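(* Suppose that $Q:\mathbb C\to\mathbb R$ is $C^2$-smooth and $p\in\mathbb R$. Then for each $N$, the planar symplectic ensemble with potential $Q$, rescaled at $p$, satisfies $$\bar\partial C_N(z)=R_N(z)-\frac{Nr_N^2}2\,\Delta Q(p+r_Nz)-\frac12\,\Delta\log R_N(z)+\frac1{(z-\bar z)^2}$$ for $z\in\mathbb C\setminus\mathbb R$.
   Context: Write $dA(\zeta)=\frac1\pi d^2\zeta$, $\partial=\frac12(\partial_x-i\partial_y)$, $\bar\partial=\frac12(\partial_x+i\partial_y)$, $\Delta=\partial\bar\partial$. The potential satisfies $Q(\zeta)=Q(\bar\zeta)$ and grows fast enough at infinity that $Z_N<\infty$. The planar symplectic ensemble with potential $Q$ is the probability measure on $\mathbb C^N$ $$d\mathbf P_N=\frac1{Z_N}e^{-\mathbf H_N(\zeta_1,\dots,\zeta_N)}\prod_{j=1}^NdA(\zeta_j),\qquad\mathbf H_N=\sum_{j\ne k}\log\frac1{|\zeta_j-\zeta_k||\zeta_j-\bar\zeta_k|}+\sum_{j=1}^N\Big(\log\frac1{|\zeta_j-\bar\zeta_j|^2}+NQ(\zeta_j)\Big)$$ (first sum over ordered pairs), with $k$-point correlation functions $$\mathbf R_{N,k}(\zeta_1,\dots,\zeta_k)=\frac1{Z_N}\frac{N!}{(N-k)!}\int_{\mathbb C^{N-k}}e^{-\mathbf H_N}\prod_{j=k+1}^NdA(\zeta_j).$$ The micro-scale $r_N>0$ at $p$ is defined by $\int_{|\zeta-p|<r_N}\frac{\Delta Q(\zeta)}2\,dA(\zeta)=\frac1N$.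 The rescaled correlation functions are $R_{N,k}(z_1,\dots,z_k)=r_N^{2k}\,\mathbf R_{N,k}(p+r_Nz_1,\dots,p+r_Nz_k)$, and $R_N=R_{N,1}$. The Berezin kernel and its Cauchy transform are $$B_N(z,w)=\frac{R_N(z)R_N(w)-R_{N,2}(z,w)}{R_N(z)},\qquad C_N(z)=\int_{\mathbb C}\frac{B_N(z,w)}{z-w}\,dA(w).$$ *)

theory Defs
  imports "HOL-Analysis.Analysis"
begin

definition dA :: "complex measure" where
  "dA = density lborel (\<lambda>_. ennreal (1 / pi))"

definition partial_x :: "(complex \<Rightarrow> complex) \<Rightarrow> complex \<Rightarrow> complex" where
  "partial_x f z = vector_derivative (\<lambda>t::real. f (z + of_real t)) (at 0)"

definition partial_y :: "(complex \<Rightarrow> complex) \<Rightarrow> complex \<Rightarrow> complex" where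
  "partial_y f z = vector_derivative (\<lambda>t::real. f (z + \<i> * of_real t)) (at 0)"

definition partial_z :: "(complex \<Rightarrow> complex) \<Rightarrow> complex \<Rightarrow> complex" where
  "partial_z f z = (partial_x f z - \<i> * partial_y f z) / 2"

definition partial_zbar :: "(complex \<Rightarrow> complex) \<Rightarrow> complex \<Rightarrow> complex" where
  "partial_zbar f z = (partial_x f z + \<i> * partial_y f z) / 2"

text \<open>The normalisation is a quarter of the usual Laplacian.\<close>

definition Lap :: "(complex \<Rightarrow> complex) \<Rightarrow> complex \<Rightarrow> complex" where
  "Lap f = partial_z (partial_zbar f)"

definition C2_smooth :: "(complex \<Rightarrow> real) \<Rightarrow> bool" where
  "C2_smooth f \<longleftrightarrow>
     (\<exists>(f' :: complex \<Rightarrow> complex \<Rightarrow>\<^sub>L real) (f'' :: complex \<Rightarrow> complex \<Rightarrow>\<^sub>L complex \<Rightarrow>\<^sub>L real).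
        (\<forall>z. (f has_derivative blinfun_apply (f' z)) (at z)) \<and>
        (\<forall>z. (f' has_derivative blinfun_apply (f'' z)) (at z)) \<and>
        continuous_on UNIV f'')"

text \<open>The energy takes the value \<open>\<infinity>\<close> where points collide with each other, with their mirror
  images, or with the real axis; there \<open>ln 0 = 0\<close> would give the wrong value.
  No summand is ever \<open>-\<infinity>\<close>.\<close>

definition log_recip :: "real \<Rightarrow> ereal" where
  "log_recip x = (if x = 0 then \<infinity> else ereal (ln (1 / x)))"

definition exp_neg :: "ereal \<Rightarrow> real" where
  "exp_neg x = (if x = \<infinity> then 0 else exp (- real_of_ereal x))"

text \<open>A configuration of \<open>N\<close> points is a function on \<open>nat\<close> whose values at \<open>0, \<dots>, N - 1\<close> matter.\<close>

definition energy :: "(complex \<Rightarrow> real) \<Rightarrow> nat \<Rightarrow> (nat \<Rightarrow> complex) \<Rightarrow> ereal" where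
  "energy Q N \<zeta> =
     (\<Sum>j<N. \<Sum>k\<in>{..<N} - {j}. log_recip (cmod (\<zeta> j - \<zeta> k) * cmod (\<zeta> j - cnj (\<zeta> k)))) +
     (\<Sum>j<N. log_recip ((cmod (\<zeta> j - cnj (\<zeta> j)))\<^sup>2) + ereal (real N * Q (\<zeta> j)))"

definition boltzmann :: "(complex \<Rightarrow> real) \<Rightarrow> nat \<Rightarrow> (nat \<Rightarrow> complex) \<Rightarrow> real" where
  "boltzmann Q N \<zeta> = exp_neg (energy Q N \<zeta>)"

text \<open>With these conventions the weight \<open>e\<^sup>-\<^sup>H\<close> is the expected product at all configurations.\<close>

lemma exp_neg_log_recip: "x \<ge> 0 \<Longrightarrow> exp_neg (log_recip x) = x"
  by (auto simp: exp_neg_def log_recip_def ln_div)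

lemma exp_neg_add:
  "x \<noteq> -\<infinity> \<Longrightarrow> y \<noteq> -\<infinity> \<Longrightarrow> exp_neg (x + y) = exp_neg x * exp_neg y"
  by (cases x; cases y) (auto simp: exp_neg_def exp_add [symmetric])

lemma exp_neg_sum:
  assumes "\<And>i. i \<in> A \<Longrightarrow> f i \<noteq> -\<infinity>"
  shows "sum f A \<noteq> -\<infinity> \<and> exp_neg (sum f A) = (\<Prod>i\<in>A. exp_neg (f i))"
  using assms
proof (induction A rule: infinite_finite_induct)
  case (insert a A)
  then show ?case by (auto simp: exp_neg_add)
qed (auto simp: exp_neg_def)

lemma boltzmann_eq:
  "boltzmann Q N \<zeta> =
     (\<Prod>j<N. \<Prod>k\<in>{..<N} - {j}. cmod (\<zeta> j - \<zeta> k) * cmod (\<zeta> j - cnj (\<zeta> k))) *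
     (\<Prod>j<N. (cmod (\<zeta> j - cnj (\<zeta> j)))\<^sup>2 * exp (- real N * Q (\<zeta> j)))"
proof -
  have L: "log_recip x \<noteq> -\<infinity>" for x by (simp add: log_recip_def)
  have L': "log_recip x + ereal y \<noteq> -\<infinity>" for x y by (simp add: log_recip_def)
  have E: "exp_neg (ereal y) = exp (- y)" for y by (simp add: exp_neg_def)
  show ?thesis
    unfolding boltzmann_def energy_def
    by (simp add: exp_neg_add exp_neg_sum L L' E exp_neg_log_recip)
qed

definition Z_part :: "(complex \<Rightarrow> real) \<Rightarrow> nat \<Rightarrow> ennreal" where
  "Z_part Q N = (\<integral>\<^sup>+ \<zeta>. ennreal (boltzmann Q N \<zeta>) \<partial>(Pi\<^sub>M {..<N} (\<lambda>_. dA)))"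

text \<open>The \<open>k\<close>-point function takes its arguments as a list of length \<open>k\<close>; they become the points
  with indices below \<open>k\<close>, and the points with indices in \<open>{k..<N}\<close> are integrated out.
  For \<open>k > N\<close> the factor \<open>N! / (N - k)!\<close> is read as the falling factorial, which is \<open>0\<close>
  (this concerns \<open>R\<^bsub>1,2\<^esub>\<close>).\<close>

definition corr :: "(complex \<Rightarrow> real) \<Rightarrow> nat \<Rightarrow> complex list \<Rightarrow> real" where
  "corr Q N zs =
     (let k = length zs in
      if k \<le> N then
        1 / enn2real (Z_part Q N) * (fact N / fact (N - k)) *
        (\<integral>\<eta>. boltzmann Q N (\<lambda>j. if j < k then zs ! j else \<eta> j) \<partial>(Pi\<^sub>M {k..<N} (\<lambda>_. dA)))
      else 0)"

definition micro_scale :: "(complex \<Rightarrow> real) \<Rightarrow> nat \<Rightarrow> real \<Rightarrow> real \<Rightarrow> bool" where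
  "micro_scale Q N p r \<longleftrightarrow> r > 0 \<and>
     set_lebesgue_integral dA {\<zeta>. cmod (\<zeta> - of_real p) < r}
       (\<lambda>\<zeta>. Lap (\<lambda>w. of_real (Q w)) \<zeta> / 2) = 1 / of_nat N"

definition corr_resc :: "(complex \<Rightarrow> real) \<Rightarrow> nat \<Rightarrow> real \<Rightarrow> real \<Rightarrow> complex list \<Rightarrow> real" where
  "corr_resc Q N p r zs =
     r ^ (2 * length zs) * corr Q N (map (\<lambda>z. of_real p + of_real r * z) zs)"

definition R1 :: "(complex \<Rightarrow> real) \<Rightarrow> nat \<Rightarrow> real \<Rightarrow> real \<Rightarrow> complex \<Rightarrow> real" where
  "R1 Q N p r z = corr_resc Q N p r [z]"

definition berezin :: "(complex \<Rightarrow> real) \<Rightarrow> nat \<Rightarrow> real \<Rightarrow> real \<Rightarrow> complex \<Rightarrow> complex \<Rightarrow> real" where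
  "berezin Q N p r z w =
     (R1 Q N p r z * R1 Q N p r w - corr_resc Q N p r [z, w]) / R1 Q N p r z"

definition cauchy_transf :: "(complex \<Rightarrow> real) \<Rightarrow> nat \<Rightarrow> real \<Rightarrow> real \<Rightarrow> complex \<Rightarrow> complex" where
  "cauchy_transf Q N p r z = (\<integral>w. of_real (berezin Q N p r z w) / (z - w) \<partial>dA)"

end

theory Submission
  imports Defs
begin

text \<open>Write \<open>\<zeta> = p + r z\<close>, let \<open>q(u) = \<Prod>\<^sub>j (u - \<eta>\<^sub>j) (u - cnj \<eta>\<^sub>j)\<close> be the polynomial whose zeros are the other particles
  and their mirror images, and let \<open>F(u)\<close> be the integral of \<open>|q(u)|\<^sup>2\<close> against the weight of these particles.
  The one-point function is a constant times \<open>|u - cnj u|\<^sup>2 e\<^sup>-\<^sup>N\<^sup>Q F(u)\<close>, and \<open>F\<close> is a polynomial in \<open>u\<close> and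
  \<open>cnj u\<close>: finiteness of the partition function forces enough moments to be finite. Since
  \<open>q'/q = \<Sum>\<^sub>j 1/(u - \<eta>\<^sub>j) + 1/(u - cnj \<eta>\<^sub>j)\<close> and the weight is symmetric under permutations and conjugation, the
  Cauchy transform of \<open>R\<^sub>2(u, \<cdot>) / R(u)\<close> equals \<open>\<partial>F / (2 F)\<close>. As the Cauchy transform of \<open>R\<close> has
  \<open>\<partial>\<close>-bar derivative \<open>R\<close>, applying \<open>\<partial>\<close>-bar to the difference gives the claim.

  Cauchy transforms are differentiated without Green's formula: an integrable \<open>f\<close>, differentiable at \<open>z\<close>, is
  \<open>f(z)\<close> times a Gaussian centred at \<open>z\<close> plus a function vanishing at \<open>z\<close>; the transform of the latter is complex
  differentiable at \<open>z\<close>, and that of the Gaussian is expanded explicitly.\<close>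

section \<open>The normalised area measure\<close>

text \<open>Off the real axis \<open>log R\<close> splits into the logarithms of the three factors
  of \<open>R\<close>, so in unscaled variables half its Laplacian is
  \<open>1/(z - cnj z)^2 - N/2 Lap Q + 1/2 Lap log F\<close>. The last summand is dbar of
  \<open>\<partial>F / (2 F)\<close>; eliminating it accounts for every term of the formula. The 1/2
  arises because each particle gives two zeros of \<open>q\<close> with equal contributions, while
  the Cauchy kernel sees only one of them. The obstacle is that \<open>Q\<close> has no prescribed
  growth. Through Fubini, a finite partition function says only that \<open>F(u)\<close> is finite
  for almost every \<open>u\<close>, whereas differentiating \<open>F\<close> and dividing its
  integrand by \<open>u - \<eta>\<^sub>j\<close> require control of all coefficients of
  \<open>q\<close>. The bridge is a set of N points \<open>s\<close> in the upper half-plane with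
  \<open>F(s)\<close> finite. A particle and its mirror image can come close to at most one of them,
  so N - 1 particles leave a point at which \<open>|q(s)|\<close> dominates all coefficients.
  Afterwards \<open>F\<close> is a finite sum and is differentiated term by term.\<close>

lemma sets_dA [simp, measurable_cong]: "sets dA = sets borel"
  by (simp add: dA_def)

lemma space_dA [simp]: "space dA = UNIV"
  by (simp add: dA_def)

lemma borel_measurable_cnj [measurable]: "cnj \<in> borel_measurable borel"
  by (intro borel_measurable_continuous_onI continuous_intros)

lemma sigma_finite_dA: "sigma_finite_measure dA"
  unfolding dA_def by (subst sigma_finite_measure.sigma_finite_iff_density_finite[OF sigma_finite_lborel]) auto

lemma emeasure_dA:
  assumes "A \<in> sets borel"
  shows "emeasure dA A = ennreal (1 / pi) * emeasure lborel A"
  using assms unfolding dA_def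
  by (subst emeasure_density) (auto intro!: nn_integral_cmult_indicator)

lemma AE_dA_neq: "AE w in dA. w \<noteq> a"
  unfolding dA_def by (subst AE_density) (auto intro: AE_mp[OF AE_lborel_singleton[of a]])

lemma emeasure_dA_cball:
  assumes "0 \<le> r"
  shows "emeasure dA (cball a r) = ennreal (r\<^sup>2)"
  using assms
  by (simp add: emeasure_dA emeasure_cball unit_ball_vol_2 flip: ennreal_mult)

lemma emeasure_dA_ball:
  assumes "0 \<le> r"
  shows "emeasure dA (ball a r) = ennreal (r\<^sup>2)"
  using assms
  by (simp add: emeasure_dA emeasure_ball unit_ball_vol_2 flip: ennreal_mult)

text \<open>Scaling real and imaginary parts separately covers conjugation, the reflection
  \<open>a - w\<close> and the dilation \<open>t + r * w\<close> by one change of variables.\<close>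

lemma distr_dA_affine:
  assumes T: "T = (\<lambda>w. t + Complex (a * Re w) (b * Im w))" and ab: "a \<noteq> 0" "b \<noteq> 0"
  shows "dA = density (distr dA borel T) (\<lambda>_. ennreal \<bar>a * b\<bar>)"
proof -
  have [measurable]: "T \<in> borel_measurable borel"
    unfolding T Complex_eq by measurable
  \<comment> \<open>The coordinate form over the basis \<open>{1, \<i>}\<close>, as
    \<open>lborel_affine_euclidean\<close> expects it.\<close>
  have T': "T = (\<lambda>w. t + (\<Sum>j\<in>Basis. ((if j = 1 then a else b) * (w \<bullet> j)) *\<^sub>R j))"
    by (auto simp: T Basis_complex_def complex_eq_iff)
  have c: "(if j = 1 then a else b) \<noteq> 0" for j :: complex using ab by simp
  have "lborel = density (distr lborel borel T) (\<lambda>_. (\<Prod>j\<in>(Basis :: complex set). \<bar>if j = 1 then a else b\<bar>))"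
    unfolding T' by (rule lborel_affine_euclidean[of "\<lambda>j. if j = 1 then a else b" t, OF c])
  also have "(\<Prod>j\<in>(Basis :: complex set). \<bar>if j = 1 then a else b\<bar>) = \<bar>a * b\<bar>"
    by (simp add: Basis_complex_def abs_mult)
  finally have L: "lborel = density (distr lborel borel T) (\<lambda>_. ennreal \<bar>a * b\<bar>)" .
  show ?thesis
  proof (rule measure_eqI)
    fix X assume "X \<in> sets dA"
    then have [measurable]: "X \<in> sets borel" by simp
    have "emeasure lborel X = ennreal \<bar>a * b\<bar> * emeasure lborel (T -` X)"
      by (subst L) (simp add: emeasure_density_const emeasure_distr)
    moreover have "T -` X \<in> sets borel" 
      using measurable_sets[of T borel borel X] by simp
    ultimately show "emeasure dA X = emeasure (density (distr dA borel T) (\<lambda>_. ennreal \<bar>a * b\<bar>)) X"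
      by (simp add: emeasure_density_const emeasure_distr emeasure_dA ac_simps)
  qed simp
qed

lemma measure_preserving_dA_affine:
  assumes "\<bar>a * b\<bar> = 1"
  shows "distr dA dA (\<lambda>w. t + Complex (a * Re w) (b * Im w)) = dA"
proof -
  have "distr dA dA (\<lambda>w. t + Complex (a * Re w) (b * Im w)) = distr dA borel (\<lambda>w. t + Complex (a * Re w) (b * Im w))"
    by (rule distr_cong) auto
  also have "\<dots> = density \<dots> (\<lambda>_. ennreal \<bar>a * b\<bar>)"
    by (simp add: assms density_1)
  also have "\<dots> = dA"
    by (rule distr_dA_affine[symmetric]) (use assms in auto)
  finally show ?thesis .
qed

lemma distr_dA_cnj: "distr dA dA cnj = dA"
proof -
  have "cnj = (\<lambda>w. 0 + Complex (1 * Re w) (-1 * Im w))"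
    by (auto simp: complex_eq_iff)
  then show ?thesis using measure_preserving_dA_affine[of 1 "-1" 0] by simp
qed

lemma distr_dA_reflect: "distr dA dA (\<lambda>w. a - w) = dA"
proof -
  have "(\<lambda>w. a - w) = (\<lambda>w. a + Complex (-1 * Re w) (-1 * Im w))"
    by (auto simp: complex_eq_iff)
  then show ?thesis using measure_preserving_dA_affine[of "-1" "-1" a] by simp
qed

lemma
  fixes f :: "complex \<Rightarrow> 'b :: {banach, second_countable_topology}"
  assumes [measurable]: "f \<in> borel_measurable borel"
  shows integral_dA_reflect: "(\<integral>w. f (a - w) \<partial>dA) = (\<integral>w. f w \<partial>dA)"
    and integrable_dA_reflect: "integrable dA (\<lambda>w. f (a - w)) \<longleftrightarrow> integrable dA f"
proof -
  have m: "(\<lambda>w. a - w) \<in> measurable dA dA" by measurable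
  show "(\<integral>w. f (a - w) \<partial>dA) = (\<integral>w. f w \<partial>dA)"
    using integral_distr[OF m, of f] by (simp add: distr_dA_reflect)
  show "integrable dA (\<lambda>w. f (a - w)) \<longleftrightarrow> integrable dA f"
    using integrable_distr_eq[OF m, of f] by (simp add: distr_dA_reflect)
qed

lemma
  fixes f :: "complex \<Rightarrow> 'b :: {banach, second_countable_topology}"
  assumes [measurable]: "f \<in> borel_measurable borel" and r: "r > 0"
  shows integral_dA_scale: "(\<integral>w. f (t + of_real r * w) \<partial>dA) = (1 / r\<^sup>2) *\<^sub>R (\<integral>w. f w \<partial>dA)"
    and integrable_dA_scale: "integrable dA (\<lambda>w. f (t + of_real r * w)) \<longleftrightarrow> integrable dA f"
proof -
  define T where "T = (\<lambda>w. t + of_real r * w)"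
  have [measurable]: "T \<in> borel_measurable dA" unfolding T_def by measurable
  have T: "T = (\<lambda>w. t + Complex (r * Re w) (r * Im w))"
    by (auto simp: complex_eq_iff T_def)
  have D: "dA = density (distr dA borel T) (\<lambda>_. ennreal (r\<^sup>2))"
    using distr_dA_affine[OF T] r by (simp add: power2_eq_square)
  have "(\<integral>w. f w \<partial>dA) = (\<integral>w. f w \<partial>density (distr dA borel T) (\<lambda>_. ennreal (r\<^sup>2)))"
    using D by simp
  also have "\<dots> = r\<^sup>2 *\<^sub>R (\<integral>w. f (T w) \<partial>dA)"
    by (subst integral_density) (auto simp: integral_distr)
  finally show "(\<integral>w. f (t + of_real r * w) \<partial>dA) = (1 / r\<^sup>2) *\<^sub>R (\<integral>w. f w \<partial>dA)"
    using r by (simp add: T_def)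
  have "integrable dA f \<longleftrightarrow> integrable (density (distr dA borel T) (\<lambda>_. ennreal (r\<^sup>2))) f"
    using D by simp
  also have "\<dots> \<longleftrightarrow> integrable dA (\<lambda>w. r\<^sup>2 *\<^sub>R f (T w))"
    by (subst integrable_density) (auto simp: integrable_distr_eq)
  also have "\<dots> \<longleftrightarrow> integrable dA (\<lambda>w. f (T w))"
  proof
    assume "integrable dA (\<lambda>w. r\<^sup>2 *\<^sub>R f (T w))"
    from integrable_scaleR_right[of "1 / r\<^sup>2", OF this] show "integrable dA (\<lambda>w. f (T w))"
      using r by simp
  qed simp
  finally show "integrable dA (\<lambda>w. f (t + of_real r * w)) \<longleftrightarrow> integrable dA f"
    by (simp add: T_def)
qed

text \<open>The factor \<open>1 / pi\<close> gives the disc of radius s the mass s^2, so the squared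
  modulus carries \<open>dA\<close> to Lebesgue measure on the half-line. This replaces polar
  coordinates.\<close>

lemma distr_dA_norm_sq:
  "distr dA borel (\<lambda>w. (cmod w)\<^sup>2) = density lborel (indicator {0..})" (is "?M = ?N")
proof (rule measure_eqI_generator_eq)
  let ?E = "range (\<lambda>a. {..a::real})"
  show "Int_stable ?E"
    by (auto simp: Int_stable_def)
  show "?E \<subseteq> Pow UNIV" by simp
  show "sets ?M = sigma_sets UNIV ?E" "sets ?N = sigma_sets UNIV ?E"
    by (simp_all add: borel_eq_atMost)
  show "range (\<lambda>n::nat. {..real n}) \<subseteq> ?E" by auto
  show "(\<Union>n::nat. {..real n}) = UNIV"
    using real_arch_simple by auto
  have M: "emeasure ?M {..a} = ennreal a" for a
  proof -
    have "x\<^sup>2 \<le> a \<longleftrightarrow> 0 \<le> a \<and> x \<le> sqrt a" if "0 \<le> x" for x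
      using that by (metis order_trans real_sqrt_ge_0_iff real_sqrt_le_iff real_sqrt_abs2 abs_of_nonneg power2_eq_square zero_le_power2)
    then have "(\<lambda>w. (cmod w)\<^sup>2) -` {..a} = (if a < 0 then {} else cball 0 (sqrt a))"
      by auto
    then show ?thesis
      by (subst emeasure_distr) (auto simp: emeasure_dA_cball ennreal_neg)
  qed
  then show "emeasure ?M {..real n} \<noteq> \<infinity>" for n by simp
  fix X assume "X \<in> ?E"
  then obtain a where X: "X = {..a}" by auto
  have "emeasure ?N {..a} = emeasure lborel {0..a}"
    by (subst emeasure_density)
       (auto simp: indicator_inter_arith[symmetric] nn_integral_indicator Int_def atLeastAtMost_def atLeast_def atMost_def)
  then show "emeasure ?M X = emeasure ?N X"
    by (cases "a \<ge> 0") (auto simp: X M ennreal_neg)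
qed

lemma nn_integral_dA_radial:
  assumes [measurable]: "f \<in> borel_measurable borel"
  shows "(\<integral>\<^sup>+w. f ((cmod w)\<^sup>2) \<partial>dA) = (\<integral>\<^sup>+t. f t * indicator {0..} t \<partial>lborel)"
proof -
  have "(\<integral>\<^sup>+w. f ((cmod w)\<^sup>2) \<partial>dA) = (\<integral>\<^sup>+t. f t \<partial>distr dA borel (\<lambda>w. (cmod w)\<^sup>2))"
    by (subst nn_integral_distr) auto
  also have "\<dots> = (\<integral>\<^sup>+t. f t * indicator {0..} t \<partial>lborel)"
    unfolding distr_dA_norm_sq by (subst nn_integral_density) (auto simp: ac_simps)
  finally show ?thesis .
qed

lemma nn_integral_gauss:
  assumes "c > 0"
  shows "(\<integral>\<^sup>+w. ennreal (exp (- c * (cmod w)\<^sup>2)) \<partial>dA) = ennreal (1 / c)"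
proof -
  have "(\<integral>\<^sup>+w. ennreal (exp (- c * (cmod w)\<^sup>2)) \<partial>dA) =
      (\<integral>\<^sup>+t. ennreal (exp (- c * t)) * indicator {0..} t \<partial>lborel)"
    by (rule nn_integral_dA_radial[of "\<lambda>t. ennreal (exp (- c * t))"]) measurable
  also have "\<dots> = ennreal (0 - (- exp (- c * 0) / c))"
  proof (rule nn_integral_FTC_atLeast)
    show "((\<lambda>t. - exp (- c * t) / c) has_real_derivative exp (- c * x)) (at x)" for x
      using assms by (auto intro!: derivative_eq_intros)
    have "((\<lambda>t. exp (- (c * t))) \<longlongrightarrow> 0) at_top"
      using assms by (intro filterlim_compose[OF exp_at_bot] filterlim_compose[OF filterlim_uminus_at_bot_at_top]
          filterlim_tendsto_pos_mult_at_top[OF tendsto_const] filterlim_ident)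
    then have "((\<lambda>t. - exp (- c * t) / c) \<longlongrightarrow> - 0 / c) at_top"
      by (intro tendsto_intros) (use assms in auto)
    then show "((\<lambda>t. - exp (- c * t) / c) \<longlongrightarrow> 0) at_top" by simp
  qed auto
  finally show ?thesis by simp
qed

lemma
  shows integrable_gauss: "c > 0 \<Longrightarrow> integrable dA (\<lambda>w. exp (- c * (cmod w)\<^sup>2))"
    and integral_gauss: "(\<integral>w. exp (- (cmod w)\<^sup>2) \<partial>dA) = 1"
proof -
  show *: "integrable dA (\<lambda>w. exp (- c * (cmod w)\<^sup>2))" if "c > 0" for c
    by (rule integrableI_nonneg) (auto simp: nn_integral_gauss[OF that, simplified])
  show "(\<integral>w. exp (- (cmod w)\<^sup>2) \<partial>dA) = 1"
    using nn_integral_gauss[of 1]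
    by (subst integral_eq_nn_integral) auto
qed

section \<open>Local integrability of a negative power of the modulus\<close>

lemma borel_measurable_truncated_powr:
  "(\<lambda>w::complex. indicator (cball 0 s) w * cmod w powr c) \<in> borel_measurable borel"
proof -
  have [measurable]: "cball 0 s \<in> sets (borel :: complex measure)" by simp
  show ?thesis by measurable
qed

text \<open>In the variable \<open>t = |w|^2\<close> the exponent -3/2 becomes -3/4, which exceeds
  -1.\<close>

lemma integrable_norm_powr:
  assumes "0 < s"
  shows "integrable dA (\<lambda>w. indicator (cball 0 s) w * cmod w powr (-3/2))"
proof (rule integrableI_nonneg)
  have "(\<integral>\<^sup>+w. ennreal (indicator (cball 0 s) w * cmod w powr (-3/2)) \<partial>dA) =
      (\<integral>\<^sup>+w. ennreal (indicator {..s\<^sup>2} ((cmod w)\<^sup>2) * ((cmod w)\<^sup>2) powr (-3/4)) \<partial>dA)"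
  proof (intro nn_integral_cong arg_cong[where f=ennreal] arg_cong2[where f="(*)"])
    fix w :: complex
    show "indicator (cball 0 s) w = (indicator {..s\<^sup>2} ((cmod w)\<^sup>2) :: real)"
      using assms by (auto simp: indicator_def power_mono_iff)
    have "(cmod w)\<^sup>2 = cmod w powr 2" by simp
    then show "cmod w powr (-3/2) = (cmod w)\<^sup>2 powr (-3/4)"
      by (simp only: powr_powr) simp
  qed
  also have "\<dots> = (\<integral>\<^sup>+t. ennreal (indicator {..s\<^sup>2} t * t powr (-3/4)) * indicator {0..} t \<partial>lborel)"
    by (rule nn_integral_dA_radial[of "\<lambda>t. ennreal (indicator {..s\<^sup>2} t * t powr (-3/4))"]) measurable
  also have "\<dots> = (\<integral>\<^sup>+t. ennreal (t powr (-3/4)) * indicator {0..s\<^sup>2} t \<partial>lborel)"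
    by (intro nn_integral_cong) (auto simp: indicator_def)
  also have "\<dots> < \<infinity>"
  proof -
    have "(\<lambda>t. t powr (-3/4)) absolutely_integrable_on {0..s\<^sup>2}"
      by (rule nonnegative_absolutely_integrable_1[OF integrable_on_powr_from_0]) auto
    then have "integrable lborel (\<lambda>t. indicator {0..s\<^sup>2} t *\<^sub>R t powr (-3/4))"
      unfolding set_integrable_def by (subst (asm) integrable_completion) auto
    then have "(\<integral>\<^sup>+t. ennreal (norm (indicator {0..s\<^sup>2} t *\<^sub>R t powr (-3/4))) \<partial>lborel) < \<infinity>"
      unfolding integrable_iff_bounded by blast
    moreover have "(\<integral>\<^sup>+t. ennreal (norm (indicator {0..s\<^sup>2} t *\<^sub>R t powr (-3/4))) \<partial>lborel) =
        (\<integral>\<^sup>+t. ennreal (t powr (-3/4)) * indicator {0..s\<^sup>2} t \<partial>lborel)"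
      by (intro nn_integral_cong) (auto simp: indicator_def)
    ultimately show ?thesis by simp
  qed
  finally show "(\<integral>\<^sup>+w. ennreal (indicator (cball 0 s) w * cmod w powr (-3/2)) \<partial>dA) < \<infinity>" .
  show "(\<lambda>w. indicator (cball 0 s) w * cmod w powr (-3/2)) \<in> borel_measurable dA"
    using borel_measurable_truncated_powr[of s "-3/2"] by simp
qed auto

section \<open>Cauchy transforms\<close>

definition cauchy_tr :: "(complex \<Rightarrow> complex) \<Rightarrow> complex \<Rightarrow> complex" where
  "cauchy_tr f u = (\<integral>w. f w / (u - w) \<partial>dA)"

text \<open>The bound at \<open>u = z\<close> already forces \<open>\<rho> z = 0\<close>. Dividing
  by the distance then leaves a square root of the distance, which tends to 0.\<close>

lemma has_derivative_zero_three_halves: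
  fixes \<rho> :: "complex \<Rightarrow> complex"
  assumes "0 < \<delta>" and "\<And>u. cmod (u - z) < \<delta> \<Longrightarrow> cmod (\<rho> u) \<le> K * cmod (u - z) powr (3/2)"
  shows "(\<rho> has_derivative (\<lambda>_. 0)) (at z)"
proof (rule has_derivativeI_sandwich[where e = \<delta> and H = "\<lambda>u. K * cmod (u - z) powr (1/2)"])
  have "\<rho> z = 0" using assms(2)[of z] assms(1) by simp
  fix u assume "u \<noteq> z" "dist u z < \<delta>"
  then have "cmod (\<rho> u) \<le> K * cmod (u - z) powr (3/2)"
    using assms(2)[of u] by (simp add: dist_norm)
  moreover have "cmod (u - z) powr (3/2) = cmod (u - z) powr (1/2) * cmod (u - z)"
    using \<open>u \<noteq> z\<close> powr_add[of "cmod (u - z)" "1/2" 1] by simp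
  ultimately show "cmod (\<rho> u - \<rho> z - 0) / cmod (u - z) \<le> K * cmod (u - z) powr (1/2)"
    using \<open>u \<noteq> z\<close> \<open>\<rho> z = 0\<close> by (simp add: divide_le_eq mult.assoc)
next
  have "((\<lambda>u. K * cmod (u - z) powr (1/2)) \<longlongrightarrow> K * cmod (z - z) powr (1/2)) (at z)"
    by (intro tendsto_intros tendsto_powr') auto
  then show "((\<lambda>u. K * cmod (u - z) powr (1/2)) \<longlongrightarrow> 0) (at z)" by simp
qed (use assms in auto)

text \<open>Both singularities \<open>1 / a\<close> and \<open>d\<^sup>2 / (a * b)\<close> are traded for the exponent \<open>-3/2\<close>, which is still
  locally integrable in the plane and leaves \<open>d powr (3/2) = o(d)\<close>.\<close>

lemma inverse_le_powr_three_halves: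
  fixes a s :: real
  assumes "0 < a" "a \<le> s"
  shows "1 / a \<le> sqrt s * a powr (-3/2)"
proof -
  have "1 / a = a powr (1/2) * a powr (-3/2)"
    using assms by (subst powr_add[symmetric]) (simp add: powr_neg_one)
  also have "\<dots> \<le> sqrt s * a powr (-3/2)"
    using assms by (intro mult_right_mono) (auto simp: powr_half_sqrt)
  finally show ?thesis .
qed

lemma inverse_mult_le_powr_three_halves:
  fixes a b d :: real
  assumes "0 < a" "0 < b" "0 < d" "d \<le> a + b"
  shows "d\<^sup>2 / (a * b) \<le> d powr (3/2) * (2 * (a powr (-3/2) + b powr (-3/2)))"
proof -
  \<comment> \<open>By symmetry let \<open>a\<close> be the smaller distance. Then
    \<open>d \<le> 2 * b\<close>, and the power \<open>b powr (-1/2)\<close> that survives is at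
    most \<open>a powr (-1/2)\<close>.\<close>
  have *: "d powr (1/2) / (a * b) \<le> 2 * (a powr (-3/2) + b powr (-3/2))"
    if "0 < a" "a \<le> b" "d \<le> a + b" for a b
  proof -
    have "d powr (1/2) / (a * b) \<le> (2 * b) powr (1/2) / (a * b)"
      using that assms by (intro divide_right_mono powr_mono2) auto
    also have "\<dots> = 2 powr (1/2) * (b powr (1/2) * b powr (-1)) * a powr (-1)"
      using that by (simp add: powr_mult powr_neg_one)
    also have "\<dots> = 2 powr (1/2) * b powr (-1/2) * a powr (-1)"
      by (subst powr_add[symmetric]) simp
    also have "\<dots> \<le> 2 powr 1 * a powr (-1/2) * a powr (-1)"
      using that by (intro mult_mono powr_mono powr_mono2') auto
    also have "\<dots> = 2 * (a powr (-1/2) * a powr (-1))"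
      by (metis mult.assoc powr_one zero_le_numeral)
    also have "a powr (-1/2) * a powr (-1) = a powr (-3/2)"
      by (subst powr_add[symmetric]) simp
    also have "2 * a powr (-3/2) \<le> 2 * (a powr (-3/2) + b powr (-3/2))" by simp
    finally show ?thesis .
  qed
  have "d powr (1/2) / (a * b) \<le> 2 * (a powr (-3/2) + b powr (-3/2))"
    using *[of a b] *[of b a] assms by (cases "a \<le> b") (auto simp: ac_simps)
  then have "d powr (3/2) * (d powr (1/2) / (a * b)) \<le> d powr (3/2) * (2 * (a powr (-3/2) + b powr (-3/2)))"
    by (intro mult_left_mono) auto
  moreover have "d\<^sup>2 = d powr (3/2) * d powr (1/2)"
    using assms by (subst powr_add[symmetric]) simp
  ultimately show ?thesis by simp
qed

lemma integrable_norm_powr_at: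
  assumes "0 < s"
  shows "integrable dA (\<lambda>w. indicator (cball u s) w * cmod (u - w) powr (-3/2))"
proof -
  have "integrable dA (\<lambda>w. (\<lambda>w. indicator (cball 0 s) w * cmod w powr (-3/2)) (u - w))"
    by (subst integrable_dA_reflect) (use integrable_norm_powr[OF assms] borel_measurable_truncated_powr[of s "-3/2"] in auto)
  moreover have "indicator (cball 0 s) (u - w) = (indicator (cball u s) w :: real)" for w
    by (simp add: indicator_def dist_norm norm_minus_commute)
  ultimately show ?thesis by simp
qed

text \<open>Independence of the centre \<open>u\<close> makes the remainder estimate for the
  transform uniform in \<open>u\<close>.\<close>

lemma integral_norm_powr_at:
  "(\<integral>w. indicator (cball u s) w * cmod (u - w) powr (-3/2) \<partial>dA) =
   (\<integral>w. indicator (cball 0 s) w * cmod w powr (-3/2) \<partial>dA)"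
proof -
  have "(\<integral>w. indicator (cball u s) w * cmod (u - w) powr (-3/2) \<partial>dA) =
      (\<integral>w. (\<lambda>w. indicator (cball 0 s) w * cmod w powr (-3/2)) (u - w) \<partial>dA)"
    by (intro Bochner_Integration.integral_cong) (auto simp: indicator_def dist_norm norm_minus_commute)
  also have "\<dots> = (\<integral>w. indicator (cball 0 s) w * cmod w powr (-3/2) \<partial>dA)"
    by (rule integral_dA_reflect) (rule borel_measurable_truncated_powr)
  finally show ?thesis .
qed

text \<open>Within \<open>\<delta> / 2\<close> of the pole \<open>u\<close> the function is bounded,
  because that disc lies in the ball around \<open>z\<close>, and the kernel is locally integrable.
  Elsewhere the kernel is at most \<open>2 / \<delta>\<close> and \<open>f\<close> itself is
  integrable.\<close>

lemma integrable_div_diff: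
  fixes f :: "complex \<Rightarrow> complex"
  assumes f: "integrable dA f" and \<delta>: "0 < \<delta>" and M: "\<And>w. cmod (w - z) < \<delta> \<Longrightarrow> cmod (f w) \<le> M"
    and u: "cmod (u - z) < \<delta> / 2"
  shows "integrable dA (\<lambda>w. f w / (u - w))"
proof (rule Bochner_Integration.integrable_bound)
  have [measurable]: "f \<in> borel_measurable borel"
    using borel_measurable_integrable[OF f] by simp
  show "integrable dA (\<lambda>w. M * sqrt \<delta> * (indicator (cball u \<delta>) w * cmod (u - w) powr (-3/2)) + 2 / \<delta> * cmod (f w))"
    by (intro Bochner_Integration.integrable_add integrable_mult_right integrable_norm_powr_at integrable_norm f \<delta>)
  show "(\<lambda>w. f w / (u - w)) \<in> borel_measurable dA" by measurable
  have M0: "0 \<le> M" using order_trans[OF norm_ge_zero M[of z]] \<delta> by simp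
  show "AE w in dA. cmod (f w / (u - w)) \<le>
      norm (M * sqrt \<delta> * (indicator (cball u \<delta>) w * cmod (u - w) powr (-3/2)) + 2 / \<delta> * cmod (f w))"
  proof (rule AE_mp[OF AE_dA_neq[of u]], rule AE_I2, rule impI)
    fix w assume w: "w \<noteq> u"
    have nn: "0 \<le> M * sqrt \<delta> * (indicator (cball u \<delta>) w * cmod (u - w) powr (-3/2))"
      using M0 \<delta> by simp
    show "cmod (f w / (u - w)) \<le>
      norm (M * sqrt \<delta> * (indicator (cball u \<delta>) w * cmod (u - w) powr (-3/2)) + 2 / \<delta> * cmod (f w))"
    proof (cases "cmod (u - w) < \<delta> / 2")
      case True
      then have "cmod (w - z) < \<delta>"
        using u norm_triangle_lt[of "w - u" "u - z" \<delta>] by (simp add: norm_minus_commute)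
      then have "cmod (f w) * (1 / cmod (u - w)) \<le> M * (sqrt \<delta> * cmod (u - w) powr (-3/2))"
        using True w M0 \<delta> by (intro mult_mono M inverse_le_powr_three_halves) auto
      moreover have "w \<in> cball u \<delta>" using True \<delta> by (simp add: dist_norm)
      ultimately show ?thesis using nn \<delta> by (simp add: norm_divide mult.assoc add_increasing2)
    next
      case False
      then have "cmod (f w) * (1 / cmod (u - w)) \<le> cmod (f w) * (2 / \<delta>)"
        using \<delta> w by (intro mult_left_mono) (auto simp: field_simps)
      then show ?thesis using nn \<delta> by (simp add: norm_divide mult.commute)
    qed
  qed
qed

text \<open>For \<open>a = z - w\<close> and \<open>b = u - w\<close> this is the exact remainder of
  \<open>h / (u - w)\<close> after its first-order expansion in \<open>u\<close> at
  \<open>z\<close>.\<close>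

lemma cauchy_kernel_taylor:
  fixes a b h :: complex
  assumes "a \<noteq> 0" "b \<noteq> 0"
  shows "h / b - h / a + (b - a) * (h / a\<^sup>2) = h * ((b - a)\<^sup>2 / (a\<^sup>2 * b))"
  using assms by (simp add: field_simps power2_eq_square)

text \<open>Since \<open>h\<close> vanishes linearly at \<open>z\<close>, the formally
  differentiated integrand has a singularity of order only 1 and is integrable. The kernel is
  holomorphic in \<open>u\<close>, so the derivative is complex linear.\<close>

lemma cauchy_tr_has_derivative_vanishing:
  fixes h :: "complex \<Rightarrow> complex"
  assumes h: "integrable dA h" and \<delta>: "0 < \<delta>"
    and K: "\<And>w. cmod (w - z) < \<delta> \<Longrightarrow> cmod (h w) \<le> K * cmod (w - z)"
  shows "\<exists>c. (cauchy_tr h has_derivative (\<lambda>d. c * d)) (at z)"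
proof -
  have [measurable]: "h \<in> borel_measurable borel"
    using borel_measurable_integrable[OF h] by simp
  have K0: "0 \<le> K" 
  proof -
    have "0 \<le> K * cmod (\<delta> / 2)"
      using K[of "z + \<delta> / 2"] \<delta> norm_ge_zero[of "h (z + \<delta> / 2)"] by (simp del: norm_ge_zero)
    then show ?thesis using \<delta> by (simp add: zero_le_mult_iff)
  qed
  have [simp]: "h z = 0" using K[of z] \<delta> by simp
  have bnd: "cmod (h w) \<le> K * \<delta>" if "cmod (w - z) < \<delta>" for w
    using K[OF that] that K0 by (meson less_imp_le mult_left_mono order_trans)
  have int: "integrable dA (\<lambda>w. h w / (u - w))" if "cmod (u - z) < \<delta> / 2" for u
    using integrable_div_diff[OF h \<delta> bnd that] .
  have split: "cmod (h w) \<le> K * cmod (z - w) \<or> (\<delta> \<le> cmod (z - w))" for w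
    using K[of w] by (force simp: norm_minus_commute)
  have int2: "integrable dA (\<lambda>w. h w / (z - w)\<^sup>2)"
  proof (rule Bochner_Integration.integrable_bound)
    show "integrable dA (\<lambda>w. K * sqrt \<delta> * (indicator (cball z \<delta>) w * cmod (z - w) powr (-3/2)) + 1 / \<delta>\<^sup>2 * cmod (h w))"
      by (intro Bochner_Integration.integrable_add integrable_mult_right integrable_norm_powr_at integrable_norm h \<delta>)
    show "(\<lambda>w. h w / (z - w)\<^sup>2) \<in> borel_measurable dA" by measurable
    show "AE w in dA. norm (h w / (z - w)\<^sup>2)
         \<le> norm (K * sqrt \<delta> * (indicator (cball z \<delta>) w * cmod (z - w) powr (-3/2)) + 1 / \<delta>\<^sup>2 * cmod (h w))"
    proof (rule AE_I2)
      fix w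
      have nn: "0 \<le> K * sqrt \<delta> * (indicator (cball z \<delta>) w * cmod (z - w) powr (-3/2))"
        using K0 \<delta> by simp
      show "norm (h w / (z - w)\<^sup>2)
         \<le> norm (K * sqrt \<delta> * (indicator (cball z \<delta>) w * cmod (z - w) powr (-3/2)) + 1 / \<delta>\<^sup>2 * cmod (h w))"
      proof (cases "cmod (z - w) < \<delta> \<and> w \<noteq> z")
        case True
        then have "cmod (h w) / (cmod (z - w))\<^sup>2 \<le> K * cmod (z - w) / (cmod (z - w))\<^sup>2"
          using split[of w] by (intro divide_right_mono) auto
        also have "\<dots> = K * (1 / cmod (z - w))"
          by (simp add: power2_eq_square)
        also have "\<dots> \<le> K * (sqrt \<delta> * cmod (z - w) powr (-3/2))"
          using True K0 by (intro mult_left_mono inverse_le_powr_three_halves) auto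
        finally have "cmod (h w) / (cmod (z - w))\<^sup>2 \<le> K * (sqrt \<delta> * cmod (z - w) powr (-3/2))" .
        moreover have "w \<in> cball z \<delta>" using True by (simp add: dist_norm)
        ultimately show ?thesis using nn \<delta> by (simp add: norm_divide norm_power mult.assoc add_increasing2)
      next
        case False
        then have "cmod (h w) * (1 / (cmod (z - w))\<^sup>2) \<le> cmod (h w) * (1 / \<delta>\<^sup>2)"
          using \<delta> by (cases "w = z") (auto intro!: mult_left_mono divide_left_mono power_mono)
        then show ?thesis using nn \<delta> by (simp add: norm_divide norm_power)
      qed
    qed
  qed
  define c where "c = - (\<integral>w. h w / (z - w)\<^sup>2 \<partial>dA)"
  \<comment> \<open>Radius \<open>2 * \<delta>\<close> ensures that the discs around
    \<open>z\<close> and around \<open>u\<close> both contain every \<open>w\<close> with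
    \<open>|z - w| < \<delta>\<close>. The first summand of \<open>L\<close> accounts for these
    \<open>w\<close>, the second for the remaining ones.\<close>
  define P where "P = (\<integral>w. indicator (cball 0 (2 * \<delta>)) w * cmod w powr (-3/2) \<partial>dA)"
  define H where "H = (\<integral>w. cmod (h w) \<partial>dA)"
  define L where "L = 4 * K * P + 2 / \<delta> ^ 3 * sqrt \<delta> * H"
  have "((\<lambda>u. cauchy_tr h u - cauchy_tr h z - c * (u - z)) has_derivative (\<lambda>_. 0)) (at z)"
  proof (rule has_derivative_zero_three_halves)
    show "0 < \<delta> / 2" using \<delta> by simp
    fix u assume u: "cmod (u - z) < \<delta> / 2"
    define d where "d = u - z"
    let ?r = "\<lambda>w. h w / (u - w) - h w / (z - w) + d * (h w / (z - w)\<^sup>2)"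
    let ?g = "\<lambda>w. 2 * K * (cmod d powr (3/2) * (indicator (cball z (2 * \<delta>)) w * cmod (z - w) powr (-3/2)) +
         cmod d powr (3/2) * (indicator (cball u (2 * \<delta>)) w * cmod (u - w) powr (-3/2))) +
         2 / \<delta> ^ 3 * (cmod d)\<^sup>2 * cmod (h w)"
    have zu: "cmod (z - z) < \<delta> / 2" using \<delta> by simp
    have eq: "cauchy_tr h u - cauchy_tr h z - c * (u - z) = (\<integral>w. ?r w \<partial>dA)"
      using int[OF u] int[OF zu] int2 by (simp add: cauchy_tr_def c_def d_def del: times_divide_eq_right)
    have "cmod (\<integral>w. ?r w \<partial>dA) \<le> (\<integral>w. cmod (?r w) \<partial>dA)"
      by (rule integral_norm_bound)
    also have "\<dots> \<le> (\<integral>w. ?g w \<partial>dA)"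
    proof (rule integral_mono_AE)
      show "integrable dA (\<lambda>w. cmod (?r w))"
        by (intro integrable_norm Bochner_Integration.integrable_add Bochner_Integration.integrable_diff
            integrable_mult_right int[OF u] int[OF zu] int2)
      show "integrable dA ?g"
        using \<delta> by (intro Bochner_Integration.integrable_add integrable_mult_right integrable_norm_powr_at integrable_norm h) auto
      show "AE w in dA. cmod (?r w) \<le> ?g w"
        using AE_dA_neq[of z] AE_dA_neq[of u]
      proof eventually_elim
        case (elim w)
        define a where "a = cmod (z - w)"
        define b where "b = cmod (u - w)"
        have ab: "0 < a" "0 < b" using elim by (auto simp: a_def b_def)
        have bd: "b \<le> a + cmod d" "a \<le> b + cmod d" "cmod d \<le> a + b"
          using norm_triangle_ineq[of "z - w" d] norm_triangle_ineq4[of "u - w" d]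
            norm_triangle_ineq4[of "u - w" "z - w"]
          by (auto simp: a_def b_def d_def algebra_simps)
        have "?r w = h w * (d\<^sup>2 / ((z - w)\<^sup>2 * (u - w)))"
          using cauchy_kernel_taylor[of "z - w" "u - w" "h w"] elim by (simp add: d_def)
        then have r: "cmod (?r w) = cmod (h w) * ((cmod d)\<^sup>2 / (a\<^sup>2 * b))"
          by (simp add: norm_mult norm_divide norm_power a_def b_def)
        show ?case
        proof (cases "d = 0")
          case True
          then show ?thesis using K0 \<delta> by (simp add: d_def)
        next
          case False
          show ?thesis
          proof (cases "a < \<delta>")
            case True
            then have h: "cmod (h w) \<le> K * a" using split[of w] by (auto simp: a_def)
            have "cmod (?r w) \<le> K * a * ((cmod d)\<^sup>2 / (a\<^sup>2 * b))"
              unfolding r using h ab by (intro mult_right_mono) auto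
            also have "\<dots> = K * ((cmod d)\<^sup>2 / (a * b))"
              using ab by (simp add: power2_eq_square)
            also have "\<dots> \<le> K * (cmod d powr (3/2) * (2 * (a powr (-3/2) + b powr (-3/2))))"
              using ab False bd K0 by (intro mult_left_mono inverse_mult_le_powr_three_halves) auto
            also have "\<dots> \<le> ?g w"
            proof -
              have "w \<in> cball z (2 * \<delta>)" "w \<in> cball u (2 * \<delta>)"
                using True bd u \<delta> by (auto simp: dist_norm a_def b_def d_def)
              then show ?thesis using \<delta> by (simp add: a_def b_def algebra_simps)
            qed
            finally show ?thesis .
          next
            case False
            \<comment> \<open>Far from \<open>z\<close> only integrability of \<open>h\<close> is
              available, but there both distances are bounded below.\<close>
            then have "\<delta> / 2 \<le> b" using bd u by (simp add: d_def)
            then have "\<delta>\<^sup>2 * (\<delta> / 2) \<le> a\<^sup>2 * b"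
              using False \<delta> by (intro mult_mono power_mono) auto
            then have "(cmod d)\<^sup>2 / (a\<^sup>2 * b) \<le> (cmod d)\<^sup>2 / (\<delta>\<^sup>2 * (\<delta> / 2))"
              using \<delta> ab by (intro divide_left_mono mult_pos_pos) auto
            then have "cmod (?r w) \<le> cmod (h w) * ((cmod d)\<^sup>2 / (\<delta>\<^sup>2 * (\<delta> / 2)))"
              unfolding r by (intro mult_left_mono) auto
            also have "\<dots> = 2 / \<delta> ^ 3 * (cmod d)\<^sup>2 * cmod (h w)"
              by (simp add: power2_eq_square power3_eq_cube)
            also have "\<dots> \<le> ?g w"
              using K0 by simp
            finally show ?thesis .
          qed
        qed
      qed
    qed
    also have "(\<integral>w. ?g w \<partial>dA) = 4 * K * P * cmod d powr (3/2) + 2 / \<delta> ^ 3 * H * (cmod d)\<^sup>2"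
    proof -
      have 2: "0 < 2 * \<delta>" using \<delta> by simp
      show ?thesis
        using integrable_norm_powr_at[OF 2, of z] integrable_norm_powr_at[OF 2, of u] h
          integral_norm_powr_at[of z "2 * \<delta>"] integral_norm_powr_at[of u "2 * \<delta>"]
        by (simp add: P_def H_def)
    qed
    also have "\<dots> \<le> L * cmod d powr (3/2)"
    proof -
      have "(cmod d)\<^sup>2 = cmod d powr (1/2) * cmod d powr (3/2)"
        by (subst powr_add[symmetric]) simp
      also have "\<dots> \<le> sqrt \<delta> * cmod d powr (3/2)"
        using u \<delta> by (intro mult_right_mono) (auto simp: powr_half_sqrt d_def)
      finally have "2 / \<delta> ^ 3 * H * (cmod d)\<^sup>2 \<le> 2 / \<delta> ^ 3 * H * (sqrt \<delta> * cmod d powr (3/2))"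
        using \<delta> by (intro mult_left_mono) (auto simp: H_def)
      then show ?thesis by (simp add: L_def algebra_simps)
    qed
    finally show "cmod (cauchy_tr h u - cauchy_tr h z - c * (u - z)) \<le> L * cmod (u - z) powr (3/2)"
      unfolding eq d_def .
  qed
  then have "((\<lambda>u. (cauchy_tr h u - cauchy_tr h z - c * (u - z)) + (cauchy_tr h z + c * (u - z))) has_derivative (\<lambda>d. 0 + c * d)) (at z)"
    by (rule has_derivative_add) (auto intro!: derivative_eq_intros)
  then show ?thesis by (intro exI[of _ c]) simp
qed

text \<open>All of it follows from \<open>1 + s \<le> exp s\<close>, used at \<open>s\<close> and at
  \<open>- s\<close>. The crude factor \<open>exp \<bar>s\<bar>\<close> is later absorbed by a
  Gaussian.\<close>

lemma abs_exp_remainder_le: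
  fixes s :: real
  shows "\<bar>exp s - 1 - s\<bar> \<le> s\<^sup>2 * exp \<bar>s\<bar>"
proof -
  have "1 - s \<le> exp (- s)" using exp_ge_add_one_self[of "- s"] by simp
  then have "exp s * (1 - s) \<le> exp s * exp (- s)" by (intro mult_left_mono) auto
  then have "exp s - 1 \<le> s * exp s" by (simp add: exp_minus algebra_simps)
  then have 1: "exp s - 1 - s \<le> s * (exp s - 1)" by (simp add: algebra_simps)
  have "\<bar>exp s - 1\<bar> \<le> \<bar>s\<bar> * exp \<bar>s\<bar>"
  proof (cases "0 \<le> s")
    case True
    then show ?thesis using \<open>exp s - 1 \<le> s * exp s\<close> by simp
  next
    case False
    have "1 - exp s \<le> - s * 1" using exp_ge_add_one_self[of s] by linarith
    also have "\<dots> \<le> - s * exp (- s)" using False by (intro mult_left_mono) auto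
    finally show ?thesis using False by simp
  qed
  then have "\<bar>s\<bar> * \<bar>exp s - 1\<bar> \<le> \<bar>s\<bar> * (\<bar>s\<bar> * exp \<bar>s\<bar>)"
    by (intro mult_left_mono) auto
  moreover have "s * (exp s - 1) \<le> \<bar>s\<bar> * \<bar>exp s - 1\<bar>"
    using abs_ge_self[of "s * (exp s - 1)"] by (simp add: abs_mult)
  moreover have "\<bar>s\<bar> * (\<bar>s\<bar> * exp \<bar>s\<bar>) = s\<^sup>2 * exp \<bar>s\<bar>" 
    by (simp add: power2_eq_square)
  ultimately show ?thesis using 1 exp_ge_add_one_self[of s] by linarith
qed

text \<open>With \<open>v = u - w\<close> and \<open>d = u - z\<close> the pole moves to the origin
  and the Gaussian factors as \<open>exp (-|d|^2) * exp (-|v|^2) * exp (s d v)\<close>, where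
  \<open>s d v = d * cnj v + cnj d * v\<close>. In the linear term of the last exponential,
  \<open>cnj d * v\<close> cancels the pole and leaves the total Gaussian mass 1: this is the
  antiholomorphic part of the derivative.\<close>

lemma cauchy_tr_gauss_has_derivative:
  "\<exists>\<alpha>. (cauchy_tr (\<lambda>w. of_real (exp (- (cmod (w - z))\<^sup>2))) has_derivative (\<lambda>d. \<alpha> * d + cnj d)) (at z)"
proof -
  let ?G = "\<lambda>v. exp (- (cmod v)\<^sup>2)"
  define s where "s = (\<lambda>d v. 2 * Re (d * cnj v))"
  have [measurable]: "s d \<in> borel_measurable borel" for d unfolding s_def by measurable
  have G: "integrable dA ?G" using integrable_gauss[of 1] by simp
  have iA: "integrable dA (\<lambda>v. of_real (?G v) / v)"
  proof -
    have "integrable dA (\<lambda>v. complex_of_real (?G v) / (0 - v))"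
      by (rule integrable_div_diff[where \<delta> = 1 and z = 0 and M = 1]) (use G in auto)
    then have "integrable dA (\<lambda>v. - (complex_of_real (?G v) / (0 - v)))"
      by (rule Bochner_Integration.integrable_minus)
    then show ?thesis by simp
  qed
  have i\<alpha>: "integrable dA (\<lambda>v. of_real (?G v) * cnj v / v)"
  proof (rule Bochner_Integration.integrable_bound[OF G])
    show "AE v in dA. norm (of_real (?G v) * cnj v / v) \<le> norm (?G v)"
      by (rule AE_I2) (simp add: norm_divide norm_mult divide_le_eq)
  qed measurable
  \<comment> \<open>For \<open>|d| < 1\<close> the second-order remainder divided by
    \<open>|v|\<close> is at most \<open>|d|^2\<close> times this integrand. The constant 9/2 comes
    from \<open>(|v| - 3)^2 \<ge> 0\<close>.\<close>
  have iJ: "integrable dA (\<lambda>v. ?G v * (4 * cmod v * exp (2 * cmod v)))"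
  proof (rule Bochner_Integration.integrable_bound)
    show "integrable dA (\<lambda>v. 4 * exp (9/2) * exp (- (1/2) * (cmod v)\<^sup>2))"
      by (intro integrable_mult_right integrable_gauss) simp
    show "AE v in dA. norm (?G v * (4 * cmod v * exp (2 * cmod v))) \<le> norm (4 * exp (9/2) * exp (- (1/2) * (cmod v)\<^sup>2))"
    proof (rule AE_I2)
      fix v :: complex
      have "cmod v \<le> exp (cmod v)" using exp_ge_add_one_self[of "cmod v"] by linarith
      then have "?G v * (4 * cmod v * exp (2 * cmod v)) \<le> ?G v * (4 * exp (cmod v) * exp (2 * cmod v))"
        by (intro mult_left_mono mult_right_mono) auto
      also have "\<dots> = 4 * exp (3 * cmod v - (cmod v)\<^sup>2)"
        by (simp flip: exp_add)
      also have "3 * cmod v - (cmod v)\<^sup>2 \<le> 9/2 - (1/2) * (cmod v)\<^sup>2"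
        using zero_le_power2[of "cmod v - 3"] by (simp add: power2_diff algebra_simps)
      then have "4 * exp (3 * cmod v - (cmod v)\<^sup>2) \<le> 4 * exp (9/2 - (1/2) * (cmod v)\<^sup>2)"
        by simp
      also have "\<dots> = 4 * exp (9/2) * exp (- (1/2) * (cmod v)\<^sup>2)"
        by (simp flip: exp_add)
      finally show "norm (?G v * (4 * cmod v * exp (2 * cmod v))) \<le> norm (4 * exp (9/2) * exp (- (1/2) * (cmod v)\<^sup>2))"
        by (simp add: abs_mult)
    qed
  qed measurable
  define A where "A = (\<integral>v. of_real (?G v) / v \<partial>dA)"
  define \<alpha> where "\<alpha> = (\<integral>v. of_real (?G v) * cnj v / v \<partial>dA)"
  define J where "J = (\<integral>v. ?G v * (4 * cmod v * exp (2 * cmod v)) \<partial>dA)"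
  define \<rho> where "\<rho> = (\<lambda>d. \<integral>v. of_real (?G v * (exp (s d v) - 1 - s d v)) / v \<partial>dA)"
  have bound: "cmod (of_real (?G v * (exp (s d v) - 1 - s d v)) / v) \<le> (cmod d)\<^sup>2 * (?G v * (4 * cmod v * exp (2 * cmod v)))"
    if d: "cmod d < 1" for d v
  proof (cases "v = 0")
    case False
    have "\<bar>s d v\<bar> \<le> 2 * (cmod d * cmod v)"
      using abs_Re_le_cmod[of "d * cnj v"] by (simp add: s_def norm_mult)
    moreover have "cmod d * cmod v \<le> 1 * cmod v"
      using d by (intro mult_right_mono) auto
    ultimately have s: "\<bar>s d v\<bar> \<le> 2 * (cmod d * cmod v)" "\<bar>s d v\<bar> \<le> 2 * cmod v" by auto
    have "\<bar>exp (s d v) - 1 - s d v\<bar> \<le> \<bar>s d v\<bar>\<^sup>2 * exp \<bar>s d v\<bar>"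
      using abs_exp_remainder_le[of "s d v"] by simp
    also have "\<dots> \<le> (2 * (cmod d * cmod v))\<^sup>2 * exp (2 * cmod v)"
      using s by (intro mult_mono power_mono) auto
    finally have "?G v * \<bar>exp (s d v) - 1 - s d v\<bar> / cmod v \<le> ?G v * ((2 * (cmod d * cmod v))\<^sup>2 * exp (2 * cmod v)) / cmod v"
      by (intro divide_right_mono mult_left_mono) auto
    also have "\<dots> = (cmod d)\<^sup>2 * (?G v * (4 * cmod v * exp (2 * cmod v)))"
      using False by (simp add: power2_eq_square field_simps)
    finally show ?thesis by (simp only: norm_divide norm_mult norm_of_real abs_mult abs_exp_cancel)
  qed simp
  have i\<rho>: "integrable dA (\<lambda>v. of_real (?G v * (exp (s d v) - 1 - s d v)) / v :: complex)" if d: "cmod d < 1" for d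
  proof (rule Bochner_Integration.integrable_bound)
    show "integrable dA (\<lambda>v. (cmod d)\<^sup>2 * (?G v * (4 * cmod v * exp (2 * cmod v))))"
      by (intro integrable_mult_right iJ)
    show "AE v in dA. cmod (of_real (?G v * (exp (s d v) - 1 - s d v)) / v)
        \<le> norm ((cmod d)\<^sup>2 * (?G v * (4 * cmod v * exp (2 * cmod v))))"
      by (rule AE_I2, rule order_trans[OF bound[OF d]]) simp
  qed measurable
  have \<rho>_bound: "cmod (\<rho> d) \<le> J * cmod (d - 0) powr (3/2)" if "cmod (d - 0) < 1" for d
  proof -
    have d: "cmod d < 1" using that by simp
    have "cmod (\<rho> d) \<le> (\<integral>v. (cmod d)\<^sup>2 * (?G v * (4 * cmod v * exp (2 * cmod v))) \<partial>dA)"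
      unfolding \<rho>_def
      by (rule Bochner_Integration.integral_norm_bound_integral) (use i\<rho>[OF d] iJ bound[OF d] in auto)
    also have "\<dots> = J * (cmod d)\<^sup>2" by (simp add: J_def)
    also have "(cmod d)\<^sup>2 = cmod d powr 2" by simp
    also have "J * \<dots> \<le> J * cmod d powr (3/2)"
      using d by (intro mult_left_mono powr_mono') (auto simp: J_def)
    finally show ?thesis by simp
  qed
  have eq: "cauchy_tr (\<lambda>w. of_real (exp (- (cmod (w - z))\<^sup>2))) u =
      of_real (?G (u - z)) * (A + \<alpha> * (u - z) + cnj (u - z) + \<rho> (u - z))" if u: "cmod (u - z) < 1" for u
  proof -
    define d where "d = u - z"
    have d: "cmod d < 1" using u by (simp add: d_def)
    have "cauchy_tr (\<lambda>w. of_real (exp (- (cmod (w - z))\<^sup>2))) u =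
        (\<integral>v. of_real (?G (d - v)) / v \<partial>dA)"
      unfolding cauchy_tr_def
      by (subst integral_dA_reflect[of _ u, symmetric]) (auto simp: d_def algebra_simps)
    also have "\<dots> = (\<integral>v. of_real (?G d) * (of_real (?G v) / v + d * (of_real (?G v) * cnj v / v) +
        cnj d * of_real (?G v) + of_real (?G v * (exp (s d v) - 1 - s d v)) / v) \<partial>dA)"
    proof (rule integral_cong_AE)
      show "AE v in dA. of_real (?G (d - v)) / v = of_real (?G d) * (of_real (?G v) / v + d * (of_real (?G v) * cnj v / v) +
        cnj d * of_real (?G v) + of_real (?G v * (exp (s d v) - 1 - s d v)) / v)"
        using AE_dA_neq[of 0]
      proof eventually_elim
        case (elim v)
        have "- (cmod (d - v))\<^sup>2 = - (cmod d)\<^sup>2 + (- (cmod v)\<^sup>2) + s d v"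
          unfolding cmod_power2 s_def by (simp add: power2_eq_square algebra_simps)
        then have G: "?G (d - v) = ?G d * ?G v * exp (s d v)"
          by (simp only: exp_add)
        have s: "complex_of_real (s d v) = d * cnj v + cnj d * v"
          by (simp add: s_def complex_eq_iff algebra_simps)
        have "of_real (?G d) * (of_real (?G v) / v + d * (of_real (?G v) * cnj v / v) +
          cnj d * of_real (?G v) + of_real (?G v * (exp (s d v) - 1 - s d v)) / v) =
          of_real (?G d) * of_real (?G v) * (1 + (d * cnj v + cnj d * v) + (of_real (exp (s d v)) - 1 - of_real (s d v))) / v"
          using elim by (simp add: field_simps)
        also have "\<dots> = of_real (?G (d - v)) / v"
          unfolding s[symmetric] G by simp
        finally show ?case ..
      qed
    qed measurable
    also have "\<dots> = of_real (?G d) * (A + d * \<alpha> + cnj d * 1 + \<rho> d)"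
    proof -
      have lin: "(\<integral>v. c * (f1 v + d * f2 v + e * f3 v + f4 v) \<partial>dA) =
          c * (integral\<^sup>L dA f1 + d * integral\<^sup>L dA f2 + e * integral\<^sup>L dA f3 + integral\<^sup>L dA f4)"
        if "integrable dA f1" "integrable dA f2" "integrable dA f3" "integrable dA f4"
        for c e :: complex and f1 f2 f3 f4 :: "complex \<Rightarrow> complex"
        using that by simp
      have 1: "(\<integral>v. complex_of_real (?G v) \<partial>dA) = 1"
        using integral_gauss by (simp only: integral_complex_of_real of_real_1)
      have G': "integrable dA (\<lambda>v. complex_of_real (?G v))"
        using G by (rule integrable_of_real)
      show ?thesis
        unfolding A_def \<alpha>_def \<rho>_def by (subst lin[OF iA i\<alpha> G' i\<rho>[OF d]]) (simp only: 1)
    qed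
    finally show ?thesis by (simp add: d_def mult.commute)
  qed
  have \<rho>': "(\<rho> has_derivative (\<lambda>_. 0)) (at (z - z))"
    using has_derivative_zero_three_halves[of 1 0 \<rho> J] \<rho>_bound by simp
  have D\<rho>: "((\<lambda>u. \<rho> (u - z)) has_derivative (\<lambda>_. 0)) (at z)"
    by (rule has_derivative_compose[where f = "\<lambda>u. u - z", OF _ \<rho>']) (auto intro!: derivative_eq_intros)
  \<comment> \<open>The Gaussian prefactor is critical at \<open>z\<close>, so the constant
    \<open>A\<close> contributes nothing to the derivative.\<close>
  have DG: "((\<lambda>u. complex_of_real (?G (u - z))) has_derivative (\<lambda>_. 0)) (at z)"
  proof -
    have "((\<lambda>u. - ((u - z) \<bullet> (u - z))) has_derivative (\<lambda>_. 0)) (at z)"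
      by (auto intro!: derivative_eq_intros)
    from has_derivative_of_real[OF has_derivative_exp[OF this]] show ?thesis 
      by (simp add: power2_norm_eq_inner)
  qed
  have "((\<lambda>u. of_real (?G (u - z)) * (A + \<alpha> * (u - z) + cnj (u - z) + \<rho> (u - z)))
      has_derivative (\<lambda>d. \<alpha> * d + cnj d)) (at z)"
    by (rule has_derivative_eq_rhs, rule has_derivative_mult[OF DG]) 
       (auto intro!: derivative_eq_intros D\<rho> has_derivative_cnj)
  then have "(cauchy_tr (\<lambda>w. of_real (exp (- (cmod (w - z))\<^sup>2))) has_derivative (\<lambda>d. \<alpha> * d + cnj d)) (at z)"
    by (rule has_derivative_transform_within_open[where s = "ball z 1"])
       (auto simp: eq dist_norm norm_minus_commute)
  then show ?thesis by blast
qed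

text \<open>The first part says pointwise that the kernel is a fundamental solution of dbar with
  respect to \<open>dA\<close>; regularity of \<open>f\<close> is asked for at \<open>z\<close>
  only. The second part justifies splitting a transform into summands: at a divergent integral
  \<open>cauchy_tr\<close> has the default value 0 and additivity may fail.\<close>

theorem cauchy_tr_has_derivative:
  fixes f :: "complex \<Rightarrow> complex"
  assumes f: "integrable dA f" and D: "f differentiable (at z)"
  shows "\<exists>\<alpha>. (cauchy_tr f has_derivative (\<lambda>d. \<alpha> * d + f z * cnj d)) (at z)"
    and "\<exists>\<delta>>0. \<forall>u. cmod (u - z) < \<delta> \<longrightarrow> integrable dA (\<lambda>w. f w / (u - w))"
proof -
  let ?g = "\<lambda>w. complex_of_real (exp (- (cmod (w - z))\<^sup>2))"
  have g: "integrable dA ?g"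
  proof -
    have "integrable dA (\<lambda>w. complex_of_real (exp (- (cmod (z - w))\<^sup>2)))"
      by (rule iffD2[OF integrable_dA_reflect[of "\<lambda>w. complex_of_real (exp (- (cmod w)\<^sup>2))"]])
         (use integrable_gauss[of 1] in auto)
    then show ?thesis by (simp add: norm_minus_commute)
  qed
  have lip: "\<exists>K \<delta>. 0 < \<delta> \<and> (\<forall>w. cmod (w - z) < \<delta> \<longrightarrow> cmod (h w - h z) \<le> K * cmod (w - z))"
    if "h differentiable (at z)" for h :: "complex \<Rightarrow> complex"
  proof -
    from that obtain h' where h': "(h has_derivative h') (at z)" by (auto simp: differentiable_def)
    then obtain B where B: "\<And>x. norm (h' x) \<le> norm x * B"
      using bounded_linear.bounded[OF has_derivative_bounded_linear] by blast
    obtain \<delta> where "0 < \<delta>" and \<delta>: "\<And>w. norm (w - z) < \<delta> \<Longrightarrow> norm (h w - h z - h' (w - z)) \<le> 1 * norm (w - z)"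
      using h' unfolding has_derivative_at_alt by (metis zero_less_one)
    have "cmod (h w - h z) \<le> (1 + B) * cmod (w - z)" if "cmod (w - z) < \<delta>" for w
      using \<delta>[OF that] B[of "w - z"] norm_triangle_sub[of "h w - h z" "h' (w - z)"] by (simp add: algebra_simps)
    then show ?thesis using \<open>0 < \<delta>\<close> by blast
  qed
  have int: "\<exists>\<delta>>0. \<forall>u. cmod (u - z) < \<delta> \<longrightarrow> integrable dA (\<lambda>w. h w / (u - w))"
    if h: "integrable dA h" "h differentiable (at z)" for h :: "complex \<Rightarrow> complex"
  proof -
    from lip[OF h(2)] obtain K \<delta> where "0 < \<delta>" and K: "\<And>w. cmod (w - z) < \<delta> \<Longrightarrow> cmod (h w - h z) \<le> K * cmod (w - z)"
      by blast
    have "cmod (h w) \<le> cmod (h z) + \<bar>K\<bar> * \<delta>" if "cmod (w - z) < \<delta>" for w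
    proof -
      have "cmod (h w) \<le> cmod (h z) + cmod (h w - h z)" by (rule norm_triangle_sub)
      also have "cmod (h w - h z) \<le> \<bar>K\<bar> * cmod (w - z)"
        by (rule order_trans[OF K[OF that]]) (auto intro: mult_right_mono)
      also have "\<dots> \<le> \<bar>K\<bar> * \<delta>" using that by (intro mult_left_mono) auto
      finally show ?thesis by simp
    qed
    from integrable_div_diff[OF h(1) \<open>0 < \<delta>\<close> this] show ?thesis
      using \<open>0 < \<delta>\<close> by (intro exI[of _ "\<delta> / 2"]) auto
  qed
  show 1: "\<exists>\<delta>>0. \<forall>u. cmod (u - z) < \<delta> \<longrightarrow> integrable dA (\<lambda>w. f w / (u - w))"
    by (rule int[OF f D])
  define h where "h = (\<lambda>w. f w - f z * ?g w)"
  have hi: "integrable dA h" unfolding h_def using f g by auto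
  have Dg: "?g differentiable (at z)"
  proof -
    have "((\<lambda>u. - ((u - z) \<bullet> (u - z))) has_derivative (\<lambda>_. 0)) (at z)"
      by (auto intro!: derivative_eq_intros)
    from has_derivative_of_real[OF has_derivative_exp[OF this]] show ?thesis 
      by (auto simp: power2_norm_eq_inner differentiable_def)
  qed
  have hD: "h differentiable (at z)"
    unfolding h_def by (intro differentiable_diff differentiable_mult differentiable_const Dg D)
  have "h z = 0" by (simp add: h_def)
  then obtain K \<delta> where "0 < \<delta>" and K: "\<And>w. cmod (w - z) < \<delta> \<Longrightarrow> cmod (h w) \<le> K * cmod (w - z)"
    using lip[OF hD] by auto
  from cauchy_tr_has_derivative_vanishing[OF hi this] obtain c
    where c: "(cauchy_tr h has_derivative (\<lambda>d. c * d)) (at z)" by blast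
  obtain \<alpha> where \<alpha>: "(cauchy_tr ?g has_derivative (\<lambda>d. \<alpha> * d + cnj d)) (at z)"
    using cauchy_tr_gauss_has_derivative by blast
  obtain \<delta>1 where \<delta>1: "\<delta>1 > 0" "\<And>u. cmod (u - z) < \<delta>1 \<Longrightarrow> integrable dA (\<lambda>w. h w / (u - w))"
    using int[OF hi hD] by blast
  obtain \<delta>2 where \<delta>2: "\<delta>2 > 0" "\<And>u. cmod (u - z) < \<delta>2 \<Longrightarrow> integrable dA (\<lambda>w. ?g w / (u - w))"
    using int[OF g Dg] by blast
  have eq: "cauchy_tr f u = cauchy_tr h u + f z * cauchy_tr ?g u" if u: "cmod (u - z) < min \<delta>1 \<delta>2" for u
  proof -
    have "cauchy_tr f u = (\<integral>w. h w / (u - w) + f z * (?g w / (u - w)) \<partial>dA)"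
      unfolding cauchy_tr_def
      by (intro Bochner_Integration.integral_cong) (auto simp: h_def diff_divide_distrib)
    also have "\<dots> = cauchy_tr h u + f z * cauchy_tr ?g u"
      using \<delta>1(2)[of u] \<delta>2(2)[of u] u
      by (simp add: cauchy_tr_def del: of_real_exp times_divide_eq_right)
    finally show ?thesis .
  qed
  have "((\<lambda>u. cauchy_tr h u + f z * cauchy_tr ?g u) has_derivative (\<lambda>d. (c + f z * \<alpha>) * d + f z * cnj d)) (at z)"
    by (rule has_derivative_eq_rhs, rule has_derivative_add[OF c], rule has_derivative_mult_right[OF \<alpha>])
       (auto simp: algebra_simps)
  then have "(cauchy_tr f has_derivative (\<lambda>d. (c + f z * \<alpha>) * d + f z * cnj d)) (at z)"
    by (rule has_derivative_transform_within_open[where s = "ball z (min \<delta>1 \<delta>2)"])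
       (use \<delta>1 \<delta>2 in \<open>auto simp: eq dist_norm norm_minus_commute\<close>)
  then show "\<exists>\<alpha>. (cauchy_tr f has_derivative (\<lambda>d. \<alpha> * d + f z * cnj d)) (at z)" by blast
qed

section \<open>Product measures and polynomials with random zeros\<close>

interpretation dA: product_sigma_finite "\<lambda>_::nat. dA"
  by (simp add: product_sigma_finite_def sigma_finite_dA)

text \<open>The inserted coordinate stands first, so that Fubini leaves it as the outer variable: a
  marked particle outside, the others integrated out inside.\<close>

lemma distr_insert_PiM_dA:
  fixes J :: "nat set"
  assumes "finite J" "i \<notin> J"
  shows "distr (dA \<Otimes>\<^sub>M PiM J (\<lambda>_. dA)) (PiM (insert i J) (\<lambda>_. dA)) (\<lambda>(y, x). x(i := y)) = PiM (insert i J) (\<lambda>_. dA)"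
    (is "distr ?P ?M ?g = _")
proof (rule dA.PiM_eqI)
  interpret J: sigma_finite_measure "PiM J (\<lambda>_. dA)" using assms by (intro dA.sigma_finite)
  have g: "?g \<in> measurable ?P ?M" by measurable
  fix A :: "nat \<Rightarrow> complex set" assume A: "\<And>k. k \<in> insert i J \<Longrightarrow> A k \<in> sets dA"
  have "?g -` Pi\<^sub>E (insert i J) A \<inter> space ?P = A i \<times> Pi\<^sub>E J A"
    using assms by (auto simp: space_pair_measure space_PiM PiE_iff extensional_def split: if_splits)
  then show "emeasure (distr ?P ?M ?g) (Pi\<^sub>E (insert i J) A) = (\<Prod>k\<in>insert i J. emeasure dA (A k))"
    using assms A by (subst emeasure_distr[OF g])
      (auto intro!: sets_PiM_I_finite simp: J.emeasure_pair_measure_Times dA.emeasure_PiM)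
qed (use assms in auto)

lemma
  fixes f :: "(nat \<Rightarrow> complex) \<Rightarrow> 'b :: {banach, second_countable_topology}"
  assumes J: "finite J" "i \<notin> J" and f: "integrable (PiM (insert i J) (\<lambda>_. dA)) f"
  shows integrable_PiM_insert: "integrable dA (\<lambda>y. \<integral>x. f (x(i := y)) \<partial>PiM J (\<lambda>_. dA))"
    and integral_PiM_insert: "(\<integral>y. (\<integral>x. f (x(i := y)) \<partial>PiM J (\<lambda>_. dA)) \<partial>dA) = (\<integral>x. f x \<partial>PiM (insert i J) (\<lambda>_. dA))"
proof -
  interpret J: sigma_finite_measure "PiM J (\<lambda>_. dA)" using J by (intro dA.sigma_finite)
  interpret P: pair_sigma_finite dA "PiM J (\<lambda>_. dA)"
    by (intro pair_sigma_finite.intro sigma_finite_dA J.sigma_finite_measure_axioms)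
  let ?g = "\<lambda>(y, x). x(i := y)"
  have g: "?g \<in> measurable (dA \<Otimes>\<^sub>M PiM J (\<lambda>_. dA)) (PiM (insert i J) (\<lambda>_. dA))" by measurable
  have [measurable]: "f \<in> borel_measurable (PiM (insert i J) (\<lambda>_. dA))" using f by auto
  have "integrable (dA \<Otimes>\<^sub>M PiM J (\<lambda>_. dA)) (\<lambda>p. f (?g p))"
    by (rule integrable_distr[OF g]) (simp add: distr_insert_PiM_dA[OF J] f)
  then have i: "integrable (dA \<Otimes>\<^sub>M PiM J (\<lambda>_. dA)) (\<lambda>(y, x). f (x(i := y)))"
    by (simp add: case_prod_unfold)
  from P.integrable_fst[OF i] show "integrable dA (\<lambda>y. \<integral>x. f (x(i := y)) \<partial>PiM J (\<lambda>_. dA))" .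
  have "(\<integral>x. f x \<partial>PiM (insert i J) (\<lambda>_. dA)) = (\<integral>p. f (?g p) \<partial>(dA \<Otimes>\<^sub>M PiM J (\<lambda>_. dA)))"
    by (subst distr_insert_PiM_dA[OF J, symmetric], rule integral_distr[OF g]) measurable
  also have "\<dots> = (\<integral>y. (\<integral>x. f (x(i := y)) \<partial>PiM J (\<lambda>_. dA)) \<partial>dA)"
    using P.integral_fst[OF i] by (simp add: case_prod_unfold)
  finally show "(\<integral>y. (\<integral>x. f (x(i := y)) \<partial>PiM J (\<lambda>_. dA)) \<partial>dA) = (\<integral>x. f x \<partial>PiM (insert i J) (\<lambda>_. dA))" ..
qed

text \<open>Two symmetries of the ensemble in one statement: \<open>s = id\<close> exchanges
  particles, and \<open>\<pi> = id\<close> with \<open>s = cnj\<close> reflects all of them in the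
  real axis.\<close>

lemma distr_PiM_dA_reindex:
  fixes I :: "nat set"
  assumes I: "finite I" and \<pi>: "bij_betw \<pi> I I" and s: "s \<in> measurable dA dA" "distr dA dA s = dA"
  shows "distr (PiM I (\<lambda>_. dA)) (PiM I (\<lambda>_. dA)) (\<lambda>\<eta>. \<lambda>i\<in>I. s (\<eta> (\<pi> i))) = PiM I (\<lambda>_. dA)"
proof (rule dA.PiM_eqI)
  let ?T = "\<lambda>\<eta>. \<lambda>i\<in>I. s (\<eta> (\<pi> i))"
  have \<pi>I: "\<pi> i \<in> I" if "i \<in> I" for i using \<pi> that by (auto simp: bij_betw_def)
  have T: "?T \<in> measurable (PiM I (\<lambda>_. dA)) (PiM I (\<lambda>_. dA))"
    by (intro measurable_restrict measurable_compose[OF measurable_component_singleton[OF \<pi>I] s(1)])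
  fix A :: "nat \<Rightarrow> complex set" assume A: "\<And>i. i \<in> I \<Longrightarrow> A i \<in> sets dA"
  \<comment> \<open>The preimage of the box with sides \<open>A\<close> is again a box: coordinate
    \<open>\<pi> i\<close> has to land in \<open>A i\<close> under \<open>s\<close>.\<close>
  define B where "B = (\<lambda>k. s -` A (the_inv_into I \<pi> k))"
  have inv: "the_inv_into I \<pi> (\<pi> i) = i" if "i \<in> I" for i
    using that \<pi> by (auto simp: bij_betw_def the_inv_into_f_f)
  have surj: "\<exists>i\<in>I. k = \<pi> i" if "k \<in> I" for k
    using that \<pi> by (auto simp: bij_betw_def)
  have s_sets: "s -` X \<in> sets dA" if "X \<in> sets dA" for X
    using measurable_sets[OF s(1) that] by simp
  have B: "B k \<in> sets dA" if "k \<in> I" for k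
    using surj[OF that] A s_sets by (auto simp: B_def inv)
  have vim: "?T -` Pi\<^sub>E I A \<inter> space (PiM I (\<lambda>_. dA)) = Pi\<^sub>E I B"
  proof -
    have "(\<forall>i\<in>I. s (x (\<pi> i)) \<in> A i) \<longleftrightarrow> (\<forall>k\<in>I. x k \<in> B k)" for x
    proof -
      have "(\<forall>k\<in>I. x k \<in> B k) \<longleftrightarrow> (\<forall>i\<in>I. x (\<pi> i) \<in> B (\<pi> i))"
        using surj \<pi>I by metis
      then show ?thesis by (simp add: B_def inv)
    qed
    then show ?thesis by (auto simp: space_PiM PiE_iff)
  qed
  have eB: "emeasure dA (B (\<pi> i)) = emeasure dA (A i)" if "i \<in> I" for i
  proof -
    have "emeasure dA (A i) = emeasure (distr dA dA s) (A i)" by (simp add: s(2))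
    also have "\<dots> = emeasure dA (s -` A i)" using A[OF that] by (subst emeasure_distr[OF s(1)]) auto
    finally show ?thesis by (simp add: B_def inv that)
  qed
  have "emeasure (distr (PiM I (\<lambda>_. dA)) (PiM I (\<lambda>_. dA)) ?T) (Pi\<^sub>E I A) = emeasure (PiM I (\<lambda>_. dA)) (Pi\<^sub>E I B)"
    using I A by (subst emeasure_distr[OF T]) (auto simp: vim intro!: sets_PiM_I_finite)
  also have "\<dots> = (\<Prod>k\<in>I. emeasure dA (B k))"
    using I B by (rule dA.emeasure_PiM)
  also have "\<dots> = (\<Prod>i\<in>I. emeasure dA (B (\<pi> i)))"
    by (rule prod.reindex_bij_betw[OF \<pi>, symmetric])
  also have "\<dots> = (\<Prod>i\<in>I. emeasure dA (A i))"
    by (rule prod.cong) (auto simp: eB)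
  finally show "emeasure (distr (PiM I (\<lambda>_. dA)) (PiM I (\<lambda>_. dA)) ?T) (Pi\<^sub>E I A) = (\<Prod>i\<in>I. emeasure dA (A i))" .
qed (use I in auto)

lemma integral_PiM_dA_reindex:
  fixes f :: "(nat \<Rightarrow> complex) \<Rightarrow> 'b :: {banach, second_countable_topology}"
  assumes I: "finite I" and \<pi>: "bij_betw \<pi> I I" and s: "s \<in> measurable dA dA" "distr dA dA s = dA"
    and f: "f \<in> borel_measurable (PiM I (\<lambda>_. dA))"
  shows "(\<integral>\<eta>. f (\<lambda>i\<in>I. s (\<eta> (\<pi> i))) \<partial>PiM I (\<lambda>_. dA)) = (\<integral>\<eta>. f \<eta> \<partial>PiM I (\<lambda>_. dA))"
proof -
  have \<pi>I: "\<pi> i \<in> I" if "i \<in> I" for i using \<pi> that by (auto simp: bij_betw_def)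
  have T: "(\<lambda>\<eta>. \<lambda>i\<in>I. s (\<eta> (\<pi> i))) \<in> measurable (PiM I (\<lambda>_. dA)) (PiM I (\<lambda>_. dA))"
    by (intro measurable_restrict measurable_compose[OF measurable_component_singleton[OF \<pi>I] s(1)])
  show ?thesis
    using integral_distr[OF T f] by (simp add: distr_PiM_dA_reindex[OF I \<pi> s])
qed

text \<open>Unit discs have mass 1, hence so has their product, and a function positive on that
  product cannot vanish almost everywhere.\<close>

lemma nn_integral_PiM_dA_pos:
  fixes c :: "nat \<Rightarrow> complex"
  assumes I: "finite I" and f: "f \<in> borel_measurable (PiM I (\<lambda>_. dA))"
    and pos: "\<And>\<eta>. \<eta> \<in> Pi\<^sub>E I (\<lambda>j. ball (c j) 1) \<Longrightarrow> f \<eta> > (0::ennreal)"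
  shows "(\<integral>\<^sup>+\<eta>. f \<eta> \<partial>PiM I (\<lambda>_. dA)) > 0"
proof (rule ccontr)
  assume "\<not> ?thesis"
  then have "(\<integral>\<^sup>+\<eta>. f \<eta> \<partial>PiM I (\<lambda>_. dA)) = 0" by simp
  then have "AE \<eta> in PiM I (\<lambda>_. dA). f \<eta> = 0" using f by (simp add: nn_integral_0_iff_AE)
  then have "AE \<eta> in PiM I (\<lambda>_. dA). \<eta> \<notin> Pi\<^sub>E I (\<lambda>j. ball (c j) 1)"
    by eventually_elim (use pos in force)
  then have "emeasure (PiM I (\<lambda>_. dA)) (Pi\<^sub>E I (\<lambda>j. ball (c j) 1)) = 0"
    using I by (subst (asm) AE_iff_measurable[OF _ refl])
      (auto simp: space_PiM intro!: sets_PiM_I_finite elim!: back_subst[of "\<lambda>X. emeasure _ X = 0"])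
  moreover have "emeasure (PiM I (\<lambda>_. dA)) (Pi\<^sub>E I (\<lambda>j. ball (c j) 1)) = (\<Prod>j\<in>I. 1)"
    using I by (subst dA.emeasure_PiM) (auto simp: emeasure_dA_ball)
  ultimately show False by simp
qed

section \<open>Polynomials vanishing at the particles and their mirror images\<close>

definition qpoly :: "nat set \<Rightarrow> (nat \<Rightarrow> complex) \<Rightarrow> complex poly" where
  "qpoly I \<eta> = (\<Prod>j\<in>I. [:- \<eta> j, 1:] * [:- cnj (\<eta> j), 1:])"

text \<open>The square collects one factor for a particle and one for its conjugate. Up to factors
  depending on \<open>u\<close> alone, this dominates the coefficients of \<open>qpoly\<close>, its
  values, and its values divided by a linear factor.\<close>

definition majorant :: "nat set \<Rightarrow> (nat \<Rightarrow> complex) \<Rightarrow> real" where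
  "majorant I \<eta> = (\<Prod>j\<in>I. (1 + cmod (\<eta> j))\<^sup>2)"

lemma poly_qpoly: "poly (qpoly I \<eta>) u = (\<Prod>j\<in>I. (u - \<eta> j) * (u - cnj (\<eta> j)))"
  by (auto simp: qpoly_def poly_prod algebra_simps intro!: prod.cong)

lemma majorant_nonneg: "0 \<le> majorant I \<eta>"
  by (simp add: majorant_def prod_nonneg)

lemma qpoly_insert:
  assumes "finite I" "i \<notin> I"
  shows "qpoly (insert i I) \<eta> = [:- \<eta> i, 1:] * ([:- cnj (\<eta> i), 1:] * qpoly I \<eta>)"
  unfolding qpoly_def by (simp only: prod.insert[OF assms] mult.assoc)

lemma coeff_linear_mult:
  fixes p :: "complex poly"
  shows "coeff ([:- a, 1:] * p) m = (case m of 0 \<Rightarrow> 0 | Suc n \<Rightarrow> coeff p n) - a * coeff p m"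
  by (simp add: mult_pCons_left coeff_pCons split: nat.split)

lemma coeff_linear_mult_le:
  fixes p :: "complex poly"
  assumes "\<And>m. cmod (coeff p m) \<le> B"
  shows "cmod (coeff ([:- a, 1:] * p) m) \<le> (1 + cmod a) * B"
proof -
  have B: "0 \<le> B" using order_trans[OF norm_ge_zero assms] .
  have "cmod (coeff ([:- a, 1:] * p) m) \<le> cmod (case m of 0 \<Rightarrow> 0 | Suc n \<Rightarrow> coeff p n) + cmod (a * coeff p m)"
    unfolding coeff_linear_mult by (rule norm_triangle_ineq4)
  also have "\<dots> \<le> B + cmod a * B"
    using assms B by (intro add_mono) (auto simp: norm_mult mult_left_mono split: nat.split)
  finally show ?thesis by (simp add: algebra_simps)
qed

lemma coeff_qpoly_le:
  assumes "finite I"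
  shows "cmod (coeff (qpoly I \<eta>) m) \<le> majorant I \<eta>"
  using assms
proof (induction I arbitrary: m)
  case empty
  then show ?case by (simp add: qpoly_def majorant_def)
next
  case (insert i I)
  have "cmod (coeff (qpoly (insert i I) \<eta>) m) \<le> (1 + cmod (\<eta> i)) * ((1 + cmod (cnj (\<eta> i))) * majorant I \<eta>)"
    unfolding qpoly_insert[OF insert.hyps] by (intro coeff_linear_mult_le insert.IH)
  also have "\<dots> = majorant (insert i I) \<eta>"
    using insert.hyps by (simp add: majorant_def power2_eq_square)
  finally show ?case .
qed

lemma measurable_coeff_qpoly:
  assumes "finite I" "I \<subseteq> J"
  shows "(\<lambda>\<eta>. coeff (qpoly I \<eta>) m) \<in> borel_measurable (PiM J (\<lambda>_. dA))"
  using assms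
proof (induction I arbitrary: m)
  case empty
  then show ?case by (simp add: qpoly_def)
next
  case (insert i I)
  then have [measurable]: "(\<lambda>\<eta>. coeff (qpoly I \<eta>) m) \<in> borel_measurable (PiM J (\<lambda>_. dA))" for m by auto
  have "i \<in> J" using insert.prems by auto
  then have [measurable]: "(\<lambda>\<eta>. \<eta> i) \<in> borel_measurable (PiM J (\<lambda>_. dA))"
    by (metis measurable_component_singleton measurable_cong_sets sets_dA)
  have 1: "(\<lambda>\<eta>. coeff ([:- cnj (\<eta> i), 1:] * qpoly I \<eta>) m) \<in> borel_measurable (PiM J (\<lambda>_. dA))" for m
    unfolding coeff_linear_mult by (cases m) auto
  then show ?case
    unfolding qpoly_insert[OF insert.hyps] coeff_linear_mult[of "\<eta> i" for \<eta>] by (cases m) auto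
qed

lemma degree_qpoly: "finite I \<Longrightarrow> degree (qpoly I \<eta>) \<le> 2 * card I"
proof (induction I rule: finite_induct)
  case (insert i I)
  have "degree ([:- cnj (\<eta> i), 1:] * qpoly I \<eta>) \<le> 1 + degree (qpoly I \<eta>)"
    by (rule order_trans[OF degree_mult_le]) simp
  moreover have "degree (qpoly (insert i I) \<eta>) \<le> 1 + degree ([:- cnj (\<eta> i), 1:] * qpoly I \<eta>)"
    unfolding qpoly_insert[OF insert.hyps] by (rule order_trans[OF degree_mult_le]) simp
  ultimately show ?case using insert by simp
qed (simp add: qpoly_def)

text \<open>The range of summation does not depend on the polynomial, so the sum can be interchanged
  with an integral over the zeros.\<close>

lemma poly_eq_sum_atMost:
  fixes p :: "complex poly"
  assumes "degree p \<le> D"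
  shows "poly p u = (\<Sum>m\<le>D. coeff p m * u ^ m)"
  unfolding poly_altdef using assms
  by (intro sum.mono_neutral_left) (auto simp: coeff_eq_0)

lemma poly_pderiv_eq_sum_atMost:
  fixes p :: "complex poly"
  assumes "degree p \<le> D"
  shows "poly (pderiv p) u = (\<Sum>m\<le>D. coeff p m * (of_nat m * u ^ (m - 1)))"
proof -
  have "((\<lambda>u. \<Sum>m\<le>D. coeff p m * u ^ m) has_field_derivative (\<Sum>m\<le>D. coeff p m * (of_nat m * u ^ (m - 1)))) (at u)"
    by (auto intro!: derivative_eq_intros sum.cong)
  then show ?thesis
    using poly_DERIV[of p u] DERIV_unique by (simp add: poly_eq_sum_atMost[OF assms, abs_def]) blast
qed

section \<open>Values of the polynomials against the majorant\<close>

lemma cmod_diff_le: "cmod (u - a) \<le> (1 + cmod u) * (1 + cmod a)"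
proof -
  have "(1 + cmod u) * (1 + cmod a) = 1 + (cmod u + cmod a) + cmod u * cmod a"
    by (simp add: algebra_simps)
  moreover have "0 \<le> cmod u * cmod a" by simp
  ultimately show ?thesis using norm_triangle_ineq4[of u a] by linarith
qed

lemma poly_qpoly_le:
  assumes I: "finite I"
  shows "cmod (poly (qpoly I \<eta>) u) \<le> (1 + cmod u) ^ (2 * card I) * majorant I \<eta>"
proof -
  have "cmod (poly (qpoly I \<eta>) u) = (\<Prod>j\<in>I. cmod (u - \<eta> j) * cmod (u - cnj (\<eta> j)))"
    by (simp add: poly_qpoly norm_mult flip: prod_norm)
  also have "\<dots> \<le> (\<Prod>j\<in>I. ((1 + cmod u) * (1 + cmod (\<eta> j))) * ((1 + cmod u) * (1 + cmod (cnj (\<eta> j)))))"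
    by (intro prod_mono conjI mult_mono cmod_diff_le mult_nonneg_nonneg) auto
  also have "\<dots> = (\<Prod>j\<in>I. (1 + cmod u)\<^sup>2 * (1 + cmod (\<eta> j))\<^sup>2)"
    by (intro prod.cong) (auto simp: power2_eq_square)
  also have "\<dots> = (1 + cmod u) ^ (2 * card I) * majorant I \<eta>"
    by (simp add: prod.distrib majorant_def power_mult)
  finally show ?thesis .
qed

text \<open>The denominator cancels one linear factor, and the product of the others obeys the same
  kind of bound. So the pole costs no integrability. At \<open>u = a\<close> the quotient is 0 by
  convention.\<close>

lemma poly_qpoly_div_le:
  assumes I: "finite I" "j \<in> I" and a: "a = \<eta> j \<or> a = cnj (\<eta> j)"
  shows "cmod (poly (qpoly I \<eta>) u / (u - a)) \<le> (1 + cmod u) ^ (2 * card I) * majorant I \<eta>"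
proof (cases "u = a")
  case True
  then show ?thesis by (simp add: majorant_nonneg)
next
  case False
  let ?J = "I - {j}"
  have I': "I = insert j ?J" "finite ?J" "j \<notin> ?J" using I by auto
  have p: "poly (qpoly I \<eta>) u = (u - \<eta> j) * (u - cnj (\<eta> j)) * poly (qpoly ?J \<eta>) u"
    unfolding poly_qpoly using I by (simp add: prod.remove)
  have m: "majorant I \<eta> = (1 + cmod (\<eta> j))\<^sup>2 * majorant ?J \<eta>"
    unfolding majorant_def using I by (simp add: prod.remove)
  define b where "b = (if a = \<eta> j then cnj (\<eta> j) else \<eta> j)"
  have "cmod (poly (qpoly I \<eta>) u / (u - a)) = cmod (u - b) * cmod (poly (qpoly ?J \<eta>) u)"
    using False a unfolding p b_def by (auto simp: norm_mult norm_divide)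
  also have "\<dots> \<le> ((1 + cmod u) * (1 + cmod b)) * ((1 + cmod u) ^ (2 * card ?J) * majorant ?J \<eta>)"
    by (intro mult_mono cmod_diff_le poly_qpoly_le I' mult_nonneg_nonneg) auto
  also have "cmod b = cmod (\<eta> j)" by (simp add: b_def)
  also have "((1 + cmod u) * (1 + cmod (\<eta> j))) * ((1 + cmod u) ^ (2 * card ?J) * majorant ?J \<eta>) =
      (1 + cmod u) ^ (1 + 2 * card ?J) * ((1 + cmod (\<eta> j)) * majorant ?J \<eta>)"
    by (simp add: ac_simps)
  also have "\<dots> \<le> (1 + cmod u) ^ (2 * card I) * ((1 + cmod (\<eta> j))\<^sup>2 * majorant ?J \<eta>)"
  proof (intro mult_mono power_increasing)
    have "0 < card I" using I by (auto simp: card_gt_0_iff)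
    then show "1 + 2 * card ?J \<le> 2 * card I" using I by simp
    show "1 + cmod (\<eta> j) \<le> (1 + cmod (\<eta> j))\<^sup>2" by (rule self_le_power) auto
  qed (auto simp: majorant_nonneg)
  finally show ?thesis by (simp only: m)
qed

lemma poly_pderiv_qpoly:
  assumes "finite I" "\<And>j. j \<in> I \<Longrightarrow> u \<noteq> \<eta> j \<and> u \<noteq> cnj (\<eta> j)"
  shows "poly (pderiv (qpoly I \<eta>)) u = poly (qpoly I \<eta>) u * (\<Sum>j\<in>I. 1 / (u - \<eta> j) + 1 / (u - cnj (\<eta> j)))"
  using assms
proof (induction I rule: finite_induct)
  case empty
  then show ?case by (simp add: qpoly_def)
next
  case (insert i I)
  then have *: "u - \<eta> i \<noteq> 0" "u - cnj (\<eta> i) \<noteq> 0" by auto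
  have IH: "poly (pderiv (qpoly I \<eta>)) u = poly (qpoly I \<eta>) u * (\<Sum>j\<in>I. 1 / (u - \<eta> j) + 1 / (u - cnj (\<eta> j)))"
    using insert by auto
  have "poly (pderiv (qpoly (insert i I) \<eta>)) u =
      ((u - \<eta> i) + (u - cnj (\<eta> i))) * poly (qpoly I \<eta>) u + (u - \<eta> i) * (u - cnj (\<eta> i)) * poly (pderiv (qpoly I \<eta>)) u"
    unfolding qpoly_insert[OF insert.hyps] pderiv_mult by (simp add: pderiv_pCons algebra_simps)
  also have "\<dots> = poly (qpoly (insert i I) \<eta>) u * (1 / (u - \<eta> i) + 1 / (u - cnj (\<eta> i)) + (\<Sum>j\<in>I. 1 / (u - \<eta> j) + 1 / (u - cnj (\<eta> j))))"
  proof -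
    have "(A + B) * q + A * B * (q * S) = A * (B * q) * (1 / A + 1 / B + S)"
      if "A \<noteq> 0" "B \<noteq> 0" for A B q S :: complex
      using that by (simp add: field_simps)
    note this[OF *]
    moreover have "poly (qpoly (insert i I) \<eta>) u = (u - \<eta> i) * ((u - cnj (\<eta> i)) * poly (qpoly I \<eta>) u)"
      unfolding qpoly_insert[OF insert.hyps] by (simp add: algebra_simps)
    ultimately show ?thesis by (simp only: IH)
  qed
  finally show ?case using insert.hyps by simp
qed

lemma separated_finite_set:
  fixes S :: "complex set"
  assumes "finite S"
  shows "\<exists>\<delta>>0. \<forall>s\<in>S. \<forall>t\<in>S. s \<noteq> t \<longrightarrow> 2 * \<delta> \<le> cmod (s - t)"
proof -
  \<comment> \<open>The element 1 keeps \<open>D\<close> nonempty when \<open>S\<close> has fewer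
    than two points.\<close>
  define D where "D = insert 1 ((\<lambda>(s, t). cmod (s - t) / 2) ` {(s, t). s \<in> S \<and> t \<in> S \<and> s \<noteq> t})"
  have "finite {(s, t). s \<in> S \<and> t \<in> S \<and> s \<noteq> t}"
    by (rule finite_subset[of _ "S \<times> S"]) (use assms in auto)
  then have D: "finite D" "D \<noteq> {}" by (auto simp: D_def)
  have "Min D > 0" using D by (subst Min_gr_iff) (auto simp: D_def)
  moreover have "2 * Min D \<le> cmod (s - t)" if "s \<in> S" "t \<in> S" "s \<noteq> t" for s t
    using Min_le[OF D(1), of "cmod (s - t) / 2"] that by (force simp: D_def)
  ultimately show ?thesis by blast
qed

text \<open>By the pigeonhole principle some point of \<open>S\<close> stays away from all zeros of \<open>qpoly I \<eta>\<close>.\<close>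

lemma majorant_le_sum_poly:
  assumes I: "finite I" and S: "finite S" "card I < card S" "\<And>s. s \<in> S \<Longrightarrow> 0 < Im s"
  shows "\<exists>K\<ge>0. \<forall>\<eta>. (majorant I \<eta>)\<^sup>2 \<le> K * (\<Sum>s\<in>S. (cmod (poly (qpoly I \<eta>) s))\<^sup>2)"
proof -
  obtain \<delta> where \<delta>: "\<delta> > 0" "\<And>s t. s \<in> S \<Longrightarrow> t \<in> S \<Longrightarrow> s \<noteq> t \<Longrightarrow> 2 * \<delta> \<le> cmod (s - t)"
    using separated_finite_set[OF S(1)] by blast
  obtain B where B: "\<And>s. s \<in> S \<Longrightarrow> cmod s \<le> B"
    using finite_imp_bounded[OF S(1)] by (auto simp: bounded_iff)
  obtain s0 where "s0 \<in> S" using S(2) by (metis card.empty ex_in_conv not_less0)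
  then have B0: "0 \<le> B" using order_trans[OF norm_ge_zero B] by blast
  \<comment> \<open>If \<open>a\<close> has distance at least \<open>\<delta>\<close> from a point
    \<open>s\<close> of \<open>S\<close>, then
    \<open>1 + |a| \<le> 1 + B + |s - a| \<le> C * |s - a|\<close>.\<close>
  define C where "C = 1 + (1 + B) / \<delta>"
  have C: "1 \<le> C" using \<delta> B0 by (simp add: C_def)
  define near where "near = (\<lambda>s a. cmod (s - a) < \<delta> \<or> cmod (s - cnj a) < \<delta>)"
  \<comment> \<open>In the upper half-plane \<open>s\<close> is no closer to \<open>cnj t\<close>
    than to \<open>t\<close>. Hence a particle and its mirror image together can be near only one
    point of \<open>S\<close>, although they are two zeros; this is why
    \<open>card I < card S\<close> suffices.\<close>
  have near_unique: "s = t" if "s \<in> S" "t \<in> S" "near s a" "near t a" for s t a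
  proof (rule ccontr)
    assume "s \<noteq> t"
    then have st: "2 * \<delta> \<le> cmod (s - t)" using \<delta> that by auto
    have "0 < Im s" "0 < Im t" using S(3) that by auto
    then have "\<bar>Im (s - t)\<bar> \<le> \<bar>Im (s - cnj t)\<bar>" by simp
    then have "(Im (s - t))\<^sup>2 \<le> (Im (s - cnj t))\<^sup>2" by (simp only: abs_le_square_iff)
    then have "cmod (s - t) \<le> cmod (s - cnj t)" unfolding cmod_def by simp
    moreover have "cmod (s - t) < 2 * \<delta> \<or> cmod (s - cnj t) < 2 * \<delta>"
    proof -
      have tri: "cmod (x - y) < 2 * \<delta>" if "cmod (x - b) < \<delta>" "cmod (y - b) < \<delta>" for x y b
        using norm_triangle_ineq4[of "x - b" "y - b"] that by simp
      have cnj: "cmod (cnj t - b) = cmod (t - cnj b)" for b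
        by (metis complex_cnj_cnj complex_cnj_diff complex_mod_cnj)
      show ?thesis
        using that tri[of s a t] tri[of s "cnj a" t] tri[of s a "cnj t"] tri[of s "cnj a" "cnj t"]
        by (auto simp: near_def cnj)
    qed
    ultimately show False using st by linarith
  qed
  have "\<exists>s\<in>S. majorant I \<eta> \<le> C ^ (2 * card I) * cmod (poly (qpoly I \<eta>) s)" for \<eta>
  proof -
    have "\<exists>s\<in>S. \<forall>j\<in>I. \<not> near s (\<eta> j)"
    proof (rule ccontr)
      assume "\<not> ?thesis"
      then obtain j where j: "\<And>s. s \<in> S \<Longrightarrow> j s \<in> I \<and> near s (\<eta> (j s))" by metis
      have "inj_on j S"
        using j near_unique by (intro inj_onI) metis
      then have "card S \<le> card I" using j I by (intro card_inj_on_le[of j]) auto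
      then show False using S by simp
    qed
    then obtain s where s: "s \<in> S" "\<And>j. j \<in> I \<Longrightarrow> \<not> near s (\<eta> j)" by blast
    have 1: "1 + cmod a \<le> C * cmod (s - a)" if "\<delta> \<le> cmod (s - a)" for a
    proof -
      have "1 + cmod a \<le> (1 + B) + cmod (s - a)"
        using B[OF s(1)] norm_triangle_ineq4[of s "s - a"] by simp
      also have "(1 + B) * \<delta> \<le> (1 + B) * cmod (s - a)"
        using that B0 by (intro mult_left_mono) auto
      then have "1 + B \<le> (1 + B) / \<delta> * cmod (s - a)"
        using \<delta> by (simp add: field_simps)
      finally show ?thesis by (simp add: C_def algebra_simps)
    qed
    have "majorant I \<eta> = (\<Prod>j\<in>I. (1 + cmod (\<eta> j)) * (1 + cmod (cnj (\<eta> j))))"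
      by (simp add: majorant_def power2_eq_square)
    also have "\<dots> \<le> (\<Prod>j\<in>I. (C * cmod (s - \<eta> j)) * (C * cmod (s - cnj (\<eta> j))))"
      using s(2) C by (intro prod_mono conjI mult_mono 1 mult_nonneg_nonneg) (auto simp: near_def not_less)
    also have "\<dots> = (\<Prod>j\<in>I. C\<^sup>2 * cmod ((s - \<eta> j) * (s - cnj (\<eta> j))))"
      by (intro prod.cong) (auto simp: power2_eq_square norm_mult)
    also have "\<dots> = C ^ (2 * card I) * cmod (poly (qpoly I \<eta>) s)"
      by (simp only: prod.distrib poly_qpoly prod_norm prod_constant power_mult)
    finally show ?thesis using s(1) by blast
  qed note key = this
  show ?thesis
  proof (intro exI[of _ "(C ^ (2 * card I))\<^sup>2"] conjI allI)
    fix \<eta>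
    obtain s where s: "s \<in> S" "majorant I \<eta> \<le> C ^ (2 * card I) * cmod (poly (qpoly I \<eta>) s)"
      using key by blast
    have "(majorant I \<eta>)\<^sup>2 \<le> (C ^ (2 * card I) * cmod (poly (qpoly I \<eta>) s))\<^sup>2"
      using s(2) majorant_nonneg by (intro power_mono)
    also have "\<dots> = (C ^ (2 * card I))\<^sup>2 * (cmod (poly (qpoly I \<eta>) s))\<^sup>2" by (rule power_mult_distrib)
    also have "\<dots> \<le> (C ^ (2 * card I))\<^sup>2 * (\<Sum>s\<in>S. (cmod (poly (qpoly I \<eta>) s))\<^sup>2)"
      using s(1) S(1) by (intro mult_left_mono member_le_sum) auto
    finally show "(majorant I \<eta>)\<^sup>2 \<le> (C ^ (2 * card I))\<^sup>2 * (\<Sum>s\<in>S. (cmod (poly (qpoly I \<eta>) s))\<^sup>2)" .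
  qed simp
qed

section \<open>Weights and moments\<close>

definition onepoint :: "(complex \<Rightarrow> real) \<Rightarrow> real \<Rightarrow> complex \<Rightarrow> real" where
  "onepoint Q c u = (cmod (u - cnj u))\<^sup>2 * exp (- c * Q u)"

text \<open>The coefficient \<open>c\<close> of the potential is separate from the size of
  \<open>I\<close>: once one particle is fixed, the remaining N - 1 still carry the exponent
  N.\<close>

definition weight :: "(complex \<Rightarrow> real) \<Rightarrow> real \<Rightarrow> nat set \<Rightarrow> (nat \<Rightarrow> complex) \<Rightarrow> real" where
  "weight Q c I \<eta> =
     (\<Prod>j\<in>I. \<Prod>k\<in>I - {j}. cmod (\<eta> j - \<eta> k) * cmod (\<eta> j - cnj (\<eta> k))) * (\<Prod>j\<in>I. onepoint Q c (\<eta> j))"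

lemma boltzmann_eq_weight: "boltzmann Q N = weight Q (real N) {..<N}"
  by (rule ext) (simp add: boltzmann_eq weight_def onepoint_def)

lemma onepoint_nonneg: "0 \<le> onepoint Q c u"
  by (simp add: onepoint_def)

lemma weight_nonneg: "0 \<le> weight Q c I \<eta>"
  by (simp add: weight_def prod_nonneg onepoint_nonneg)

lemma weight_cong: "(\<And>j. j \<in> I \<Longrightarrow> \<eta> j = \<eta>' j) \<Longrightarrow> weight Q c I \<eta> = weight Q c I \<eta>'"
  unfolding weight_def by (intro arg_cong2[where f = "(*)"] prod.cong) auto

lemma qpoly_cong: "(\<And>j. j \<in> I \<Longrightarrow> \<eta> j = \<eta>' j) \<Longrightarrow> qpoly I \<eta> = qpoly I \<eta>'"
  unfolding qpoly_def by (intro prod.cong) auto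

text \<open>The products run over ordered pairs, so each interaction of \<open>i\<close> with
  another particle occurs twice. One copy of all of them multiplies to \<open>|q(\<eta> i)|\<close>,
  whence the square.\<close>

lemma weight_insert:
  assumes "finite I" "i \<notin> I"
  shows "weight Q c (insert i I) \<eta> = onepoint Q c (\<eta> i) * (cmod (poly (qpoly I \<eta>) (\<eta> i)))\<^sup>2 * weight Q c I \<eta>"
proof -
  define g where "g = (\<lambda>j k. cmod (\<eta> j - \<eta> k) * cmod (\<eta> j - cnj (\<eta> k)))"
  have sym: "g j k = g k j" for j k
  proof -
    have "cmod (\<eta> j - cnj (\<eta> k)) = cmod (\<eta> k - cnj (\<eta> j))"
      by (metis complex_cnj_cnj complex_cnj_diff complex_mod_cnj norm_minus_commute)
    then show ?thesis by (simp add: g_def norm_minus_commute)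
  qed
  have "(\<Prod>j\<in>insert i I. \<Prod>k\<in>insert i I - {j}. g j k) =
      (\<Prod>k\<in>insert i I - {i}. g i k) * (\<Prod>j\<in>I. \<Prod>k\<in>insert i I - {j}. g j k)"
    using assms by simp
  also have "insert i I - {i} = I" using assms by auto
  also have "(\<Prod>j\<in>I. \<Prod>k\<in>insert i I - {j}. g j k) = (\<Prod>j\<in>I. g j i * (\<Prod>k\<in>I - {j}. g j k))"
  proof (rule prod.cong)
    fix j assume "j \<in> I"
    then have "insert i I - {j} = insert i (I - {j})" using assms by auto
    then show "(\<Prod>k\<in>insert i I - {j}. g j k) = g j i * (\<Prod>k\<in>I - {j}. g j k)" using assms by simp
  qed simp
  also have "(\<Prod>k\<in>I. g i k) * \<dots> = (\<Prod>k\<in>I. g i k)\<^sup>2 * (\<Prod>j\<in>I. \<Prod>k\<in>I - {j}. g j k)"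
    by (simp add: prod.distrib sym[of _ i] power2_eq_square)
  also have "(\<Prod>k\<in>I. g i k) = cmod (poly (qpoly I \<eta>) (\<eta> i))"
    by (simp add: poly_qpoly g_def norm_mult flip: prod_norm)
  finally have *: "(\<Prod>j\<in>insert i I. \<Prod>k\<in>insert i I - {j}. g j k) =
      (cmod (poly (qpoly I \<eta>) (\<eta> i)))\<^sup>2 * (\<Prod>j\<in>I. \<Prod>k\<in>I - {j}. g j k)" .
  have w: "weight Q c J \<eta> = (\<Prod>j\<in>J. \<Prod>k\<in>J - {j}. g j k) * (\<Prod>j\<in>J. onepoint Q c (\<eta> j))" for J
    by (simp add: weight_def g_def)
  show ?thesis
    unfolding w * prod.insert[OF assms] by (simp add: ac_simps)
qed

lemma weight_permute:
  assumes "bij_betw \<pi> I I"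
  shows "weight Q c I (\<lambda>i\<in>I. \<eta> (\<pi> i)) = weight Q c I \<eta>"
proof -
  define g where "g = (\<lambda>j k. cmod (\<eta> j - \<eta> k) * cmod (\<eta> j - cnj (\<eta> k)))"
  have "weight Q c I (\<lambda>i\<in>I. \<eta> (\<pi> i)) = weight Q c I (\<lambda>i. \<eta> (\<pi> i))"
    by (rule weight_cong) simp
  also have "\<dots> = (\<Prod>j\<in>I. \<Prod>k\<in>I - {j}. g (\<pi> j) (\<pi> k)) * (\<Prod>j\<in>I. onepoint Q c (\<eta> (\<pi> j)))"
    by (simp add: weight_def g_def)
  also have "(\<Prod>j\<in>I. onepoint Q c (\<eta> (\<pi> j))) = (\<Prod>j\<in>I. onepoint Q c (\<eta> j))"
    by (rule prod.reindex_bij_betw[OF assms])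
  also have "(\<Prod>j\<in>I. \<Prod>k\<in>I - {j}. g (\<pi> j) (\<pi> k)) = (\<Prod>j\<in>I. \<Prod>k\<in>I - {\<pi> j}. g (\<pi> j) k)"
  proof (rule prod.cong)
    fix j assume "j \<in> I"
    then have "bij_betw \<pi> (I - {j}) (I - {\<pi> j})"
      using assms by (intro bij_betw_DiffI) (auto simp: bij_betw_def)
    then show "(\<Prod>k\<in>I - {j}. g (\<pi> j) (\<pi> k)) = (\<Prod>k\<in>I - {\<pi> j}. g (\<pi> j) k)"
      by (rule prod.reindex_bij_betw)
  qed simp
  also have "\<dots> = (\<Prod>j\<in>I. \<Prod>k\<in>I - {j}. g j k)"
    by (rule prod.reindex_bij_betw[OF assms, of "\<lambda>j. \<Prod>k\<in>I - {j}. g j k"])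
  finally show ?thesis by (simp add: weight_def g_def)
qed

lemma weight_cnj:
  assumes "\<And>u. Q (cnj u) = Q u"
  shows "weight Q c I (\<lambda>i\<in>I. cnj (\<eta> i)) = weight Q c I \<eta>"
proof -
  have "weight Q c I (\<lambda>i\<in>I. cnj (\<eta> i)) = weight Q c I (\<lambda>i. cnj (\<eta> i))"
    by (rule weight_cong) simp
  moreover have "cmod (cnj a - b) = cmod (a - cnj b)" for a b
    by (metis complex_cnj_cnj complex_cnj_diff complex_mod_cnj)
  ultimately show ?thesis by (simp add: weight_def onepoint_def assms norm_minus_commute)
qed

lemma qpoly_permute:
  assumes "bij_betw \<pi> I I"
  shows "qpoly I (\<lambda>i\<in>I. \<eta> (\<pi> i)) = qpoly I \<eta>"
proof -
  have "qpoly I (\<lambda>i\<in>I. \<eta> (\<pi> i)) = qpoly I (\<lambda>i. \<eta> (\<pi> i))"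
    by (rule qpoly_cong) simp
  also have "\<dots> = qpoly I \<eta>"
    unfolding qpoly_def by (rule prod.reindex_bij_betw[OF assms, of "\<lambda>j. [:- \<eta> j, 1:] * [:- cnj (\<eta> j), 1:]"])
  finally show ?thesis .
qed

lemma qpoly_cnj: "qpoly I (\<lambda>i\<in>I. cnj (\<eta> i)) = qpoly I \<eta>"
proof -
  have "qpoly I (\<lambda>i\<in>I. cnj (\<eta> i)) = qpoly I (\<lambda>i. cnj (\<eta> i))"
    by (rule qpoly_cong) simp
  also have "\<dots> = qpoly I \<eta>"
    unfolding qpoly_def by (rule prod.cong) (auto simp: mult.commute simp del: mult_pCons_left mult_pCons_right)
  finally show ?thesis .
qed

section \<open>Measurability and positivity of the weights\<close>

lemma measurable_component_dA:
  "i \<in> I \<Longrightarrow> (\<lambda>\<eta>. \<eta> i) \<in> borel_measurable (PiM I (\<lambda>_. dA))"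
  by (metis measurable_component_singleton measurable_cong_sets sets_dA)

lemma measurable_weight:
  assumes Q [measurable]: "Q \<in> borel_measurable borel" and "finite I"
  shows "weight Q c I \<in> borel_measurable (PiM I (\<lambda>_. dA))"
proof -
  note [measurable] = measurable_component_dA
  have [measurable]: "(\<lambda>\<eta>. onepoint Q c (\<eta> j)) \<in> borel_measurable (PiM I (\<lambda>_. dA))" if "j \<in> I" for j
    unfolding onepoint_def using that by measurable
  show ?thesis unfolding weight_def
    by (intro borel_measurable_times borel_measurable_prod) (auto intro!: borel_measurable_times borel_measurable_norm)
qed

lemma measurable_poly_qpoly:
  assumes "finite I"
  shows "(\<lambda>\<eta>. poly (qpoly I \<eta>) u) \<in> borel_measurable (PiM I (\<lambda>_. dA))"
  using measurable_coeff_qpoly[OF assms subset_refl]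
  by (simp add: poly_eq_sum_atMost[OF degree_qpoly[OF assms]])

lemma measurable_majorant:
  "(\<lambda>\<eta>. majorant I \<eta>) \<in> borel_measurable (PiM I (\<lambda>_. dA))"
  unfolding majorant_def using measurable_component_dA by (intro borel_measurable_prod) auto

text \<open>Centres on the imaginary axis at spacing 3 keep the unit discs disjoint, and
  \<open>b \<ge> 2\<close> keeps them off their mirror images and the real axis. A larger
  \<open>b\<close> lifts all discs above a prescribed point.\<close>

lemma weight_pos:
  assumes c: "\<And>j. c' j = \<i> * of_real (b + 3 * real j)" "2 \<le> b" and \<eta>: "\<eta> \<in> Pi\<^sub>E I (\<lambda>j. ball (c' j) 1)"
  shows "weight Q c I \<eta> > 0" and "j \<in> I \<Longrightarrow> Im (\<eta> j) > b - 1"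
proof -
  have Im: "\<bar>Im (\<eta> j) - (b + 3 * real j)\<bar> < 1" if "j \<in> I" for j
  proof -
    have "cmod (c' j - \<eta> j) < 1" using \<eta> that by (auto simp: PiE_iff dist_norm)
    then show ?thesis using abs_Im_le_cmod[of "c' j - \<eta> j"] by (simp add: c(1))
  qed
  have Im_gt: "Im (\<eta> j) > b - 1" if "j \<in> I" for j 
    using Im[OF that] by (simp add: abs_less_iff)
  then show "j \<in> I \<Longrightarrow> Im (\<eta> j) > b - 1" by simp
  have ne: "\<eta> j \<noteq> \<eta> k" if "j \<in> I" "k \<in> I" "j \<noteq> k" for j k
  proof
    assume "\<eta> j = \<eta> k"
    then have "\<bar>3 * (real j - real k)\<bar> < 2" using Im[OF that(1)] Im[OF that(2)] by simp
    moreover have "\<bar>real j - real k\<bar> \<ge> 1" using that(3) by linarith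
    ultimately show False by simp
  qed
  have ne_cnj: "\<eta> j \<noteq> cnj (\<eta> k)" if "j \<in> I" "k \<in> I" for j k
    using Im_gt[OF that(1)] Im_gt[OF that(2)] c(2) by (auto simp: complex_eq_iff)
  show "weight Q c I \<eta> > 0"
    unfolding weight_def onepoint_def
    using ne ne_cnj by (intro mult_pos_pos prod_pos ballI) auto
qed

text \<open>\<open>pint\<close> is the (unnormalised) one-point function without the factor \<open>onepoint\<close>;
  it is a polynomial in \<open>u\<close> and \<open>cnj u\<close>.\<close>

definition pint :: "(complex \<Rightarrow> real) \<Rightarrow> real \<Rightarrow> nat set \<Rightarrow> complex \<Rightarrow> real" where
  "pint Q c I u = (\<integral>\<eta>. (cmod (poly (qpoly I \<eta>) u))\<^sup>2 * weight Q c I \<eta> \<partial>PiM I (\<lambda>_. dA))"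

definition moment :: "(complex \<Rightarrow> real) \<Rightarrow> real \<Rightarrow> nat set \<Rightarrow> nat \<Rightarrow> nat \<Rightarrow> complex" where
  "moment Q c I m n = (\<integral>\<eta>. coeff (qpoly I \<eta>) m * cnj (coeff (qpoly I \<eta>) n) * of_real (weight Q c I \<eta>) \<partial>PiM I (\<lambda>_. dA))"

text \<open>With \<open>f m = u ^ m\<close> and \<open>g n = cnj u ^ n\<close> this is \<open>pint\<close>; the other choices are derivatives.\<close>

definition bisum :: "(complex \<Rightarrow> real) \<Rightarrow> real \<Rightarrow> nat set \<Rightarrow> (nat \<Rightarrow> complex) \<Rightarrow> (nat \<Rightarrow> complex) \<Rightarrow> complex" where
  "bisum Q c I f g = (\<Sum>m\<le>2 * card I. \<Sum>n\<le>2 * card I. moment Q c I m n * f m * g n)"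

text \<open>\<open>finite_nn\<close> is the single source of integrability: every integrand below is
  dominated by a multiple of \<open>majorant\<close> squared times the weight.\<close>

locale finite_moment =
  fixes Q :: "complex \<Rightarrow> real" and c :: real and I :: "nat set"
  assumes Q_measurable: "Q \<in> borel_measurable borel" and finite_I: "finite I"
    and finite_nn: "(\<integral>\<^sup>+\<eta>. ennreal ((majorant I \<eta>)\<^sup>2 * weight Q c I \<eta>) \<partial>PiM I (\<lambda>_. dA)) < \<infinity>"
begin

lemma integrable_majorant: "integrable (PiM I (\<lambda>_. dA)) (\<lambda>\<eta>. (majorant I \<eta>)\<^sup>2 * weight Q c I \<eta>)"
proof (rule integrableI_nonneg)
  note [measurable] = measurable_weight[OF Q_measurable finite_I] measurable_majorant
  show "(\<lambda>\<eta>. (majorant I \<eta>)\<^sup>2 * weight Q c I \<eta>) \<in> borel_measurable (PiM I (\<lambda>_. dA))"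
    by measurable
qed (use finite_nn weight_nonneg in auto)

lemma integrable_weight:
  fixes g :: "(nat \<Rightarrow> complex) \<Rightarrow> complex"
  assumes [measurable]: "g \<in> borel_measurable (PiM I (\<lambda>_. dA))" and "\<And>\<eta>. cmod (g \<eta>) \<le> C * (majorant I \<eta>)\<^sup>2"
  shows "integrable (PiM I (\<lambda>_. dA)) (\<lambda>\<eta>. g \<eta> * of_real (weight Q c I \<eta>))"
proof (rule Bochner_Integration.integrable_bound)
  note [measurable] = measurable_weight[OF Q_measurable finite_I]
  show "integrable (PiM I (\<lambda>_. dA)) (\<lambda>\<eta>. C * ((majorant I \<eta>)\<^sup>2 * weight Q c I \<eta>))"
    by (intro integrable_mult_right integrable_majorant)
  show "AE \<eta> in PiM I (\<lambda>_. dA). norm (g \<eta> * of_real (weight Q c I \<eta>)) \<le> norm (C * ((majorant I \<eta>)\<^sup>2 * weight Q c I \<eta>))"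
  proof (rule AE_I2)
    fix \<eta>
    have "cmod (g \<eta>) * weight Q c I \<eta> \<le> C * (majorant I \<eta>)\<^sup>2 * weight Q c I \<eta>"
      by (intro mult_right_mono assms weight_nonneg)
    also have "\<dots> \<le> \<bar>C * (majorant I \<eta>)\<^sup>2 * weight Q c I \<eta>\<bar>" by (rule abs_ge_self)
    finally show "norm (g \<eta> * of_real (weight Q c I \<eta>)) \<le> norm (C * ((majorant I \<eta>)\<^sup>2 * weight Q c I \<eta>))"
      using weight_nonneg[of Q c I \<eta>] by (simp add: norm_mult mult.assoc)
  qed
  show "(\<lambda>\<eta>. g \<eta> * of_real (weight Q c I \<eta>)) \<in> borel_measurable (PiM I (\<lambda>_. dA))"
    by measurable
qed

lemma integrable_moment:
  "integrable (PiM I (\<lambda>_. dA)) (\<lambda>\<eta>. coeff (qpoly I \<eta>) m * cnj (coeff (qpoly I \<eta>) n) * of_real (weight Q c I \<eta>))"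
proof (rule integrable_weight)
  note [measurable] = measurable_coeff_qpoly[OF finite_I subset_refl]
  show "(\<lambda>\<eta>. coeff (qpoly I \<eta>) m * cnj (coeff (qpoly I \<eta>) n)) \<in> borel_measurable (PiM I (\<lambda>_. dA))"
    by measurable
  fix \<eta>
  have "cmod (coeff (qpoly I \<eta>) m) * cmod (coeff (qpoly I \<eta>) n) \<le> majorant I \<eta> * majorant I \<eta>"
    by (intro mult_mono coeff_qpoly_le finite_I majorant_nonneg) auto
  then show "cmod (coeff (qpoly I \<eta>) m * cnj (coeff (qpoly I \<eta>) n)) \<le> 1 * (majorant I \<eta>)\<^sup>2"
    by (simp add: norm_mult power2_eq_square)
qed

text \<open>The double sum factors under the integral into one polynomial expression and the
  conjugate of another. Derivative coefficients in \<open>f\<close> thus produce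
  \<open>pderiv\<close> in the first factor only.\<close>

lemma bisum_eq_integral:
  "bisum Q c I f (\<lambda>n. cnj (g n)) = (\<integral>\<eta>. (\<Sum>m\<le>2 * card I. coeff (qpoly I \<eta>) m * f m) *
     cnj (\<Sum>n\<le>2 * card I. coeff (qpoly I \<eta>) n * g n) * of_real (weight Q c I \<eta>) \<partial>PiM I (\<lambda>_. dA))"
proof -
  have gen: "(\<integral>\<eta>. (\<Sum>m\<in>A. \<Sum>n\<in>B. h m n \<eta> * k m n) \<partial>M) = (\<Sum>m\<in>A. \<Sum>n\<in>B. integral\<^sup>L M (h m n) * k m n)"
    if "\<And>m n. integrable M (h m n)"
    for A B :: "nat set" and h :: "nat \<Rightarrow> nat \<Rightarrow> (nat \<Rightarrow> complex) \<Rightarrow> complex" and k M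
    using that by simp
  have "bisum Q c I f (\<lambda>n. cnj (g n)) = (\<integral>\<eta>. (\<Sum>m\<le>2 * card I. \<Sum>n\<le>2 * card I.
     (coeff (qpoly I \<eta>) m * cnj (coeff (qpoly I \<eta>) n) * of_real (weight Q c I \<eta>)) * (f m * cnj (g n))) \<partial>PiM I (\<lambda>_. dA))"
    unfolding gen[OF integrable_moment] by (simp add: bisum_def moment_def mult.assoc)
  also have "\<dots> = (\<integral>\<eta>. (\<Sum>m\<le>2 * card I. coeff (qpoly I \<eta>) m * f m) *
     cnj (\<Sum>n\<le>2 * card I. coeff (qpoly I \<eta>) n * g n) * of_real (weight Q c I \<eta>) \<partial>PiM I (\<lambda>_. dA))"
  proof (intro Bochner_Integration.integral_cong refl)
    have expand: "(\<Sum>m\<in>A. a m) * cnj (\<Sum>n\<in>A. b n) * W = (\<Sum>m\<in>A. \<Sum>n\<in>A. a m * cnj (b n) * W)"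
      for A :: "nat set" and a b W
      by (subst cnj_sum, subst sum_product) (simp only: sum_distrib_right)
    show "(\<Sum>m\<le>2 * card I. \<Sum>n\<le>2 * card I. coeff (qpoly I \<eta>) m * cnj (coeff (qpoly I \<eta>) n) * of_real (weight Q c I \<eta>) * (f m * cnj (g n))) =
        (\<Sum>m\<le>2 * card I. coeff (qpoly I \<eta>) m * f m) * cnj (\<Sum>n\<le>2 * card I. coeff (qpoly I \<eta>) n * g n) * of_real (weight Q c I \<eta>)" for \<eta>
      unfolding expand by (intro sum.cong refl) simp
  qed
  finally show ?thesis .
qed

lemma pint_eq_bisum: "of_real (pint Q c I u) = bisum Q c I (\<lambda>m. u ^ m) (\<lambda>n. cnj u ^ n)"
proof -
  have "bisum Q c I (\<lambda>m. u ^ m) (\<lambda>n. cnj (u ^ n)) =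
      (\<integral>\<eta>. poly (qpoly I \<eta>) u * cnj (poly (qpoly I \<eta>) u) * of_real (weight Q c I \<eta>) \<partial>PiM I (\<lambda>_. dA))"
    unfolding bisum_eq_integral by (simp add: poly_eq_sum_atMost[OF degree_qpoly[OF finite_I]])
  also have "\<dots> = (\<integral>\<eta>. of_real ((cmod (poly (qpoly I \<eta>) u))\<^sup>2 * weight Q c I \<eta>) \<partial>PiM I (\<lambda>_. dA))"
    by (intro Bochner_Integration.integral_cong refl) (simp only: of_real_mult complex_norm_square)
  also have "\<dots> = of_real (pint Q c I u)"
    unfolding pint_def by (rule integral_complex_of_real)
  finally show ?thesis by simp
qed

lemma bisum_deriv_eq_integral:
  "bisum Q c I (\<lambda>m. of_nat m * u ^ (m - 1)) (\<lambda>n. cnj u ^ n) =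
    (\<integral>\<eta>. poly (pderiv (qpoly I \<eta>)) u * cnj (poly (qpoly I \<eta>) u) * of_real (weight Q c I \<eta>) \<partial>PiM I (\<lambda>_. dA))"
  using bisum_eq_integral[of "\<lambda>m. of_nat m * u ^ (m - 1)" "\<lambda>n. u ^ n"]
  by (simp add: poly_eq_sum_atMost[OF degree_qpoly[OF finite_I]] poly_pderiv_eq_sum_atMost[OF degree_qpoly[OF finite_I]])

lemma integrable_pint:
  "integrable (PiM I (\<lambda>_. dA)) (\<lambda>\<eta>. complex_of_real ((cmod (poly (qpoly I \<eta>) u))\<^sup>2 * weight Q c I \<eta>))"
proof -
  note [measurable] = measurable_poly_qpoly[OF finite_I]
  have "integrable (PiM I (\<lambda>_. dA)) (\<lambda>\<eta>. complex_of_real ((cmod (poly (qpoly I \<eta>) u))\<^sup>2) * of_real (weight Q c I \<eta>))"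
  proof (rule integrable_weight)
    fix \<eta>
    have "(cmod (poly (qpoly I \<eta>) u))\<^sup>2 \<le> ((1 + cmod u) ^ (2 * card I) * majorant I \<eta>)\<^sup>2"
      by (intro power_mono poly_qpoly_le finite_I) auto
    then show "cmod (complex_of_real ((cmod (poly (qpoly I \<eta>) u))\<^sup>2)) \<le> ((1 + cmod u) ^ (2 * card I))\<^sup>2 * (majorant I \<eta>)\<^sup>2"
      by (simp add: power_mult_distrib norm_power)
  qed measurable
  then show ?thesis by simp
qed

lemma integrable_pint_real:
  "integrable (PiM I (\<lambda>_. dA)) (\<lambda>\<eta>. (cmod (poly (qpoly I \<eta>) u))\<^sup>2 * weight Q c I \<eta>)"
  using integrable_pint[of u] by (simp only: complex_of_real_integrable_eq)

text \<open>Only one of the two factors \<open>|q|\<close> has to absorb the pole, which may sit at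
  the particle or at its mirror image.\<close>

lemma integrable_pint_div:
  assumes "j \<in> I" and a: "\<And>\<eta>. a \<eta> = \<eta> j \<or> a \<eta> = cnj (\<eta> j)"
    and a_meas: "a \<in> borel_measurable (PiM I (\<lambda>_. dA))"
  shows "integrable (PiM I (\<lambda>_. dA)) (\<lambda>\<eta>. of_real ((cmod (poly (qpoly I \<eta>) u))\<^sup>2 * weight Q c I \<eta>) / (u - a \<eta>))"
proof -
  note [measurable] = measurable_poly_qpoly[OF finite_I] a_meas
  have "integrable (PiM I (\<lambda>_. dA)) (\<lambda>\<eta>. complex_of_real ((cmod (poly (qpoly I \<eta>) u))\<^sup>2) / (u - a \<eta>) * of_real (weight Q c I \<eta>))"
  proof (rule integrable_weight)
    fix \<eta>
    let ?p = "poly (qpoly I \<eta>) u" and ?K = "(1 + cmod u) ^ (2 * card I)"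
    have "cmod (of_real ((cmod ?p)\<^sup>2) / (u - a \<eta>)) = cmod ?p * cmod (?p / (u - a \<eta>))"
      by (simp add: norm_divide power2_eq_square norm_mult)
    also have "\<dots> \<le> (?K * majorant I \<eta>) * (?K * majorant I \<eta>)"
      by (intro mult_mono poly_qpoly_le poly_qpoly_div_le[OF finite_I \<open>j \<in> I\<close> a] finite_I) (auto simp: majorant_nonneg)
    finally show "cmod (of_real ((cmod ?p)\<^sup>2) / (u - a \<eta>)) \<le> ?K\<^sup>2 * (majorant I \<eta>)\<^sup>2"
      by (simp add: power2_eq_square ac_simps)
  qed measurable
  then show ?thesis by simp
qed

text \<open>Apply the transposition of \<open>i\<close> and \<open>j\<close>, then simultaneous
  conjugation of all particles; both preserve the measure, the weight and
  \<open>qpoly\<close>.\<close>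

lemma pint_div_symmetric:
  assumes Q: "\<And>u. Q (cnj u) = Q u" and ij: "i \<in> I" "j \<in> I"
  shows "(\<integral>\<eta>. of_real ((cmod (poly (qpoly I \<eta>) u))\<^sup>2 * weight Q c I \<eta>) / (u - \<eta> j) \<partial>PiM I (\<lambda>_. dA)) =
     (\<integral>\<eta>. of_real ((cmod (poly (qpoly I \<eta>) u))\<^sup>2 * weight Q c I \<eta>) / (u - \<eta> i) \<partial>PiM I (\<lambda>_. dA))"
    and "(\<integral>\<eta>. of_real ((cmod (poly (qpoly I \<eta>) u))\<^sup>2 * weight Q c I \<eta>) / (u - cnj (\<eta> j)) \<partial>PiM I (\<lambda>_. dA)) =
     (\<integral>\<eta>. of_real ((cmod (poly (qpoly I \<eta>) u))\<^sup>2 * weight Q c I \<eta>) / (u - \<eta> j) \<partial>PiM I (\<lambda>_. dA))"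
proof -
  let ?f = "\<lambda>j \<eta>. complex_of_real ((cmod (poly (qpoly I \<eta>) u))\<^sup>2 * weight Q c I \<eta>) / (u - \<eta> j)"
  note [measurable] = measurable_poly_qpoly[OF finite_I] measurable_component_dA measurable_weight[OF Q_measurable finite_I]
  have f: "?f j \<in> borel_measurable (PiM I (\<lambda>_. dA))" if "j \<in> I" for j
    using that by measurable
  define \<pi> where "\<pi> = Transposition.transpose i j"
  have \<pi>: "bij_betw \<pi> I I"
    unfolding \<pi>_def using ij by (intro permutes_imp_bij permutes_swap_id)
  have "(\<integral>\<eta>. ?f j (\<lambda>k\<in>I. id (\<eta> (\<pi> k))) \<partial>PiM I (\<lambda>_. dA)) = (\<integral>\<eta>. ?f j \<eta> \<partial>PiM I (\<lambda>_. dA))"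
    by (rule integral_PiM_dA_reindex[OF finite_I \<pi> _ _ f[OF ij(2)]]) (simp_all add: distr_id2 id_def)
  moreover have "?f j (\<lambda>k\<in>I. id (\<eta> (\<pi> k))) = ?f i \<eta>" for \<eta>
    using ij by (simp add: weight_permute[OF \<pi>] qpoly_permute[OF \<pi>]) (simp add: \<pi>_def)
  ultimately show "(\<integral>\<eta>. ?f j \<eta> \<partial>PiM I (\<lambda>_. dA)) = (\<integral>\<eta>. ?f i \<eta> \<partial>PiM I (\<lambda>_. dA))"
    by simp
  have "(\<integral>\<eta>. ?f j (\<lambda>k\<in>I. cnj (\<eta> (id k))) \<partial>PiM I (\<lambda>_. dA)) = (\<integral>\<eta>. ?f j \<eta> \<partial>PiM I (\<lambda>_. dA))"
    by (rule integral_PiM_dA_reindex[OF finite_I bij_betw_id _ _ f[OF ij(2)]]) (simp_all add: distr_dA_cnj)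
  moreover have "?f j (\<lambda>k\<in>I. cnj (\<eta> (id k))) =
      of_real ((cmod (poly (qpoly I \<eta>) u))\<^sup>2 * weight Q c I \<eta>) / (u - cnj (\<eta> j))" for \<eta>
    using ij by (simp add: weight_cnj[of Q, OF Q] qpoly_cnj)
  ultimately show "(\<integral>\<eta>. of_real ((cmod (poly (qpoly I \<eta>) u))\<^sup>2 * weight Q c I \<eta>) / (u - cnj (\<eta> j)) \<partial>PiM I (\<lambda>_. dA)) =
     (\<integral>\<eta>. ?f j \<eta> \<partial>PiM I (\<lambda>_. dA))"
    by simp
qed

text \<open>Symmetrisation: the logarithmic derivative of \<open>qpoly\<close> has \<open>2 * card I\<close> terms, all with the same integral.\<close>

lemma card_pint_div:
  assumes Q: "\<And>u. Q (cnj u) = Q u" and i: "i \<in> I"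
  shows "2 * of_nat (card I) * (\<integral>\<eta>. of_real ((cmod (poly (qpoly I \<eta>) u))\<^sup>2 * weight Q c I \<eta>) / (u - \<eta> i) \<partial>PiM I (\<lambda>_. dA)) =
    bisum Q c I (\<lambda>m. of_nat m * u ^ (m - 1)) (\<lambda>n. cnj u ^ n)"
proof -
  let ?W = "\<lambda>\<eta>. complex_of_real ((cmod (poly (qpoly I \<eta>) u))\<^sup>2 * weight Q c I \<eta>)"
  let ?J = "\<integral>\<eta>. ?W \<eta> / (u - \<eta> i) \<partial>PiM I (\<lambda>_. dA)"
  note m = measurable_component_dA
  have "bisum Q c I (\<lambda>m. of_nat m * u ^ (m - 1)) (\<lambda>n. cnj u ^ n) =
      (\<integral>\<eta>. (\<Sum>j\<in>I. ?W \<eta> / (u - \<eta> j) + ?W \<eta> / (u - cnj (\<eta> j))) \<partial>PiM I (\<lambda>_. dA))"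
    unfolding bisum_deriv_eq_integral
  proof (intro Bochner_Integration.integral_cong refl)
    fix \<eta>
    let ?p = "poly (qpoly I \<eta>) u"
    show "poly (pderiv (qpoly I \<eta>)) u * cnj ?p * of_real (weight Q c I \<eta>) =
       (\<Sum>j\<in>I. ?W \<eta> / (u - \<eta> j) + ?W \<eta> / (u - cnj (\<eta> j)))"
    \<comment> \<open>If \<open>?p = 0\<close> then both sides are 0, even where a denominator
      vanishes, because every numerator contains \<open>?p\<close> or its conjugate. Otherwise
      \<open>u\<close> avoids all zeros and the logarithmic derivative is available.\<close>
    proof (cases "?p = 0")
      case False
      then have ne: "u \<noteq> \<eta> j \<and> u \<noteq> cnj (\<eta> j)" if "j \<in> I" for j
        using that finite_I by (auto simp: poly_qpoly)
      have W: "?W \<eta> = ?p * cnj ?p * of_real (weight Q c I \<eta>)"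
        by (simp only: of_real_mult complex_norm_square)
      have "(\<Sum>j\<in>I. ?W \<eta> / (u - \<eta> j) + ?W \<eta> / (u - cnj (\<eta> j))) = ?W \<eta> * (\<Sum>j\<in>I. 1 / (u - \<eta> j) + 1 / (u - cnj (\<eta> j)))"
        by (simp add: sum_distrib_left distrib_left)
      also have "\<dots> = poly (pderiv (qpoly I \<eta>)) u * cnj ?p * of_real (weight Q c I \<eta>)"
        unfolding W using poly_pderiv_qpoly[OF finite_I ne] by simp
      finally show ?thesis ..
    qed simp
  qed
  also have "\<dots> = (\<Sum>j\<in>I. (\<integral>\<eta>. ?W \<eta> / (u - \<eta> j) \<partial>PiM I (\<lambda>_. dA)) + (\<integral>\<eta>. ?W \<eta> / (u - cnj (\<eta> j)) \<partial>PiM I (\<lambda>_. dA)))"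
  proof -
    have 1: "integrable (PiM I (\<lambda>_. dA)) (\<lambda>\<eta>. ?W \<eta> / (u - \<eta> j))" if "j \<in> I" for j
      by (rule integrable_pint_div[OF that]) (use m[OF that] in auto)
    have 2: "integrable (PiM I (\<lambda>_. dA)) (\<lambda>\<eta>. ?W \<eta> / (u - cnj (\<eta> j)))" if "j \<in> I" for j
    proof (rule integrable_pint_div[OF that])
      note [measurable] = m[OF that]
      show "(\<lambda>\<eta>. cnj (\<eta> j)) \<in> borel_measurable (PiM I (\<lambda>_. dA))" by measurable
    qed auto
    show ?thesis
      by (subst Bochner_Integration.integral_sum)
         (auto intro!: Bochner_Integration.integrable_add Bochner_Integration.integral_add sum.cong 1 2 simp del: of_real_mult)
  qed
  also have "\<dots> = (\<Sum>j\<in>I. ?J + ?J)"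
    by (intro sum.cong refl arg_cong2[where f = "(+)"])
       (simp_all only: pint_div_symmetric(1)[OF Q i] pint_div_symmetric(2)[OF Q i])
  also have "\<dots> = 2 * of_nat (card I) * ?J" by simp
  finally show ?thesis ..
qed

end

section \<open>The ensemble\<close>

locale symplectic_ensemble =
  fixes Q :: "complex \<Rightarrow> real" and N :: nat
  assumes Q_cont: "continuous_on UNIV Q" and Q_cnj: "\<And>u. Q (cnj u) = Q u"
    and N: "1 \<le> N" and Z_finite: "Z_part Q N < \<infinity>"
begin

text \<open>Particle 0 is the one held at \<open>u\<close>; these are the others.\<close>

abbreviation I :: "nat set" where "I \<equiv> {Suc 0..<N}"
abbreviation wt :: "(nat \<Rightarrow> complex) \<Rightarrow> real" where "wt \<equiv> weight Q (real N) I"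
abbreviation dI :: "(nat \<Rightarrow> complex) measure" where "dI \<equiv> PiM I (\<lambda>_. dA)"
abbreviation sq :: "complex \<Rightarrow> (nat \<Rightarrow> complex) \<Rightarrow> real" where "sq u \<eta> \<equiv> (cmod (poly (qpoly I \<eta>) u))\<^sup>2 * wt \<eta>"

lemma Q_meas [measurable]: "Q \<in> borel_measurable borel"
  by (rule borel_measurable_continuous_onI[OF Q_cont])

lemma onepoint_meas [measurable]: "onepoint Q c \<in> borel_measurable borel"
  unfolding onepoint_def by measurable

lemma insert_0_I: "insert 0 I = {..<N}"
  using N by auto

lemma measurable_sq: "sq u \<in> borel_measurable dI"
proof -
  note [measurable] = measurable_poly_qpoly[of I u] measurable_weight[of Q I "real N"]
  show ?thesis by measurable
qed

lemma weight_fun_upd_0: "weight Q (real N) {..<N} (\<eta>(0 := u)) = onepoint Q (real N) u * sq u \<eta>"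
proof -
  have q: "qpoly I (\<eta>(0 := u)) = qpoly I \<eta>" by (rule qpoly_cong) auto
  have w: "weight Q (real N) I (\<eta>(0 := u)) = wt \<eta>" by (rule weight_cong) auto
  show ?thesis
    unfolding insert_0_I[symmetric] by (subst weight_insert) (simp_all only: q w fun_upd_same mult.assoc, auto)
qed

text \<open>Fubini in its nonnegative form with particle 0 outermost, since no integrability of the
  inner integral is known at this stage.\<close>

lemma Z_part_eq: "Z_part Q N = (\<integral>\<^sup>+u. ennreal (onepoint Q (real N) u) * (\<integral>\<^sup>+\<eta>. ennreal (sq u \<eta>) \<partial>dI) \<partial>dA)"
proof -
  note [measurable] = measurable_weight[of Q "{..<N}" "real N"]
  have "Z_part Q N = (\<integral>\<^sup>+\<eta>. ennreal (weight Q (real N) {..<N} \<eta>) \<partial>PiM (insert 0 I) (\<lambda>_. dA))"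
    unfolding Z_part_def boltzmann_eq_weight insert_0_I ..
  also have "\<dots> = (\<integral>\<^sup>+u. (\<integral>\<^sup>+\<eta>. ennreal (weight Q (real N) {..<N} (\<eta>(0 := u))) \<partial>dI) \<partial>dA)"
    by (rule dA.product_nn_integral_insert_rev) (auto simp: insert_0_I)
  also have "\<dots> = (\<integral>\<^sup>+u. ennreal (onepoint Q (real N) u) * (\<integral>\<^sup>+\<eta>. ennreal (sq u \<eta>) \<partial>dI) \<partial>dA)"
    unfolding weight_fun_upd_0 ennreal_mult'[OF onepoint_nonneg]
    by (intro nn_integral_cong nn_integral_cmult measurable_compose[OF measurable_sq measurable_ennreal])
  finally show ?thesis .
qed

text \<open>\<open>onepoint\<close> is positive off the real axis, so a finite \<open>Z_part\<close>
  makes the inner integral finite almost everywhere in the upper half-plane. Were the good points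
  finite in number, they would form a null set, yet the unit disc around \<open>2 * \<i>\<close> has
  mass 1.\<close>

lemma infinite_good_points: "infinite {u. 0 < Im u \<and> (\<integral>\<^sup>+\<eta>. ennreal (sq u \<eta>) \<partial>dI) < \<infinity>}" (is "infinite ?G")
proof
  assume fin: "finite ?G"
  have [measurable]: "(\<lambda>u. \<integral>\<^sup>+\<eta>. ennreal (sq u \<eta>) \<partial>dI) \<in> borel_measurable dA"
  proof -
    interpret sigma_finite_measure dI by (rule dA.sigma_finite) simp
    have [measurable]: "(\<lambda>p. coeff (qpoly I (snd p)) m) \<in> borel_measurable (dA \<Otimes>\<^sub>M dI)" for m
      by (rule measurable_compose[OF measurable_snd measurable_coeff_qpoly]) auto
    have [measurable]: "(\<lambda>p. wt (snd p)) \<in> borel_measurable (dA \<Otimes>\<^sub>M dI)"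
      by (rule measurable_compose[OF measurable_snd measurable_weight]) auto
    have [measurable]: "fst \<in> borel_measurable (dA \<Otimes>\<^sub>M dI)"
      using measurable_fst[of dA dI] by (simp cong: measurable_cong_sets)
    have "(\<lambda>p. ennreal ((cmod (\<Sum>m\<le>2 * card I. coeff (qpoly I (snd p)) m * fst p ^ m))\<^sup>2 * wt (snd p))) \<in> borel_measurable (dA \<Otimes>\<^sub>M dI)"
      by measurable
    then have "(\<lambda>(u, \<eta>). ennreal (sq u \<eta>)) \<in> borel_measurable (dA \<Otimes>\<^sub>M dI)"
      by (simp only: poly_eq_sum_atMost[OF degree_qpoly[OF finite_atLeastLessThan]] case_prod_unfold)
    then show ?thesis by (rule borel_measurable_nn_integral)
  qed
  have "AE u in dA. ennreal (onepoint Q (real N) u) * (\<integral>\<^sup>+\<eta>. ennreal (sq u \<eta>) \<partial>dI) \<noteq> \<infinity>"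
    using Z_finite unfolding Z_part_eq
    by (intro nn_integral_PInf_AE) auto
  moreover have "AE u in dA. \<forall>g\<in>?G. u \<noteq> g"
    using fin by (intro AE_finite_allI AE_dA_neq)
  ultimately have "AE u in dA. \<not> 0 < Im u"
  proof eventually_elim
    case (elim u)
    show ?case
    proof
      assume u: "0 < Im u"
      then have "u \<noteq> cnj u" by (auto simp: complex_eq_iff)
      then have "0 < onepoint Q (real N) u" by (simp add: onepoint_def)
      then have "(\<integral>\<^sup>+\<eta>. ennreal (sq u \<eta>) \<partial>dI) \<noteq> \<infinity>"
        using elim(1) by (auto simp: ennreal_mult_eq_top_iff)
      then have "u \<in> ?G" using u by (simp add: less_top)
      then show False using elim(2) by blast
    qed
  qed
  then have "AE u in dA. u \<notin> ball (2 * \<i>) 1"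
  proof eventually_elim
    case (elim u)
    show ?case
    proof
      assume "u \<in> ball (2 * \<i>) 1"
      then show False using elim abs_Im_le_cmod[of "2 * \<i> - u"] by (auto simp: dist_norm)
    qed
  qed
  then have "emeasure dA (ball (2 * \<i>) 1) = 0"
    by (subst (asm) AE_iff_measurable[OF _ refl]) (auto elim!: back_subst[of "\<lambda>X. emeasure _ X = 0"])
  then show False by (simp add: emeasure_dA_ball)
qed

text \<open>There are N - 1 particles in \<open>I\<close>, so N good points satisfy the pigeonhole
  condition, and the integral is dominated by a multiple of a sum of N finite ones.\<close>

sublocale finite_moment Q "real N" I
proof
  obtain S where S: "S \<subseteq> {u. 0 < Im u \<and> (\<integral>\<^sup>+\<eta>. ennreal (sq u \<eta>) \<partial>dI) < \<infinity>}" "finite S" "card S = N"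
    using infinite_arbitrarily_large[OF infinite_good_points] by blast
  obtain K where K: "0 \<le> K" "\<And>\<eta>. (majorant I \<eta>)\<^sup>2 \<le> K * (\<Sum>s\<in>S. (cmod (poly (qpoly I \<eta>) s))\<^sup>2)"
    using majorant_le_sum_poly[of I S] S N by (auto simp: subset_iff)
  have "(\<integral>\<^sup>+\<eta>. ennreal ((majorant I \<eta>)\<^sup>2 * wt \<eta>) \<partial>dI) \<le> (\<integral>\<^sup>+\<eta>. ennreal K * (\<Sum>s\<in>S. ennreal (sq s \<eta>)) \<partial>dI)"
  proof (rule nn_integral_mono)
    fix \<eta>
    have "(majorant I \<eta>)\<^sup>2 * wt \<eta> \<le> K * (\<Sum>s\<in>S. (cmod (poly (qpoly I \<eta>) s))\<^sup>2) * wt \<eta>"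
      by (intro mult_right_mono K weight_nonneg)
    also have "\<dots> = K * (\<Sum>s\<in>S. sq s \<eta>)" by (simp add: sum_distrib_right)
    finally show "ennreal ((majorant I \<eta>)\<^sup>2 * wt \<eta>) \<le> ennreal K * (\<Sum>s\<in>S. ennreal (sq s \<eta>))"
      using K(1) weight_nonneg by (simp add: sum_ennreal sum_nonneg ennreal_leI flip: ennreal_mult)
  qed
  also have "\<dots> = ennreal K * (\<Sum>s\<in>S. (\<integral>\<^sup>+\<eta>. ennreal (sq s \<eta>) \<partial>dI))"
    using measurable_sq by (simp add: nn_integral_cmult nn_integral_sum)
  also have "\<dots> < \<infinity>"
    using S by (auto simp: ennreal_mult_less_top subset_iff)
  finally show "(\<integral>\<^sup>+\<eta>. ennreal ((majorant I \<eta>)\<^sup>2 * wt \<eta>) \<partial>dI) < \<infinity>" .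
qed auto

abbreviation ker :: "complex \<Rightarrow> real" where "ker \<equiv> pint Q (real N) I"

lemma ker_nonneg: "0 \<le> ker u"
  unfolding pint_def by (intro integral_nonneg_AE) (auto simp: weight_nonneg)

lemma nn_integral_sq: "(\<integral>\<^sup>+\<eta>. ennreal (sq u \<eta>) \<partial>dI) = ennreal (ker u)"
  unfolding pint_def by (rule nn_integral_eq_integral[OF integrable_pint_real]) (auto simp: weight_nonneg)

lemma ker_pos:
  assumes "u \<notin> \<real>"
  shows "0 < ker u"
proof -
  \<comment> \<open>All particles then have height above \<open>|u| + 1\<close>, so neither they nor
    their mirror images hit \<open>u\<close>.\<close>
  define b where "b = cmod u + 2"
  define c' where "c' = (\<lambda>j. \<i> * of_real (b + 3 * real j))"
  have "0 < (\<integral>\<^sup>+\<eta>. ennreal (sq u \<eta>) \<partial>dI)"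
  proof (rule nn_integral_PiM_dA_pos[where c = c'])
    show "(\<lambda>\<eta>. ennreal (sq u \<eta>)) \<in> borel_measurable dI" using measurable_sq by measurable
    fix \<eta> assume \<eta>: "\<eta> \<in> Pi\<^sub>E I (\<lambda>j. ball (c' j) 1)"
    note * = weight_pos[where c' = c' and b = b and I = I and \<eta> = \<eta>, OF _ _ \<eta>]
    have "Im (\<eta> j) > cmod u + 1" if "j \<in> I" for j
      using *(2)[OF _ _ that] by (simp add: c'_def b_def)
    then have "u \<noteq> \<eta> j \<and> u \<noteq> cnj (\<eta> j)" if "j \<in> I" for j
      using that abs_Im_le_cmod[of u] by force
    then have "poly (qpoly I \<eta>) u \<noteq> 0" by (auto simp: poly_qpoly)
    moreover have "0 < wt \<eta>" by (rule *(1)) (auto simp: c'_def b_def)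
    ultimately show "0 < ennreal (sq u \<eta>)" by simp
  qed simp
  then show ?thesis unfolding nn_integral_sq by simp
qed

lemma Z_pos: "0 < Z_part Q N"
proof -
  define c' where "c' = (\<lambda>j. \<i> * of_real (2 + 3 * real j))"
  show ?thesis
    unfolding Z_part_def boltzmann_eq_weight
  proof (rule nn_integral_PiM_dA_pos[where c = c'])
    note [measurable] = measurable_weight[of Q "{..<N}" "real N"]
    show "(\<lambda>\<eta>. ennreal (weight Q (real N) {..<N} \<eta>)) \<in> borel_measurable (PiM {..<N} (\<lambda>_. dA))" by measurable
    fix \<eta> assume \<eta>: "\<eta> \<in> Pi\<^sub>E {..<N} (\<lambda>j. ball (c' j) 1)"
    have "weight Q (real N) {..<N} \<eta> > 0"
      by (rule weight_pos(1)[OF _ _ \<eta>, where b = 2]) (auto simp: c'_def)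
    then show "0 < ennreal (weight Q (real N) {..<N} \<eta>)" by simp
  qed simp
qed

abbreviation Z :: real where "Z \<equiv> enn2real (Z_part Q N)"

lemma Z_real_pos: "0 < Z"
  using Z_pos Z_finite by (simp add: enn2real_positive_iff)

lemma corr_one: "corr Q N [u] = real N / Z * onepoint Q (real N) u * ker u"
proof -
  have "boltzmann Q N (\<lambda>j. if j < 1 then [u] ! j else \<eta> j) = onepoint Q (real N) u * sq u \<eta>" for \<eta>
  proof -
    have "(\<lambda>j. if j < 1 then [u] ! j else \<eta> j) = \<eta>(0 := u)" by (auto simp: fun_eq_iff)
    then show ?thesis by (simp add: boltzmann_eq_weight weight_fun_upd_0)
  qed
  moreover have "fact N / fact (N - 1) = real N"
    using N by (simp add: fact_reduce[of N])
  ultimately show ?thesis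
    using N by (simp add: corr_def pint_def)
qed

lemma continuous_ker: "continuous_on UNIV ker"
proof -
  have "ker = (\<lambda>u. Re (bisum Q (real N) I (\<lambda>m. u ^ m) (\<lambda>n. cnj u ^ n)))"
    by (rule ext) (metis Re_complex_of_real pint_eq_bisum)
  then show ?thesis
    unfolding bisum_def by (auto intro!: continuous_intros)
qed

text \<open>Integrating out the last free particle gives back the partition function times
  \<open>N / Z\<close>, which is finite.\<close>

lemma integrable_corr_one: "integrable dA (\<lambda>u. complex_of_real (corr Q N [u]))"
proof (intro integrable_of_real integrableI_nonneg)
  have [measurable]: "ker \<in> borel_measurable borel"
    by (rule borel_measurable_continuous_onI[OF continuous_ker])
  show "(\<lambda>u. corr Q N [u]) \<in> borel_measurable dA" unfolding corr_one by measurable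
  show "AE u in dA. 0 \<le> corr Q N [u]"
    by (rule AE_I2) (simp add: corr_one ker_nonneg onepoint_nonneg)
  have "(\<integral>\<^sup>+u. ennreal (corr Q N [u]) \<partial>dA) = (\<integral>\<^sup>+u. ennreal (real N / Z) * (ennreal (onepoint Q (real N) u) * ennreal (ker u)) \<partial>dA)"
    by (intro nn_integral_cong) (simp add: corr_one ker_nonneg onepoint_nonneg mult.assoc flip: ennreal_mult)
  also have "\<dots> = ennreal (real N / Z) * Z_part Q N"
    unfolding Z_part_eq nn_integral_sq by (rule nn_integral_cmult) measurable
  also have "\<dots> < \<infinity>" using Z_finite by (simp add: ennreal_mult_less_top)
  finally show "(\<integral>\<^sup>+u. ennreal (corr Q N [u]) \<partial>dA) < \<infinity>" .
qed

text \<open>The second point stays inside the weight as coordinate 1, so that integrating over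
  \<open>w\<close> restores an integral over all of \<open>I\<close>.\<close>

lemma corr_two:
  assumes "2 \<le> N"
  shows "corr Q N [u, w] = real N * real (N - 1) / Z * onepoint Q (real N) u *
    (\<integral>\<eta>. sq u (\<eta>(1 := w)) \<partial>PiM {2..<N} (\<lambda>_. dA))"
proof -
  have "boltzmann Q N (\<lambda>j. if j < 2 then [u, w] ! j else \<eta> j) = onepoint Q (real N) u * sq u (\<eta>(1 := w))" for \<eta>
  proof -
    have "(\<lambda>j. if j < 2 then [u, w] ! j else \<eta> j) = (\<eta>(1 := w))(0 := u)"
      by (auto simp: fun_eq_iff less_2_cases_iff)
    then show ?thesis by (simp only: boltzmann_eq_weight weight_fun_upd_0)
  qed
  moreover have "fact N / fact (N - 2) = real N * real (N - 1)"
  proof -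
    obtain n where "N = Suc (Suc n)" using assms by (metis add_2_eq_Suc le_Suc_ex)
    then show ?thesis by simp
  qed
  ultimately show ?thesis
    using assms by (simp add: corr_def numeral_2_eq_2[symmetric])
qed

text \<open>Integration over \<open>w\<close> puts particle 1 back among the integrated ones and
  leaves the pole at \<open>\<eta> 1\<close>. The combinatorial factor N - 1 is
  \<open>card I\<close>, so symmetrisation yields half of the differentiated sum.\<close>

lemma
  shows integrable_corr_two: "integrable dA (\<lambda>w. complex_of_real (corr Q N [u, w]) / (u - w))"
    and integral_corr_two: "(\<integral>w. complex_of_real (corr Q N [u, w]) / (u - w) \<partial>dA) =
      of_real (real N / Z * onepoint Q (real N) u) * bisum Q (real N) I (\<lambda>m. of_nat m * u ^ (m - 1)) (\<lambda>n. cnj u ^ n) / 2"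
proof -
  let ?B = "bisum Q (real N) I (\<lambda>m. of_nat m * u ^ (m - 1)) (\<lambda>n. cnj u ^ n)"
  have "integrable dA (\<lambda>w. complex_of_real (corr Q N [u, w]) / (u - w)) \<and>
    (\<integral>w. complex_of_real (corr Q N [u, w]) / (u - w) \<partial>dA) = of_real (real N / Z * onepoint Q (real N) u) * ?B / 2"
  proof (cases "2 \<le> N")
    \<comment> \<open>For a single particle the two-point function is 0, and the sum consists of its
      term \<open>m = 0\<close>, which carries the factor 0.\<close>
    case False
    then have "N = 1" using N by simp
    then show ?thesis by (simp add: corr_def bisum_def)
  next
    case True
    let ?J = "{2..<N}"
    let ?f = "\<lambda>\<eta>. complex_of_real (sq u \<eta>) / (u - \<eta> 1)"
    have IJ: "insert 1 ?J = I" using True by auto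
    have 1: "1 \<in> I" using True by simp
    have J: "finite ?J" "1 \<notin> ?J" by auto
    have f: "integrable (PiM (insert 1 ?J) (\<lambda>_. dA)) ?f"
      unfolding IJ using measurable_component_dA[OF 1] by (intro integrable_pint_div[OF 1]) auto
    have eq: "complex_of_real (corr Q N [u, w]) / (u - w) =
        of_real (real N * real (N - 1) / Z * onepoint Q (real N) u) * (\<integral>\<eta>. ?f (\<eta>(1 := w)) \<partial>PiM ?J (\<lambda>_. dA))" for w
      unfolding corr_two[OF True] fun_upd_same integral_divide_zero integral_complex_of_real by simp
    show ?thesis
    proof
      show "integrable dA (\<lambda>w. complex_of_real (corr Q N [u, w]) / (u - w))"
        unfolding eq by (intro integrable_mult_right integrable_PiM_insert[OF J f])
      have "(\<integral>w. complex_of_real (corr Q N [u, w]) / (u - w) \<partial>dA) =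
          of_real (real N * real (N - 1) / Z * onepoint Q (real N) u) * (\<integral>\<eta>. ?f \<eta> \<partial>dI)"
        unfolding eq integral_mult_right_zero integral_PiM_insert[OF J f] IJ ..
      also have "\<dots> = of_real (real N / Z * onepoint Q (real N) u) * (2 * of_nat (card I) * (\<integral>\<eta>. ?f \<eta> \<partial>dI)) / 2"
        by simp
      also have "\<dots> = of_real (real N / Z * onepoint Q (real N) u) * ?B / 2"
        unfolding card_pint_div[OF Q_cnj 1] ..
      finally show "(\<integral>w. complex_of_real (corr Q N [u, w]) / (u - w) \<partial>dA) =
          of_real (real N / Z * onepoint Q (real N) u) * ?B / 2" .
    qed
  qed
  then show "integrable dA (\<lambda>w. complex_of_real (corr Q N [u, w]) / (u - w))"
    and "(\<integral>w. complex_of_real (corr Q N [u, w]) / (u - w) \<partial>dA) = of_real (real N / Z * onepoint Q (real N) u) * ?B / 2"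
    by auto
qed

end

section \<open>Wirtinger derivatives\<close>

text \<open>Every real-linear map of the plane has this form with unique \<open>a\<close> and
  \<open>b\<close>. The functions \<open>partial_z\<close> and \<open>partial_zbar\<close> are total
  and do not certify differentiability, so the calculus is developed for this predicate and their
  values are read off afterwards.\<close>

definition has_wirt :: "(complex \<Rightarrow> complex) \<Rightarrow> complex \<Rightarrow> complex \<Rightarrow> complex \<Rightarrow> bool" where
  "has_wirt f a b z \<longleftrightarrow> (f has_derivative (\<lambda>h. a * h + b * cnj h)) (at z)"

lemma has_wirt_imp_differentiable: "has_wirt f a b z \<Longrightarrow> f differentiable (at z)"
  by (auto simp: has_wirt_def differentiable_def)

lemma
  assumes "has_wirt f a b z"
  shows has_wirt_imp_partial_z: "partial_z f z = a" and has_wirt_imp_partial_zbar: "partial_zbar f z = b"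
proof -
  have *: "vector_derivative (\<lambda>t::real. f (z + c * of_real t)) (at 0) = a * c + b * cnj c" for c
  proof (rule vector_derivative_at)
    have f: "(f has_derivative (\<lambda>h. a * h + b * cnj h)) (at (z + c * of_real 0))"
      using assms by (simp add: has_wirt_def)
    have g: "((\<lambda>t::real. z + c * of_real t) has_derivative (\<lambda>t. c * of_real t)) (at 0)"
      by (auto intro!: derivative_eq_intros)
    have "((\<lambda>t::real. f (z + c * of_real t)) has_derivative (\<lambda>t. a * (c * of_real t) + b * cnj (c * of_real t))) (at 0)"
      by (rule has_derivative_compose[OF g f])
    then show "((\<lambda>t::real. f (z + c * of_real t)) has_vector_derivative a * c + b * cnj c) (at 0)"
      unfolding has_vector_derivative_def
      by (rule has_derivative_eq_rhs) (auto simp: scaleR_conv_of_real algebra_simps)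
  qed
  have x: "partial_x f z = a + b" using *[of 1] by (simp add: partial_x_def)
  have y: "partial_y f z = \<i> * (a - b)" using *[of \<i>] by (simp add: partial_y_def algebra_simps)
  show "partial_z f z = a" "partial_zbar f z = b"
    by (simp_all add: partial_z_def partial_zbar_def x y algebra_simps)
qed

lemma differentiable_imp_has_wirt:
  assumes "f differentiable (at z)"
  shows "has_wirt f (partial_z f z) (partial_zbar f z) z"
proof -
  obtain D where D: "(f has_derivative D) (at z)" using assms by (auto simp: differentiable_def)
  interpret D: bounded_linear D using D by (rule has_derivative_bounded_linear)
  have "D h = (D 1 - \<i> * D \<i>) / 2 * h + (D 1 + \<i> * D \<i>) / 2 * cnj h" for h
  proof -
    have "D h = D (Re h *\<^sub>R 1 + Im h *\<^sub>R \<i>)" by (rule arg_cong[where f = D]) (simp add: complex_eq_iff)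
    also have "\<dots> = of_real (Re h) * D 1 + of_real (Im h) * D \<i>"
      by (simp only: D.add D.scaleR) (simp only: scaleR_conv_of_real)
    also have "of_real (Re h) = (h + cnj h) / 2" by (simp add: complex_add_cnj)
    also have "of_real (Im h) = (h - cnj h) / (2 * \<i>)" by (simp add: complex_eq_iff)
    also have "(h + cnj h) / 2 * D 1 + (h - cnj h) / (2 * \<i>) * D \<i> = (D 1 - \<i> * D \<i>) / 2 * h + (D 1 + \<i> * D \<i>) / 2 * cnj h"
      by (simp add: field_simps)
    finally show ?thesis .
  qed
  then have "D = (\<lambda>h. (D 1 - \<i> * D \<i>) / 2 * h + (D 1 + \<i> * D \<i>) / 2 * cnj h)"
    by (rule ext)
  then have w: "has_wirt f ((D 1 - \<i> * D \<i>) / 2) ((D 1 + \<i> * D \<i>) / 2) z"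
    unfolding has_wirt_def by (rule has_derivative_eq_rhs[OF D])
  show ?thesis
    unfolding has_wirt_imp_partial_z[OF w] has_wirt_imp_partial_zbar[OF w] by (rule w)
qed

lemma has_wirt_eq_rhs: "has_wirt f a b z \<Longrightarrow> a = a' \<Longrightarrow> b = b' \<Longrightarrow> has_wirt f a' b' z"
  by simp

lemma has_wirt_transform:
  assumes "has_wirt f a b z" "open S" "z \<in> S" "\<And>u. u \<in> S \<Longrightarrow> f u = g u"
  shows "has_wirt g a b z"
  using has_derivative_transform_within_open[OF assms(1)[unfolded has_wirt_def] assms(2-4)]
  by (simp add: has_wirt_def)

lemma has_wirt_const: "has_wirt (\<lambda>_. c) 0 0 z"
  by (simp add: has_wirt_def)

lemma has_wirt_ident: "has_wirt (\<lambda>u. u) 1 0 z"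
  by (simp add: has_wirt_def)

lemma has_wirt_cnj: "has_wirt cnj 0 1 z"
  by (simp add: has_wirt_def bounded_linear_imp_has_derivative bounded_linear_cnj)

lemma has_wirt_add: "has_wirt f a b z \<Longrightarrow> has_wirt g c d z \<Longrightarrow> has_wirt (\<lambda>u. f u + g u) (a + c) (b + d) z"
  unfolding has_wirt_def by (drule (1) has_derivative_add) (simp add: algebra_simps)

lemma has_wirt_diff: "has_wirt f a b z \<Longrightarrow> has_wirt g c d z \<Longrightarrow> has_wirt (\<lambda>u. f u - g u) (a - c) (b - d) z"
  unfolding has_wirt_def by (drule (1) has_derivative_diff) (simp add: algebra_simps)

lemma has_wirt_mult:
  "has_wirt f a b z \<Longrightarrow> has_wirt g c d z \<Longrightarrow> has_wirt (\<lambda>u. f u * g u) (a * g z + f z * c) (b * g z + f z * d) z"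
  unfolding has_wirt_def by (drule (1) has_derivative_mult) (simp add: algebra_simps)

lemma has_wirt_cmult: "has_wirt f a b z \<Longrightarrow> has_wirt (\<lambda>u. k * f u) (k * a) (k * b) z"
  using has_wirt_mult[OF has_wirt_const[of k]] by simp

lemma has_wirt_sum:
  "(\<And>i. i \<in> A \<Longrightarrow> has_wirt (f i) (a i) (b i) z) \<Longrightarrow> has_wirt (\<lambda>u. \<Sum>i\<in>A. f i u) (\<Sum>i\<in>A. a i) (\<Sum>i\<in>A. b i) z"
  by (induction A rule: infinite_finite_induct) (auto intro: has_wirt_const has_wirt_add)

lemma has_wirt_compose:
  assumes "(g has_field_derivative D) (at (f z))" "has_wirt f a b z"
  shows "has_wirt (\<lambda>u. g (f u)) (D * a) (D * b) z"
  using has_derivative_compose[OF assms(2)[unfolded has_wirt_def] assms(1)[unfolded has_field_derivative_def]]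
  by (simp add: has_wirt_def algebra_simps)

lemma has_wirt_divide:
  assumes "has_wirt f a b z" "has_wirt g c d z" "g z \<noteq> 0"
  shows "has_wirt (\<lambda>u. f u / g u) ((a * g z - f z * c) / (g z)\<^sup>2) ((b * g z - f z * d) / (g z)\<^sup>2) z"
proof -
  have "has_wirt (\<lambda>u. inverse (g u)) (- (inverse (g z) ^ Suc (Suc 0)) * c) (- (inverse (g z) ^ Suc (Suc 0)) * d) z"
    by (rule has_wirt_compose[OF DERIV_inverse[OF assms(3)] assms(2)])
  from has_wirt_mult[OF assms(1) this] show ?thesis
    unfolding divide_inverse
    by (rule has_wirt_eq_rhs) (use assms(3) in \<open>simp_all add: field_simps power2_eq_square\<close>)
qed

lemma has_wirt_affine:
  assumes "has_wirt f a b (p + of_real r * z)"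
  shows "has_wirt (\<lambda>u. f (p + of_real r * u)) (of_real r * a) (of_real r * b) z"
proof -
  have g: "((\<lambda>u. p + of_real r * u) has_derivative (\<lambda>h. of_real r * h)) (at z)"
    by (auto intro!: derivative_eq_intros)
  show ?thesis
    using has_derivative_compose[OF g assms[unfolded has_wirt_def]]
    by (simp add: has_wirt_def algebra_simps)
qed

lemma DERIV_pow_complex: "((\<lambda>u::complex. u ^ m) has_field_derivative of_nat m * z ^ (m - 1)) (at z)"
  by (auto intro!: derivative_eq_intros)

lemma has_wirt_power: "has_wirt (\<lambda>u. u ^ m) (of_nat m * z ^ (m - 1)) 0 z"
  using has_wirt_compose[OF DERIV_pow_complex has_wirt_ident] by simp

lemma has_wirt_cnj_power: "has_wirt (\<lambda>u. cnj u ^ m) 0 (of_nat m * cnj z ^ (m - 1)) z"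
  using has_wirt_compose[OF DERIV_pow_complex has_wirt_cnj] by simp

text \<open>\<open>f\<close> varies holomorphically and \<open>g\<close> antiholomorphically, so
  each Wirtinger derivative acts on one slot.\<close>

lemma has_wirt_bisum:
  assumes "\<And>m. has_wirt (\<lambda>u. f u m) (a m) 0 z" "\<And>n. has_wirt (\<lambda>u. g u n) 0 (b n) z"
  shows "has_wirt (\<lambda>u. bisum Q c I (f u) (g u)) (bisum Q c I a (g z)) (bisum Q c I (f z) b) z"
  unfolding bisum_def
proof (intro has_wirt_sum)
  fix m n
  show "has_wirt (\<lambda>u. moment Q c I m n * f u m * g u n) (moment Q c I m n * a m * g z n) (moment Q c I m n * f z m * b n) z"
    by (rule has_wirt_eq_rhs, rule has_wirt_mult[OF has_wirt_cmult[OF assms(1)] assms(2)]) simp_all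
qed

text \<open>\<open>partial_zbar\<close> of the potential is a fixed linear combination of the
  derivative in the directions 1 and \<open>\<i>\<close>, hence differentiable itself. Of its two
  Wirtinger derivatives only the one equal to \<open>Lap\<close> has to be named.\<close>

lemma C2_smooth_has_wirt:
  assumes "C2_smooth Q"
  shows "has_wirt (\<lambda>u. of_real (Q u)) (partial_z (\<lambda>u. of_real (Q u)) z) (partial_zbar (\<lambda>u. of_real (Q u)) z) z"
    and "\<exists>b. has_wirt (partial_zbar (\<lambda>u. of_real (Q u))) (Lap (\<lambda>u. of_real (Q u)) z) b z"
    and "continuous_on UNIV Q"
proof -
  obtain Q' :: "complex \<Rightarrow> complex \<Rightarrow>\<^sub>L real" and Q'' :: "complex \<Rightarrow> complex \<Rightarrow>\<^sub>L complex \<Rightarrow>\<^sub>L real"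
    where Q': "\<And>z. (Q has_derivative blinfun_apply (Q' z)) (at z)"
      and Q'': "\<And>z. (Q' has_derivative blinfun_apply (Q'' z)) (at z)"
    using assms unfolding C2_smooth_def by blast
  let ?Q = "\<lambda>u. complex_of_real (Q u)"
  show "continuous_on UNIV Q"
    using Q' by (intro continuous_at_imp_continuous_on ballI has_derivative_continuous) auto
  have d: "(?Q has_derivative (\<lambda>h. of_real (Q' z h))) (at z)" for z
    by (rule has_derivative_of_real[OF Q'])
  then have diff: "?Q differentiable (at z)" for z by (auto simp: differentiable_def)
  show "has_wirt ?Q (partial_z ?Q z) (partial_zbar ?Q z) z"
    by (rule differentiable_imp_has_wirt[OF diff])
  have eq: "of_real (Q' z h) = partial_z ?Q z * h + partial_zbar ?Q z * cnj h" for z h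
    using has_derivative_unique[OF d differentiable_imp_has_wirt[OF diff, unfolded has_wirt_def]] by (rule fun_cong)
  have pzb: "partial_zbar ?Q = (\<lambda>z. (of_real (Q' z 1) + \<i> * of_real (Q' z \<i>)) / 2)"
    unfolding eq by (auto simp: fun_eq_iff algebra_simps)
  have "(\<lambda>z. complex_of_real (Q' z h)) differentiable (at z)" for h z
    using has_derivative_of_real[OF bounded_linear.has_derivative[OF blinfun.bounded_linear_left Q'']]
    by (auto simp: differentiable_def)
  then have "partial_zbar ?Q differentiable (at z)"
    unfolding pzb by (intro derivative_intros) auto
  from differentiable_imp_has_wirt[OF this] show "\<exists>b. has_wirt (partial_zbar ?Q) (Lap ?Q z) b z"
    unfolding Lap_def by blast
qed

section \<open>Ward's equation\<close>

context symplectic_ensemble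
begin

section \<open>Derivatives of the polynomial factor\<close>

abbreviation pow :: "complex \<Rightarrow> nat \<Rightarrow> complex" where "pow u m \<equiv> u ^ m"
abbreviation dpow :: "complex \<Rightarrow> nat \<Rightarrow> complex" where "dpow u m \<equiv> of_nat m * u ^ (m - 1)"
abbreviation bs :: "(nat \<Rightarrow> complex) \<Rightarrow> (nat \<Rightarrow> complex) \<Rightarrow> complex" where "bs \<equiv> bisum Q (real N) I"

lemma has_wirt_dpow: "\<exists>a. has_wirt (\<lambda>u. dpow u m) a 0 z" "\<exists>b. has_wirt (\<lambda>u. dpow (cnj u) m) 0 b z"
  using has_wirt_cmult[OF has_wirt_power[of "m - 1" z], of "of_nat m"] has_wirt_cmult[OF has_wirt_cnj_power[of "m - 1" z], of "of_nat m"]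
  by auto

lemma has_wirt_ker: "has_wirt (\<lambda>u. of_real (ker u)) (bs (dpow z) (pow (cnj z))) (bs (pow z) (dpow (cnj z))) z"
  unfolding pint_eq_bisum by (rule has_wirt_bisum[OF has_wirt_power has_wirt_cnj_power])

lemma has_wirt_ker_z: "\<exists>a. has_wirt (\<lambda>u. bs (dpow u) (pow (cnj u))) a (bs (dpow z) (dpow (cnj z))) z"
proof -
  have "\<exists>a. \<forall>m. has_wirt (\<lambda>u. dpow u m) (a m) 0 z"
    by (rule choice) (rule allI, rule has_wirt_dpow(1))
  then obtain a where a: "\<And>m. has_wirt (\<lambda>u. dpow u m) (a m) 0 z" by blast
  show ?thesis
    using has_wirt_bisum[where f = dpow and g = "\<lambda>u. pow (cnj u)", OF a has_wirt_cnj_power] by blast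
qed

lemma has_wirt_ker_zbar: "\<exists>b. has_wirt (\<lambda>u. bs (pow u) (dpow (cnj u))) (bs (dpow z) (dpow (cnj z))) b z"
proof -
  have "\<exists>b. \<forall>m. has_wirt (\<lambda>u. dpow (cnj u) m) 0 (b m) z"
    by (rule choice) (rule allI, rule has_wirt_dpow(2))
  then obtain b where b: "\<And>m. has_wirt (\<lambda>u. dpow (cnj u) m) 0 (b m) z" by blast
  show ?thesis
    using has_wirt_bisum[where f = pow and g = "\<lambda>u. dpow (cnj u)", OF has_wirt_power b] by blast
qed

end

locale smooth_symplectic_ensemble = symplectic_ensemble +
  assumes Q_C2: "C2_smooth Q"
begin

abbreviation Qc :: "complex \<Rightarrow> complex" where "Qc u \<equiv> of_real (Q u)"
abbreviation Rc :: "complex \<Rightarrow> complex" where "Rc u \<equiv> of_real (corr Q N [u])"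

section \<open>The one-point function and its logarithm\<close>

lemma corr_one_pos: "u \<notin> \<real> \<Longrightarrow> 0 < corr Q N [u]"
proof -
  assume u: "u \<notin> \<real>"
  then have "u \<noteq> cnj u" by (metis Reals_cnj_iff)
  then show ?thesis
    using ker_pos[OF u] Z_real_pos N by (simp add: corr_one onepoint_def)
qed

text \<open>\<open>u - cnj u\<close> is purely imaginary, so its squared modulus is minus its
  square, a polynomial to which the Wirtinger rules apply.\<close>

lemma Rc_eq: "Rc u = of_real (real N / Z) * ((- ((u - cnj u) ^ 2)) * exp (- real N * Qc u) * of_real (ker u))"
proof -
  have "complex_of_real ((cmod (u - cnj u))\<^sup>2) = - ((u - cnj u)\<^sup>2)"
    unfolding complex_norm_square by (simp add: power2_eq_square algebra_simps)
  moreover have "complex_of_real (exp (- real N * Q u)) = exp (- real N * Qc u)"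
    by (simp flip: exp_of_real)
  ultimately show ?thesis by (simp add: corr_one onepoint_def)
qed

lemma has_wirt_Rc:
  "\<exists>a. has_wirt Rc a (of_real (real N / Z) * exp (- real N * Qc z) * (2 * (z - cnj z) * of_real (ker z)
     - (z - cnj z)\<^sup>2 * (bs (pow z) (dpow (cnj z)) - real N * partial_zbar Qc z * of_real (ker z)))) z"
proof -
  have sq: "((\<lambda>v. - (v ^ 2)) has_field_derivative - (2 * (z - cnj z))) (at (z - cnj z))"
    by (auto intro!: derivative_eq_intros)
  have 1: "has_wirt (\<lambda>u. - ((u - cnj u) ^ 2)) (- (2 * (z - cnj z)) * (1 - 0)) (- (2 * (z - cnj z)) * (0 - 1)) z"
    by (rule has_wirt_compose[OF sq has_wirt_diff[OF has_wirt_ident has_wirt_cnj]])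
  have 2: "has_wirt (\<lambda>u. exp (- real N * Qc u)) (exp (- real N * Qc z) * (- real N * partial_z Qc z))
      (exp (- real N * Qc z) * (- real N * partial_zbar Qc z)) z"
    by (rule has_wirt_compose[OF DERIV_exp has_wirt_cmult[OF C2_smooth_has_wirt(1)[OF Q_C2]]])
  show ?thesis
    unfolding Rc_eq[abs_def]
    by (rule exI, rule has_wirt_eq_rhs, rule has_wirt_cmult, rule has_wirt_mult[OF has_wirt_mult[OF 1 2] has_wirt_ker], rule refl)
       (simp add: algebra_simps)
qed

text \<open>The three terms are the logarithmic derivatives of the three factors in
  \<open>Rc_eq\<close>. The complex \<open>Ln\<close> is used for the chain rule; at the positive
  values taken off the real axis it agrees with the real \<open>ln\<close>.\<close>

lemma has_wirt_ln_corr: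
  assumes "z \<notin> \<real>"
  shows "\<exists>a. has_wirt (\<lambda>u. of_real (ln (corr Q N [u]))) a
     (- 2 / (z - cnj z) - real N * partial_zbar Qc z + bs (pow z) (dpow (cnj z)) / of_real (ker z)) z"
proof -
  obtain a where a: "has_wirt Rc a (of_real (real N / Z) * exp (- real N * Qc z) * (2 * (z - cnj z) * of_real (ker z)
     - (z - cnj z)\<^sup>2 * (bs (pow z) (dpow (cnj z)) - real N * partial_zbar Qc z * of_real (ker z)))) z" (is "has_wirt _ _ ?b _")
    using has_wirt_Rc by blast
  have pos: "0 < corr Q N [z]" using corr_one_pos[OF assms] .
  then have "Rc z \<notin> \<real>\<^sub>\<le>\<^sub>0" by simp
  then have "(Ln has_field_derivative inverse (Rc z)) (at (Rc z))"
    by (rule has_field_derivative_Ln)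
  from has_wirt_compose[OF this a] have "has_wirt (\<lambda>u. Ln (Rc u)) (inverse (Rc z) * a) (inverse (Rc z) * ?b) z" .
  then have "has_wirt (\<lambda>u. of_real (ln (corr Q N [u]))) (inverse (Rc z) * a) (inverse (Rc z) * ?b) z"
    by (rule has_wirt_transform[where S = "- \<real>"])
       (use assms in \<open>auto simp: Ln_of_real corr_one_pos open_Compl closed_complex_Reals\<close>)
  moreover have "inverse (Rc z) * ?b = - 2 / (z - cnj z) - real N * partial_zbar Qc z + bs (pow z) (dpow (cnj z)) / of_real (ker z)"
  proof -
    have ne: "z - cnj z \<noteq> 0" "complex_of_real (ker z) \<noteq> 0" "complex_of_real (real N / Z) \<noteq> 0"
      using assms ker_pos[OF assms] Z_real_pos N by (auto simp: Reals_cnj_iff)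
    have "inverse (k * ((- (d ^ 2)) * e * F)) * (k * e * (2 * d * F - d\<^sup>2 * (B - n * q * F))) = - 2 / d - n * q + B / F"
      if "d \<noteq> 0" "F \<noteq> 0" "k \<noteq> 0" "e \<noteq> 0" for d F k e B n q :: complex
      using that by (simp add: field_simps power2_eq_square)
    from this[OF ne exp_not_eq_zero] show ?thesis unfolding Rc_eq .
  qed
  ultimately show ?thesis by auto
qed

lemma partial_zbar_ln_corr:
  assumes "z \<notin> \<real>"
  shows "partial_zbar (\<lambda>u. of_real (ln (corr Q N [u]))) z =
     - 2 / (z - cnj z) - real N * partial_zbar Qc z + bs (pow z) (dpow (cnj z)) / of_real (ker z)"
  using has_wirt_ln_corr[OF assms] has_wirt_imp_partial_zbar by blast

lemma has_wirt_partial_zbar_ln_corr: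
  assumes "z \<notin> \<real>"
  shows "\<exists>b. has_wirt (partial_zbar (\<lambda>u. of_real (ln (corr Q N [u]))))
     (2 / (z - cnj z)\<^sup>2 - real N * Lap Qc z +
      (bs (dpow z) (dpow (cnj z)) * of_real (ker z) - bs (pow z) (dpow (cnj z)) * bs (dpow z) (pow (cnj z))) / (of_real (ker z))\<^sup>2) b z"
proof -
  have ne: "z - cnj z \<noteq> 0" "complex_of_real (ker z) \<noteq> 0"
    using assms ker_pos[OF assms] by (auto simp: Reals_cnj_iff)
  obtain b1 where b1: "has_wirt (\<lambda>u. bs (pow u) (dpow (cnj u))) (bs (dpow z) (dpow (cnj z))) b1 z"
    using has_wirt_ker_zbar by blast
  obtain b2 where b2: "has_wirt (partial_zbar Qc) (Lap Qc z) b2 z"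
    using C2_smooth_has_wirt(2)[OF Q_C2] by blast
  note 1 = has_wirt_divide[OF has_wirt_const[of "- 2"] has_wirt_diff[OF has_wirt_ident has_wirt_cnj] ne(1)]
  note 2 = has_wirt_divide[OF b1 has_wirt_ker ne(2)]
  note 3 = has_wirt_add[OF has_wirt_diff[OF 1 has_wirt_cmult[OF b2, of "real N"]] 2]
  have S: "open (- \<real> :: complex set)" "z \<in> - \<real>"
    using assms by (auto simp: open_Compl closed_complex_Reals)
  show ?thesis
    \<comment> \<open>The explicit formula for the dbar derivative holds on the open complement of
      the real axis, so it may be differentiated at \<open>z\<close>.\<close>
    by (rule exI, rule has_wirt_eq_rhs[OF has_wirt_transform[OF 3 S]])
       (simp add: partial_zbar_ln_corr, simp, rule refl)
qed

lemma Lap_ln_corr: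
  assumes "z \<notin> \<real>"
  shows "Lap (\<lambda>u. of_real (ln (corr Q N [u]))) z = 2 / (z - cnj z)\<^sup>2 - real N * Lap Qc z +
      (bs (dpow z) (dpow (cnj z)) * of_real (ker z) - bs (pow z) (dpow (cnj z)) * bs (dpow z) (pow (cnj z))) / (of_real (ker z))\<^sup>2"
  using has_wirt_partial_zbar_ln_corr[OF assms] has_wirt_imp_partial_z unfolding Lap_def by blast

text \<open>The transform in unscaled coordinates; the rescaled one is \<open>r\<close> times this
  at \<open>p + r * z\<close>.\<close>

definition berezin_cauchy :: "complex \<Rightarrow> complex" where
  "berezin_cauchy u = (\<integral>w. of_real (corr Q N [w] - corr Q N [u, w] / corr Q N [u]) / (u - w) \<partial>dA)"

lemma Rc_differentiable: "Rc differentiable (at z)"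
  using has_wirt_Rc has_wirt_imp_differentiable by blast

text \<open>Both \<open>corr Q N [u]\<close> and the transform of the two-point function carry the
  factor \<open>N / Z * onepoint\<close>; it cancels and leaves half the logarithmic derivative of
  the kernel integral.\<close>

lemma
  assumes "u \<notin> \<real>"
  shows integrable_berezin_cauchy:
      "integrable dA (\<lambda>w. complex_of_real (corr Q N [w] - corr Q N [u, w] / corr Q N [u]) / (u - w))"
    and berezin_cauchy_eq: "berezin_cauchy u = cauchy_tr Rc u - bs (dpow u) (pow (cnj u)) / (2 * of_real (ker u))"
proof -
  have 1: "integrable dA (\<lambda>w. Rc w / (u - w))"
    using cauchy_tr_has_derivative(2)[OF integrable_corr_one Rc_differentiable[of u]] by auto
  have 2: "integrable dA (\<lambda>w. inverse (Rc u) * (complex_of_real (corr Q N [u, w]) / (u - w)))"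
    by (intro integrable_mult_right integrable_corr_two)
  have eq: "complex_of_real (corr Q N [w] - corr Q N [u, w] / corr Q N [u]) / (u - w) =
      Rc w / (u - w) - inverse (Rc u) * (complex_of_real (corr Q N [u, w]) / (u - w))" for w
    by (simp add: divide_inverse algebra_simps)
  show "integrable dA (\<lambda>w. complex_of_real (corr Q N [w] - corr Q N [u, w] / corr Q N [u]) / (u - w))"
    unfolding eq by (intro Bochner_Integration.integrable_diff 1 2)
  have ne: "onepoint Q (real N) u \<noteq> 0" "ker u \<noteq> 0"
    using corr_one_pos[OF assms] by (auto simp: corr_one)
  have "berezin_cauchy u = cauchy_tr Rc u - inverse (Rc u) * (\<integral>w. complex_of_real (corr Q N [u, w]) / (u - w) \<partial>dA)"
    unfolding berezin_cauchy_def eq cauchy_tr_def integral_mult_right_zero[symmetric]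
    by (rule Bochner_Integration.integral_diff[OF 1 2])
  also have "inverse (Rc u) * (\<integral>w. complex_of_real (corr Q N [u, w]) / (u - w) \<partial>dA) =
      bs (dpow u) (pow (cnj u)) / (2 * of_real (ker u))"
    unfolding integral_corr_two corr_one using ne Z_real_pos N by (simp add: field_simps)
  finally show "berezin_cauchy u = cauchy_tr Rc u - bs (dpow u) (pow (cnj u)) / (2 * of_real (ker u))" .
qed

lemma has_wirt_berezin_cauchy:
  assumes "z \<notin> \<real>"
  shows "\<exists>a. has_wirt berezin_cauchy a (Rc z - real N / 2 * Lap Qc z
     - 1 / 2 * Lap (\<lambda>u. of_real (ln (corr Q N [u]))) z + 1 / (z - cnj z)\<^sup>2) z"
proof -
  have ne: "z - cnj z \<noteq> 0" "2 * complex_of_real (ker z) \<noteq> 0"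
    using assms ker_pos[OF assms] by (auto simp: Reals_cnj_iff)
  obtain \<alpha> where "(cauchy_tr Rc has_derivative (\<lambda>d. \<alpha> * d + Rc z * cnj d)) (at z)"
    using cauchy_tr_has_derivative(1)[OF integrable_corr_one Rc_differentiable[of z]] by blast
  then have 1: "has_wirt (cauchy_tr Rc) \<alpha> (Rc z) z" by (simp add: has_wirt_def)
  obtain a where a: "has_wirt (\<lambda>u. bs (dpow u) (pow (cnj u))) a (bs (dpow z) (dpow (cnj z))) z"
    using has_wirt_ker_z by blast
  note 2 = has_wirt_diff[OF 1 has_wirt_divide[OF a has_wirt_cmult[OF has_wirt_ker, of 2] ne(2)]]
  have S: "open (- \<real> :: complex set)" "z \<in> - \<real>"
    using assms by (auto simp: open_Compl closed_complex_Reals)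
  \<comment> \<open>\<open>A\<close> is the mixed second derivative of \<open>F\<close>,
    \<open>B\<close> its holomorphic and \<open>C\<close> its antiholomorphic first derivative. The
    left side is what differentiation produces; the right side contains half of the Laplacian of the
    log one-point function.\<close>
  have alg: "R - (A * (2 * F) - B * (2 * C)) / (2 * F)\<^sup>2 = R - n / 2 * L - 1 / 2 * (2 / d\<^sup>2 - n * L + (A * F - C * B) / F\<^sup>2) + 1 / d\<^sup>2"
    if "d \<noteq> 0" "F \<noteq> 0" for A B C F R n L d :: complex
    using that by (simp add: field_simps power2_eq_square)
  have ne2: "complex_of_real (ker z) \<noteq> 0" using ne by simp
  show ?thesis
    by (rule exI, rule has_wirt_eq_rhs[OF has_wirt_transform[OF 2 S]])
       (simp add: berezin_cauchy_eq, rule refl, simp only: Lap_ln_corr[OF assms] of_real_divide of_real_numeral alg[OF ne(1) ne2])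
qed

text \<open>Two powers of \<open>r\<close> come from the Berezin kernel, a quotient of orders 4 and
  2, and the third from rescaling the Cauchy kernel.\<close>

lemma berezin_eq:
  assumes r: "r > 0" and u: "p + of_real r * z = u" "u \<notin> \<real>"
  shows "complex_of_real (berezin Q N p r z w) / (z - w) =
    of_real (r ^ 3) * (\<lambda>w'. of_real (corr Q N [w'] - corr Q N [u, w'] / corr Q N [u]) / (u - w')) (p + of_real r * w)"
proof -
  let ?w = "of_real p + of_real r * w"
  have R: "corr Q N [u] \<noteq> 0" using corr_one_pos[OF u(2)] by simp
  have b: "berezin Q N p r z w = r\<^sup>2 * (corr Q N [?w] - corr Q N [u, ?w] / corr Q N [u])"
  proof -
    have "(r\<^sup>2 * A * (r\<^sup>2 * B) - r ^ 4 * C) / (r\<^sup>2 * A) = r\<^sup>2 * (B - C / A)" if "A \<noteq> 0" for A B C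
      using r that by (simp add: field_simps power2_eq_square power4_eq_xxxx)
    from this[OF R, of "corr Q N [?w]" "corr Q N [u, ?w]"] show ?thesis
      by (simp add: berezin_def R1_def corr_resc_def u(1))
  qed
  have d: "u - ?w = of_real r * (z - w)" using u(1) by (auto simp: algebra_simps)
  show ?thesis
    unfolding b d using r by (simp add: power2_eq_square power3_eq_cube)
qed

end

theorem proposition2p10:
  fixes Q :: "complex \<Rightarrow> real" and N :: nat and p r :: real and z :: complex
  assumes "C2_smooth Q"
    and "\<And>\<zeta>. Q (cnj \<zeta>) = Q \<zeta>"
    and "N \<ge> 1"
    and "Z_part Q N < \<infinity>"
    and "micro_scale Q N p r"
    and "z \<notin> \<real>"
  shows
    "R1 Q N p r z > 0 \<and>
     integrable dA (\<lambda>w. of_real (berezin Q N p r z w) / (z - w)) \<and>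
     cauchy_transf Q N p r differentiable (at z) \<and>
     (\<lambda>u. complex_of_real (ln (R1 Q N p r u))) differentiable (at z) \<and>
     partial_zbar (\<lambda>u. of_real (ln (R1 Q N p r u))) differentiable (at z) \<and>
     partial_zbar (cauchy_transf Q N p r) z =
       of_real (R1 Q N p r z)
       - of_real (real N * r\<^sup>2 / 2) * Lap (\<lambda>\<zeta>. of_real (Q \<zeta>)) (of_real p + of_real r * z)
       - 1 / 2 * Lap (\<lambda>u. of_real (ln (R1 Q N p r u))) z
       + 1 / (z - cnj z)\<^sup>2"
proof -
  interpret smooth_symplectic_ensemble Q N
    by unfold_locales (use assms C2_smooth_has_wirt(3) in auto)
  have r: "r > 0" using assms(5) by (simp add: micro_scale_def)
  let ?T = "\<lambda>u. complex_of_real p + of_real r * u"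
  have T: "?T u \<notin> \<real>" if "u \<notin> \<real>" for u
    using that r by (simp add: complex_is_Real_iff)
  have R1: "R1 Q N p r u = r\<^sup>2 * corr Q N [?T u]" for u
    by (simp add: R1_def corr_resc_def)
  have R1_pos: "R1 Q N p r u > 0" if "u \<notin> \<real>" for u
    unfolding R1 using corr_one_pos[OF T[OF that]] r by simp
  let ?K = "\<lambda>u w'. complex_of_real (corr Q N [w'] - corr Q N [u, w'] / corr Q N [u]) / (u - w')"
  have K_int: "integrable dA (?K (?T u))" if "u \<notin> \<real>" for u
    by (rule integrable_berezin_cauchy[OF T[OF that]])
  then have K_meas: "?K (?T u) \<in> borel_measurable borel" if "u \<notin> \<real>" for u
    using borel_measurable_integrable[OF K_int[OF that]] by simp
  have B: "complex_of_real (berezin Q N p r u w) / (u - w) = of_real (r ^ 3) * ?K (?T u) (?T w)" if "u \<notin> \<real>" for u w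
    using berezin_eq[OF r refl T[OF that], of w] by simp
  have int: "integrable dA (\<lambda>w. complex_of_real (berezin Q N p r z w) / (z - w))"
    unfolding B[OF assms(6)]
    by (intro integrable_mult_right integrable_dA_scale[OF K_meas[OF assms(6)] r, THEN iffD2] K_int[OF assms(6)])
  have C: "cauchy_transf Q N p r u = of_real r * berezin_cauchy (?T u)" if "u \<notin> \<real>" for u
  proof -
    have "cauchy_transf Q N p r u = of_real (r ^ 3) * (\<integral>w. ?K (?T u) (?T w) \<partial>dA)"
      unfolding cauchy_transf_def B[OF that] by (rule integral_mult_right_zero)
    \<comment> \<open>The Jacobian of the dilation removes two of the three powers of
      \<open>r\<close>.\<close>
    also have "(\<integral>w. ?K (?T u) (?T w) \<partial>dA) = (1 / r\<^sup>2) *\<^sub>R berezin_cauchy (?T u)"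
      unfolding berezin_cauchy_def by (rule integral_dA_scale[OF K_meas[OF that] r])
    finally show ?thesis using r by (simp add: scaleR_conv_of_real power2_eq_square power3_eq_cube)
  qed
  have open_S: "open (- \<real> :: complex set)" by (simp add: open_Compl closed_complex_Reals)
  obtain a where a: "has_wirt berezin_cauchy a (Rc (?T z) - real N / 2 * Lap Qc (?T z)
     - 1 / 2 * Lap (\<lambda>u. of_real (ln (corr Q N [u]))) (?T z) + 1 / (?T z - cnj (?T z))\<^sup>2) (?T z)"
    using has_wirt_berezin_cauchy[OF T[OF assms(6)]] by blast
  note C_wirt = has_wirt_transform[OF has_wirt_cmult[OF has_wirt_affine[OF a], of "of_real r"] open_S, of "cauchy_transf Q N p r"]
  \<comment> \<open>Besides the change of variable, rescaling adds a constant to the logarithm,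
    which derivatives ignore.\<close>
  have ln_R1: "of_real (ln (r\<^sup>2)) + complex_of_real (ln (corr Q N [?T u])) = of_real (ln (R1 Q N p r u))" if "u \<notin> \<real>" for u
    unfolding R1 using corr_one_pos[OF T[OF that]] r by (simp add: ln_mult)
  have L_wirt: "\<exists>a. has_wirt (\<lambda>u. of_real (ln (R1 Q N p r u))) a (of_real r * partial_zbar (\<lambda>u. of_real (ln (corr Q N [u]))) (?T u)) u"
    if u: "u \<notin> \<real>" for u
  proof -
    obtain a where "has_wirt (\<lambda>u. of_real (ln (corr Q N [u]))) a (partial_zbar (\<lambda>u. of_real (ln (corr Q N [u]))) (?T u)) (?T u)"
      using has_wirt_ln_corr[OF T[OF u]] unfolding partial_zbar_ln_corr[OF T[OF u]] by blast
    note w = has_wirt_add[OF has_wirt_const[of "of_real (ln (r\<^sup>2))"] has_wirt_affine[OF this]]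
    have S: "u \<in> - \<real>" using u by simp
    show ?thesis
      by (rule exI, rule has_wirt_eq_rhs[OF has_wirt_transform[OF w open_S S]])
         (rule ln_R1, simp, rule refl, simp)
  qed
  then have zbar_L: "partial_zbar (\<lambda>u. of_real (ln (R1 Q N p r u))) u = of_real r * partial_zbar (\<lambda>u. of_real (ln (corr Q N [u]))) (?T u)"
    if "u \<notin> \<real>" for u
    using has_wirt_imp_partial_zbar that by blast
  obtain b where b: "has_wirt (partial_zbar (\<lambda>u. of_real (ln (corr Q N [u])))) (Lap (\<lambda>u. of_real (ln (corr Q N [u]))) (?T z)) b (?T z)"
    using has_wirt_partial_zbar_ln_corr[OF T[OF assms(6)]] unfolding Lap_ln_corr[OF T[OF assms(6)]] by blast
  have LL_wirt: "has_wirt (partial_zbar (\<lambda>u. of_real (ln (R1 Q N p r u))))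
      (of_real r * (of_real r * Lap (\<lambda>u. of_real (ln (corr Q N [u]))) (?T z))) (of_real r * (of_real r * b)) z"
    by (rule has_wirt_transform[OF has_wirt_cmult[OF has_wirt_affine[OF b], of "of_real r"] open_S])
       (use assms(6) zbar_L in auto)
  have Lap_L: "Lap (\<lambda>u. of_real (ln (R1 Q N p r u))) z = of_real (r\<^sup>2) * Lap (\<lambda>u. of_real (ln (corr Q N [u]))) (?T z)"
    using has_wirt_imp_partial_z[OF LL_wirt] by (simp add: Lap_def power2_eq_square)
  have C_wirt': "has_wirt (cauchy_transf Q N p r) (of_real r * (of_real r * a)) (of_real r * (of_real r * (Rc (?T z) - real N / 2 * Lap Qc (?T z)
     - 1 / 2 * Lap (\<lambda>u. of_real (ln (corr Q N [u]))) (?T z) + 1 / (?T z - cnj (?T z))\<^sup>2))) z"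
    by (rule C_wirt) (use assms(6) C in auto)
  have d: "?T z - cnj (?T z) = of_real r * (z - cnj z)" by (simp add: algebra_simps)
  have "partial_zbar (cauchy_transf Q N p r) z =
       of_real (R1 Q N p r z)
       - of_real (real N * r\<^sup>2 / 2) * Lap Qc (?T z)
       - 1 / 2 * Lap (\<lambda>u. of_real (ln (R1 Q N p r u))) z
       + 1 / (z - cnj z)\<^sup>2"
  proof -
    have ne: "z - cnj z \<noteq> 0" using assms(6) by (auto simp: Reals_cnj_iff)
    \<comment> \<open>One \<open>r\<close> stems from the rescaled transform, the other from the
      chain rule. Together they turn \<open>corr\<close> into \<open>R1\<close> and the Laplacian of
      its logarithm into the rescaled one, and cancel in the last term.\<close>
    have alg: "of_real r * (of_real r * (X - of_real (n / 2) * L - 1 / 2 * M + 1 / (of_real r * d)\<^sup>2)) =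
        of_real (r\<^sup>2 * x) - of_real (n * r\<^sup>2 / 2) * L - 1 / 2 * (of_real (r\<^sup>2) * M) + 1 / d\<^sup>2"
      if "d \<noteq> 0" "X = of_real x" for X L M d :: complex and n x
      using that r by (simp add: field_simps power2_eq_square)
    show ?thesis
      unfolding has_wirt_imp_partial_zbar[OF C_wirt'] Lap_L d R1[of z] by (rule alg[OF ne refl])
  qed
  then show ?thesis
    using R1_pos[OF assms(6)] int has_wirt_imp_differentiable[OF C_wirt'] L_wirt[OF assms(6)]
      has_wirt_imp_differentiable[OF LL_wirt] has_wirt_imp_differentiable
    by blast
qed

end
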